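(* Let $E(X,Y)$ be an $L_0$-formula with exactly two free concept variables which is provably an equivalence relation. The following are equivalent: (1) $A[E]$ is naturally relatively categorical; (2) $A[E]$ is injection invariant on abstracts, i.e. $A[E]$ proves $\forall\,\text{injection }\iota:V\to V\ \forall X\subseteq\mathrm{rng}(\partial)\ E(X,\overline{\iota}(X))$; (3) $A[E]$ is cardinality coarsening on abstracts, i.e. $A[E]$ proves $\forall X,Y\,((Y\approx X\wedge X\subseteq\mathrm{rng}(\partial))\to E(X,Y))$.
   Context: Work in many-sorted second-order logic with Henkin semantics. The signature $L_0$ has a sort of objects and, for each $n\ge1$, a sort of $n$-ary relations (unary relations are called concepts); its only non-logical symbols are the predication relations $R(x_1,\dots,x_n)$ (no constants, functions or other relations). A model is $(M,S_1[M],S_2[M],\dots)$ with $M\ne\emptyset$, $S_n[M]\subseteq P(M^n)$ and predication interpreted by membership. Every theory considered contains, in its own signature: the full comprehension schema $\exists X\forall x(Xx\leftrightarrow\Phi(x))$ (and its $n$-ary analogues) for all formulas $\Phi$ (parameters allowed, $X$ not free); the choice schema AC: $[\forall\bar x\,\exists R'\,\varphi(R',\bar x)]\to\exists R\,\forall\bar x\,\varphi(R[\bar x],\bar x)$ with $R[\bar x]=\{\bar y:R\bar x\bar y\}$; and global choice GC: a new binary relation symbol $<$ on objects with axioms saying $<$ is a linear order and, for each formula $\varphi(x)$ of the expanded signature (with parameters), $\exists x\varphi(x)\to\exists x(\varphi(x)\wedge\forall y<x\,\neg\varphi(y))$. "Provable" refers to the (complete) deductive system of this second-order logic. Notation: $V=\{x:x=x\}$;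 functions are identified with their graphs (relations of the model); $X\approx Y$ means there is a bijection $X\to Y$; for $f:V\to V$, $\overline f(X)=\{f(x):x\in X\}$. $L_0[\partial]$ adds a function symbol $\partial$ taking concepts to objects; $A[E]$ is the theory consisting of $\forall X,Y(\partial(X)=\partial(Y)\leftrightarrow E(X,Y))$ plus comprehension, AC, GC; $\mathrm{rng}(\partial)=\{x:\exists X\,\partial(X)=x\}$. $A^2[E]$ is the analogous theory in $L_0[\partial_1,\partial_2]$ asserting the abstraction axiom for both $\partial_1$ and $\partial_2$ (plus comprehension, AC, GC); its models are $\mathcal M=(M,S_1[M],S_2[M],\dots,<,\partial_1,\partial_2)$. For $i=1,2$ the induced $L_0[\partial]$-structure is $\mathcal M_i=(\mathrm{rng}(\partial_i),S_1[M]\cap P(\mathrm{rng}(\partial_i)),S_2[M]\cap P(\mathrm{rng}(\partial_i)^2),\dots,\partial_i\restriction(S_1[M]\cap P(\mathrm{rng}(\partial_i))))$ (without $<$). The natural bijection $\overline\Gamma:\mathcal M_1\to\mathcal M_2$ is given on objects by $\Gamma(\partial_1(X))=\partial_2(X)$ ($X\in S_1[M]$), a well-defined bijection $\mathrm{rng}(\partial_1)\to\mathrm{rng}(\partial_2)$, and on relations by $\overline\Gamma(X)=\{\Gamma(x):x\in X\}$ (similarly for $n$-ary relations). $A[E]$ is naturally relatively categorical if for every model $\mathcal M$ of $A^2[E]$ the natural bijection $\overline\Gamma:\mathcal M_1\to\mathcal M_2$ is an isomorphism of $L_0[\partial]$-structures. *)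

theory Defs
  imports Main
begin

section \<open>Syntax\<close>

text \<open>
  One language with object variables, relation variables of every arity \<open>n \<ge> 1\<close>, the symbol \<open><\<close>
  and abstraction symbols \<open>\<partial>\<^sub>0, \<partial>\<^sub>1, \<dots>\<close>; the signatures of interest are cut out by \<open>syms\<close> below.
  To rule out arity 0, relation sorts are indexed by the arity minus one: \<open>RV n k\<close> is the \<open>k\<close>-th
  variable for \<open>Suc n\<close>-ary relations, so \<open>RV 0 k\<close> are the concept variables. The relation
  variable predicated in \<open>Pred k t ts\<close> is \<open>RV (length ts) k\<close>, which makes all formulas well-sorted.
\<close>

datatype var = OV nat | RV nat nat

datatype otm = Var nat | Ab nat nat  \<comment> \<open>\<open>Ab i k\<close> is \<open>\<partial>\<^sub>i(X)\<close> for the concept variable \<open>X = RV 0 k\<close>\<close>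

datatype fm =
    Eq otm otm
  | EqR nat nat nat  \<comment> \<open>\<open>EqR n j k\<close> is \<open>RV n j = RV n k\<close>\<close>
  | Pred nat otm "otm list"
  | Less otm otm
  | Bot
  | Imp fm fm
  | AllO nat fm
  | AllR nat nat fm

abbreviation Neg :: "fm \<Rightarrow> fm" where "Neg p \<equiv> Imp p Bot"
abbreviation Conj :: "fm \<Rightarrow> fm \<Rightarrow> fm" where "Conj p q \<equiv> Neg (Imp p (Neg q))"
abbreviation Disj :: "fm \<Rightarrow> fm \<Rightarrow> fm" where "Disj p q \<equiv> Imp (Neg p) q"
abbreviation Iff :: "fm \<Rightarrow> fm \<Rightarrow> fm" where "Iff p q \<equiv> Conj (Imp p q) (Imp q p)"
abbreviation ExO :: "nat \<Rightarrow> fm \<Rightarrow> fm" where "ExO x p \<equiv> Neg (AllO x (Neg p))"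
abbreviation ExR :: "nat \<Rightarrow> nat \<Rightarrow> fm \<Rightarrow> fm" where "ExR n k p \<equiv> Neg (AllR n k (Neg p))"

abbreviation AllOs :: "nat list \<Rightarrow> fm \<Rightarrow> fm" where "AllOs xs p \<equiv> foldr AllO xs p"

primrec fv_tm :: "otm \<Rightarrow> var set" where
  "fv_tm (Var x) = {OV x}"
| "fv_tm (Ab i k) = {RV 0 k}"

primrec fv :: "fm \<Rightarrow> var set" where
  "fv (Eq s t) = fv_tm s \<union> fv_tm t"
| "fv (EqR n j k) = {RV n j, RV n k}"
| "fv (Pred k t ts) = {RV (length ts) k} \<union> fv_tm t \<union> \<Union> (fv_tm ` set ts)"
| "fv (Less s t) = fv_tm s \<union> fv_tm t"
| "fv Bot = {}"
| "fv (Imp p q) = fv p \<union> fv q"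
| "fv (AllO x p) = fv p - {OV x}"
| "fv (AllR n k p) = fv p - {RV n k}"

datatype sym = LessSym | AbSym nat

primrec syms_tm :: "otm \<Rightarrow> sym set" where
  "syms_tm (Var x) = {}"
| "syms_tm (Ab i k) = {AbSym i}"

primrec syms :: "fm \<Rightarrow> sym set" where
  "syms (Eq s t) = syms_tm s \<union> syms_tm t"
| "syms (EqR n j k) = {}"
| "syms (Pred k t ts) = syms_tm t \<union> \<Union> (syms_tm ` set ts)"
| "syms (Less s t) = {LessSym} \<union> syms_tm s \<union> syms_tm t"
| "syms Bot = {}"
| "syms (Imp p q) = syms p \<union> syms q"
| "syms (AllO x p) = syms p"
| "syms (AllR n k p) = syms p"

text \<open>The formulas of \<open>L\<^sub>0\<close> expanded by \<open><\<close> and \<open>\<partial>\<^sub>i\<close> for \<open>i \<in> I\<close>; the formulas of \<open>L\<^sub>0\<close> itself are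
  those with \<open>syms p = {}\<close>.\<close>

definition lang :: "nat set \<Rightarrow> fm set" where
  "lang I = {p. syms p \<subseteq> insert LessSym (AbSym ` I)}"

text \<open>
  Simultaneous capture-avoiding substitution of object terms \<open>\<sigma> x\<close> for object variables and of
  relation variables \<open>\<tau> n k\<close> for relation variables. Every bound variable is renamed to the least
  one that is not captured.
\<close>

definition fv_image :: "(nat \<Rightarrow> otm) \<Rightarrow> (nat \<Rightarrow> nat \<Rightarrow> nat) \<Rightarrow> var set \<Rightarrow> var set" where
  "fv_image \<sigma> \<tau> V = (\<Union>v\<in>V. case v of OV x \<Rightarrow> fv_tm (\<sigma> x) | RV n k \<Rightarrow> {RV n (\<tau> n k)})"

primrec subst_tm :: "(nat \<Rightarrow> otm) \<Rightarrow> (nat \<Rightarrow> nat \<Rightarrow> nat) \<Rightarrow> otm \<Rightarrow> otm" where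
  "subst_tm \<sigma> \<tau> (Var x) = \<sigma> x"
| "subst_tm \<sigma> \<tau> (Ab i k) = Ab i (\<tau> 0 k)"

primrec subst :: "(nat \<Rightarrow> otm) \<Rightarrow> (nat \<Rightarrow> nat \<Rightarrow> nat) \<Rightarrow> fm \<Rightarrow> fm" where
  "subst \<sigma> \<tau> (Eq s t) = Eq (subst_tm \<sigma> \<tau> s) (subst_tm \<sigma> \<tau> t)"
| "subst \<sigma> \<tau> (EqR n j k) = EqR n (\<tau> n j) (\<tau> n k)"
| "subst \<sigma> \<tau> (Pred k t ts) =
     Pred (\<tau> (length ts) k) (subst_tm \<sigma> \<tau> t) (map (subst_tm \<sigma> \<tau>) ts)"
| "subst \<sigma> \<tau> (Less s t) = Less (subst_tm \<sigma> \<tau> s) (subst_tm \<sigma> \<tau> t)"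
| "subst \<sigma> \<tau> Bot = Bot"
| "subst \<sigma> \<tau> (Imp p q) = Imp (subst \<sigma> \<tau> p) (subst \<sigma> \<tau> q)"
| "subst \<sigma> \<tau> (AllO x p) =
     (let y = (LEAST y. OV y \<notin> fv_image \<sigma> \<tau> (fv p - {OV x}))
      in AllO y (subst (\<sigma>(x := Var y)) \<tau> p))"
| "subst \<sigma> \<tau> (AllR n k p) =
     (let j = (LEAST j. RV n j \<notin> fv_image \<sigma> \<tau> (fv p - {RV n k}))
      in AllR n j (subst \<sigma> (\<tau>(n := (\<tau> n)(k := j))) p))"

definition instO :: "nat \<Rightarrow> otm \<Rightarrow> fm \<Rightarrow> fm" where
  "instO x t p = subst (Var(x := t)) (\<lambda>n k. k) p"

definition instR :: "nat \<Rightarrow> nat \<Rightarrow> nat \<Rightarrow> fm \<Rightarrow> fm" where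
  "instR n k j p = subst Var ((\<lambda>n k. k)(n := id(k := j))) p"


section \<open>Deductive system\<close>

text \<open>
  Hilbert calculus for many-sorted classical logic with identity in every sort, plus extensionality.
  The axioms in \<open>T\<close> may have free variables, which are read universally (generalization is
  unrestricted). Derivations may mention symbols that do not occur in \<open>T\<close>, which is conservative.
\<close>

inductive prv :: "fm set \<Rightarrow> fm \<Rightarrow> bool" (infix "\<turnstile>" 50) for T :: "fm set" where
  Ax: "p \<in> T \<Longrightarrow> T \<turnstile> p"
| MP: "T \<turnstile> Imp p q \<Longrightarrow> T \<turnstile> p \<Longrightarrow> T \<turnstile> q"
| GenO: "T \<turnstile> p \<Longrightarrow> T \<turnstile> AllO x p"
| GenR: "T \<turnstile> p \<Longrightarrow> T \<turnstile> AllR n k p"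
| K: "T \<turnstile> Imp p (Imp q p)"
| S: "T \<turnstile> Imp (Imp p (Imp q r)) (Imp (Imp p q) (Imp p r))"
| DN: "T \<turnstile> Imp (Neg (Neg p)) p"
| InstO: "T \<turnstile> Imp (AllO x p) (instO x t p)"
| InstR: "T \<turnstile> Imp (AllR n k p) (instR n k j p)"
| DistO: "OV x \<notin> fv p \<Longrightarrow> T \<turnstile> Imp (AllO x (Imp p q)) (Imp p (AllO x q))"
| DistR: "RV n k \<notin> fv p \<Longrightarrow> T \<turnstile> Imp (AllR n k (Imp p q)) (Imp p (AllR n k q))"
| ReflO: "T \<turnstile> Eq t t"
| LeibnizO: "T \<turnstile> Imp (Eq s t) (Imp (instO x s p) (instO x t p))"
| ReflR: "T \<turnstile> EqR n k k"
| LeibnizR: "T \<turnstile> Imp (EqR n i j) (Imp (instR n k i p) (instR n k j p))"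
| Ext: "distinct (x # xs) \<Longrightarrow> length xs = n \<Longrightarrow>
    T \<turnstile> Imp (AllOs (x # xs) (Iff (Pred j (Var x) (map Var xs)) (Pred k (Var x) (map Var xs))))
            (EqR n j k)"


section \<open>Henkin semantics\<close>

text \<open>\<open>rels M n\<close> is the domain \<open>S\<^sub>n\<^sub>+\<^sub>1[M]\<close>; tuples are lists, so a concept is a set of
  one-element lists.\<close>

record 'a model =
  dom :: "'a set"
  rels :: "nat \<Rightarrow> 'a list set set"
  lt :: "'a \<Rightarrow> 'a \<Rightarrow> bool"
  ab :: "nat \<Rightarrow> 'a list set \<Rightarrow> 'a"

text \<open>As usual in many-sorted logic every sort is nonempty; for relation sorts this is also a
  consequence of comprehension.\<close>

definition henkin_structure :: "nat set \<Rightarrow> 'a model \<Rightarrow> bool" where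
  "henkin_structure I M \<longleftrightarrow>
     dom M \<noteq> {} \<and>
     (\<forall>n. rels M n \<noteq> {} \<and> rels M n \<subseteq> Pow {xs. set xs \<subseteq> dom M \<and> length xs = Suc n}) \<and>
     (\<forall>i\<in>I. \<forall>X\<in>rels M 0. ab M i X \<in> dom M)"

primrec val :: "'a model \<Rightarrow> (nat \<Rightarrow> 'a) \<Rightarrow> (nat \<Rightarrow> nat \<Rightarrow> 'a list set) \<Rightarrow> otm \<Rightarrow> 'a" where
  "val M e r (Var x) = e x"
| "val M e r (Ab i k) = ab M i (r 0 k)"

primrec sat :: "'a model \<Rightarrow> (nat \<Rightarrow> 'a) \<Rightarrow> (nat \<Rightarrow> nat \<Rightarrow> 'a list set) \<Rightarrow> fm \<Rightarrow> bool" where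
  "sat M e r (Eq s t) \<longleftrightarrow> val M e r s = val M e r t"
| "sat M e r (EqR n j k) \<longleftrightarrow> r n j = r n k"
| "sat M e r (Pred k t ts) \<longleftrightarrow> map (val M e r) (t # ts) \<in> r (length ts) k"
| "sat M e r (Less s t) \<longleftrightarrow> lt M (val M e r s) (val M e r t)"
| "sat M e r Bot \<longleftrightarrow> False"
| "sat M e r (Imp p q) \<longleftrightarrow> (sat M e r p \<longrightarrow> sat M e r q)"
| "sat M e r (AllO x p) \<longleftrightarrow> (\<forall>a\<in>dom M. sat M (e(x := a)) r p)"
| "sat M e r (AllR n k p) \<longleftrightarrow> (\<forall>A\<in>rels M n. sat M e (r(n := (r n)(k := A))) p)"

definition is_model :: "nat set \<Rightarrow> 'a model \<Rightarrow> fm set \<Rightarrow> bool" where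
  "is_model I M T \<longleftrightarrow>
     henkin_structure I M \<and>
     (\<forall>p\<in>T. \<forall>e r. (\<forall>x. e x \<in> dom M) \<longrightarrow> (\<forall>n k. r n k \<in> rels M n) \<longrightarrow> sat M e r p)"


section \<open>The theories\<close>

text \<open>Parameters of the schemas are the remaining free variables.\<close>

definition comprehension :: "nat set \<Rightarrow> fm set" where
  "comprehension I =
     {ExR (length xs) X (AllOs (x # xs) (Iff (Pred X (Var x) (map Var xs)) p)) | X x xs p.
        p \<in> lang I \<and> distinct (x # xs) \<and> RV (length xs) X \<notin> fv p}"

text \<open>
  \<open>\<phi>(R[x\<^sub>1..x\<^sub>m], x\<^sub>1..x\<^sub>m)\<close> is spelled out as \<open>\<exists>R'. R' = R[x\<^sub>1..x\<^sub>m] \<and> \<phi>(R', x\<^sub>1..x\<^sub>m)\<close>, with the identity written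
  extensionally. Below \<open>x # xs\<close> and \<open>y # ys\<close> are the two tuples, so \<open>R'\<close> is
  \<open>RV (length ys) Q\<close> and \<open>R\<close> is \<open>RV (length xs + length (y # ys)) R\<close>.
\<close>

definition choice :: "nat set \<Rightarrow> fm set" where
  "choice I =
     {Imp (AllOs (x # xs) (ExR (length ys) Q p))
          (ExR (length (xs @ y # ys)) R
             (AllOs (x # xs)
                (ExR (length ys) Q
                   (Conj (AllOs (y # ys)
                            (Iff (Pred Q (Var y) (map Var ys))
                                 (Pred R (Var x) (map Var (xs @ y # ys)))))
                         p)))) | x xs y ys Q R p.
        p \<in> lang I \<and> distinct (x # xs @ y # ys) \<and> RV (length (xs @ y # ys)) R \<notin> fv p}"

definition linear_order_axioms :: "fm set" where
  "linear_order_axioms =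
     {AllO 0 (Neg (Less (Var 0) (Var 0))),
      AllOs [0, 1, 2] (Imp (Conj (Less (Var 0) (Var 1)) (Less (Var 1) (Var 2))) (Less (Var 0) (Var 2))),
      AllOs [0, 1] (Disj (Less (Var 0) (Var 1)) (Disj (Eq (Var 0) (Var 1)) (Less (Var 1) (Var 0))))}"

definition global_choice :: "nat set \<Rightarrow> fm set" where
  "global_choice I = linear_order_axioms \<union>
     {Imp (ExO x p)
          (ExO x (Conj p (AllO y (Imp (Less (Var y) (Var x)) (Neg (instO x (Var y) p)))))) | x y p.
        p \<in> lang I \<and> y \<noteq> x \<and> OV y \<notin> fv p}"

definition base_theory :: "nat set \<Rightarrow> fm set" where
  "base_theory I = comprehension I \<union> choice I \<union> global_choice I"

text \<open>The two free concept variables of \<open>E\<close> are \<open>RV 0 0\<close> and \<open>RV 0 1\<close>;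
  \<open>app2 E j k\<close> is \<open>E(RV 0 j, RV 0 k)\<close>.\<close>

definition app2 :: "fm \<Rightarrow> nat \<Rightarrow> nat \<Rightarrow> fm" where
  "app2 E j k = subst Var ((\<lambda>n k. k)(0 := id(0 := j, 1 := k))) E"

definition abstraction :: "fm \<Rightarrow> nat \<Rightarrow> fm" where
  "abstraction E i = AllR 0 0 (AllR 0 1 (Iff (Eq (Ab i 0) (Ab i 1)) (app2 E 0 1)))"

definition abs_theory :: "nat set \<Rightarrow> fm \<Rightarrow> fm set" where
  "abs_theory I E = abstraction E ` I \<union> base_theory I"

text \<open>The operator of \<open>A[E]\<close> is \<open>\<partial>\<^sub>0\<close>, those of \<open>A\<^sup>2[E]\<close> are \<open>\<partial>\<^sub>1\<close> and \<open>\<partial>\<^sub>2\<close>.\<close>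

abbreviation A_theory :: "fm \<Rightarrow> fm set" where "A_theory E \<equiv> abs_theory {0} E"
abbreviation A2_theory :: "fm \<Rightarrow> fm set" where "A2_theory E \<equiv> abs_theory {1, 2} E"

definition provably_equivalence :: "fm \<Rightarrow> bool" where
  "provably_equivalence E \<longleftrightarrow>
     base_theory {} \<turnstile> AllR 0 0 (app2 E 0 0) \<and>
     base_theory {} \<turnstile> AllR 0 0 (AllR 0 1 (Imp (app2 E 0 1) (app2 E 1 0))) \<and>
     base_theory {} \<turnstile> AllR 0 0 (AllR 0 1 (AllR 0 2
        (Imp (Conj (app2 E 0 1) (app2 E 1 2)) (app2 E 0 2))))"


section \<open>Invariance and coarsening on abstracts\<close>

text \<open>In the following formulas \<open>X, Y\<close> index concept variables and \<open>F\<close> a binary relation variable.\<close>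

abbreviation In :: "nat \<Rightarrow> nat \<Rightarrow> fm" where "In x X \<equiv> Pred X (Var x) []"
abbreviation Maps :: "nat \<Rightarrow> nat \<Rightarrow> nat \<Rightarrow> fm" where "Maps F x y \<equiv> Pred F (Var x) [Var y]"

definition injection_V :: "nat \<Rightarrow> fm" where
  "injection_V F =
     Conj (AllO 0 (ExO 1 (Maps F 0 1)))
    (Conj (AllOs [0, 1, 2] (Imp (Conj (Maps F 0 1) (Maps F 0 2)) (Eq (Var 1) (Var 2))))
          (AllOs [0, 1, 2] (Imp (Conj (Maps F 0 2) (Maps F 1 2)) (Eq (Var 0) (Var 1)))))"

definition bijection :: "nat \<Rightarrow> nat \<Rightarrow> nat \<Rightarrow> fm" where  \<comment> \<open>\<open>F\<close> is a bijection \<open>X \<rightarrow> Y\<close>\<close>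
  "bijection F X Y =
     Conj (AllOs [0, 1] (Imp (Maps F 0 1) (Conj (In 0 X) (In 1 Y))))
    (Conj (AllO 0 (Imp (In 0 X) (ExO 1 (Maps F 0 1))))
    (Conj (AllOs [0, 1, 2] (Imp (Conj (Maps F 0 1) (Maps F 0 2)) (Eq (Var 1) (Var 2))))
    (Conj (AllOs [0, 1, 2] (Imp (Conj (Maps F 0 2) (Maps F 1 2)) (Eq (Var 0) (Var 1))))
          (AllO 1 (Imp (In 1 Y) (ExO 0 (Maps F 0 1)))))))"

definition equinumerous :: "nat \<Rightarrow> nat \<Rightarrow> fm" where
  "equinumerous X Y = ExR 1 0 (bijection 0 X Y)"

definition image_of :: "nat \<Rightarrow> nat \<Rightarrow> nat \<Rightarrow> fm" where  \<comment> \<open>\<open>Y = {F(x) : x \<in> X}\<close>\<close>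
  "image_of F X Y = AllO 1 (Iff (In 1 Y) (ExO 0 (Conj (In 0 X) (Maps F 0 1))))"

definition sub_rng :: "nat \<Rightarrow> fm" where  \<comment> \<open>\<open>X \<subseteq> rng(\<partial>\<^sub>0)\<close>; the bound concept variable differs from \<open>X\<close>\<close>
  "sub_rng X = AllO 0 (Imp (In 0 X) (ExR 0 (Suc X) (Eq (Ab 0 (Suc X)) (Var 0))))"

definition injection_invariant_on_abstracts :: "fm \<Rightarrow> bool" where
  "injection_invariant_on_abstracts E \<longleftrightarrow>
     A_theory E \<turnstile>
       AllR 1 0 (Imp (injection_V 0)
         (AllR 0 0 (Imp (sub_rng 0)
           (AllR 0 1 (Imp (image_of 0 0 1) (app2 E 0 1))))))"

definition cardinality_coarsening_on_abstracts :: "fm \<Rightarrow> bool" where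
  "cardinality_coarsening_on_abstracts E \<longleftrightarrow>
     A_theory E \<turnstile>
       AllR 0 0 (AllR 0 1 (Imp (Conj (equinumerous 1 0) (sub_rng 0)) (app2 E 0 1)))"


section \<open>Natural relative categoricity\<close>

text \<open>Structures for \<open>L\<^sub>0[\<partial>]\<close> without \<open><\<close>; only the values of \<open>sab\<close> on \<open>srels 0\<close> matter.\<close>

record 'a L0d_structure =
  sdom :: "'a set"
  srels :: "nat \<Rightarrow> 'a list set set"
  sab :: "'a list set \<Rightarrow> 'a"

definition rng :: "'a model \<Rightarrow> nat \<Rightarrow> 'a set" where
  "rng M i = ab M i ` rels M 0"

definition induced :: "'a model \<Rightarrow> nat \<Rightarrow> 'a L0d_structure" where
  "induced M i =
     \<lparr>sdom = rng M i,
      srels = (\<lambda>n. rels M n \<inter> Pow {xs. set xs \<subseteq> rng M i \<and> length xs = Suc n}),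
      sab = ab M i\<rparr>"

definition is_isomorphism ::
  "('a \<Rightarrow> 'b) \<Rightarrow> (nat \<Rightarrow> 'a list set \<Rightarrow> 'b list set) \<Rightarrow> 'a L0d_structure \<Rightarrow> 'b L0d_structure \<Rightarrow> bool" where
  "is_isomorphism g G A B \<longleftrightarrow>
     bij_betw g (sdom A) (sdom B) \<and>
     (\<forall>n. bij_betw (G n) (srels A n) (srels B n)) \<and>
     (\<forall>n. \<forall>R\<in>srels A n. \<forall>xs. set xs \<subseteq> sdom A \<longrightarrow> length xs = Suc n \<longrightarrow>
        (xs \<in> R \<longleftrightarrow> map g xs \<in> G n R)) \<and>
     (\<forall>X\<in>srels A 0. g (sab A X) = sab B (G 0 X))"

definition nat_bij :: "'a model \<Rightarrow> 'a \<Rightarrow> 'a" where  \<comment> \<open>\<open>\<Gamma>\<close>, with \<open>\<Gamma>(\<partial>\<^sub>1(X)) = \<partial>\<^sub>2(X)\<close>\<close>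
  "nat_bij M a = (THE b. \<exists>X\<in>rels M 0. a = ab M 1 X \<and> b = ab M 2 X)"

definition nat_bij_rel :: "'a model \<Rightarrow> nat \<Rightarrow> 'a list set \<Rightarrow> 'a list set" where
  "nat_bij_rel M n R = map (nat_bij M) ` R"

text \<open>Models range over all Henkin models whose objects are elements of the type \<open>'a\<close>. As
  the language is countable, every infinite type \<open>'a\<close> gives the same notion.\<close>

definition naturally_relatively_categorical :: "'a itself \<Rightarrow> fm \<Rightarrow> bool" where
  "naturally_relatively_categorical (_ :: 'a itself) E \<longleftrightarrow>
     (\<forall>M :: 'a model. is_model {1, 2} M (A2_theory E) \<longrightarrow>
        is_isomorphism (nat_bij M) (nat_bij_rel M) (induced M 1) (induced M 2))"

end

theory Submission
  imports Defs "HOL-Library.Countable"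
begin

text \<open>
  By soundness and completeness, both provability statements become statements about all Henkin
  models of \<open>A[E]\<close> over the infinite type \<open>'a\<close>: \<open>E(X, f(X))\<close> holds for all concepts
  \<open>X \<subseteq> rng(\<partial>)\<close> and all injections \<open>f\<close> of the model with domain \<open>D\<close>, where \<open>D = V\<close> for injection
  invariance and \<open>D = X\<close> for cardinality coarsening. Categoricity is compared with the case
  \<open>D = rng(\<partial>)\<close>. An injection \<open>j\<close> on \<open>rng(\<partial>)\<close> makes \<open>(\<partial>, j \<circ> \<partial>)\<close> a model of \<open>A\<^sup>2[E]\<close> whose natural
  bijection is \<open>j\<close>; it is an isomorphism only if \<open>E(X, j(X))\<close>. Conversely the natural bijection is
  a function of the model, so that the case \<open>D = X\<close> applies to it.

  To enlarge or shrink \<open>D\<close> one uses that any two concepts are comparable in cardinality by global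
  choice. If an injection does not extend, its inverse does, and since \<open>E\<close> is a formula of \<open>L\<^sub>0\<close> one
  may replace \<open>\<partial>\<close> by \<open>j \<circ> \<partial>\<close>, whose range contains the domain of the inverse. In the step from
  \<open>D = rng(\<partial>)\<close> to \<open>D = X\<close> the failure to extend makes \<open>V\<close> embed into \<open>rng(\<partial>)\<close>; by Cantor-Bernstein
  one may then even assume that \<open>rng(\<partial>) = V\<close>.
\<close>

section \<open>Substitution\<close>

text \<open>The composed operator \<open>j \<circ> \<partial>\<close> is not a symbol of the
  language, so comprehension, choice and global choice have to be verified anew for formulas that
  speak of it. Such formulas are translated back with the graph of \<open>j\<close> as a parameter,
  which the schemas allow; this is why \<open>j\<close> must be a function of the model. The order
  \<open><\<close> has least elements only for definable classes and may be ill-founded when seen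
  from outside. Comparability and Cantor-Bernstein can therefore not be borrowed from the
  metatheory: every set and function in their proofs must be produced by comprehension. In the step
  to \<open>D = X\<close> the obstacle is that the extended inverse is defined on all of
  \<open>V\<close>, while the hypothesis only speaks of injections defined on the range of the
  operator. The bijection from Cantor-Bernstein turns that range into \<open>V\<close>. A single
  infinite type of objects suffices for completeness because the term model consists of classes of
  countably many terms.\<close>

lemma fv_image_simps [simp]:
  "fv_image \<sigma> \<tau> {} = {}"
  "fv_image \<sigma> \<tau> (A \<union> B) = fv_image \<sigma> \<tau> A \<union> fv_image \<sigma> \<tau> B"
  "fv_image \<sigma> \<tau> (insert (OV x) A) = fv_tm (\<sigma> x) \<union> fv_image \<sigma> \<tau> A"
  "fv_image \<sigma> \<tau> (insert (RV n k) A) = insert (RV n (\<tau> n k)) (fv_image \<sigma> \<tau> A)"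
  by (auto simp: fv_image_def)

lemma fv_image_UN: "fv_image \<sigma> \<tau> (\<Union> (f ` A)) = (\<Union>a\<in>A. fv_image \<sigma> \<tau> (f a))"
  by (auto simp: fv_image_def)

lemma finite_fv_tm [simp]: "finite (fv_tm t)"
  by (cases t) auto

lemma finite_fv [simp]: "finite (fv p)"
  by (induction p) auto

lemma finite_fv_image [simp]: "finite A \<Longrightarrow> finite (fv_image \<sigma> \<tau> A)"
  by (auto simp: fv_image_def split: var.split)

lemma fv_image_cong:
  assumes "\<And>x. OV x \<in> A \<Longrightarrow> \<sigma> x = \<sigma>' x" "\<And>n k. RV n k \<in> A \<Longrightarrow> \<tau> n k = \<tau>' n k"
  shows "fv_image \<sigma> \<tau> A = fv_image \<sigma>' \<tau>' A"
  unfolding fv_image_def using assms by (intro SUP_cong refl) (auto split: var.split)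

lemma fresh_OV: "finite A \<Longrightarrow> \<exists>y. OV y \<notin> A"
proof -
  assume "finite A"
  then have "finite (OV -` A)" by (intro finite_vimageI) (auto simp: inj_def)
  then show ?thesis by (metis ex_new_if_finite infinite_UNIV_nat vimageI)
qed

lemma fresh_RV: "finite A \<Longrightarrow> \<exists>j. RV n j \<notin> A"
proof -
  assume "finite A"
  then have "finite (RV n -` A)" by (intro finite_vimageI) (auto simp: inj_def)
  then show ?thesis by (metis ex_new_if_finite infinite_UNIV_nat vimageI)
qed

lemma fv_subst_tm: "fv_tm (subst_tm \<sigma> \<tau> t) = fv_image \<sigma> \<tau> (fv_tm t)"
  by (cases t) auto

lemma subst_tm_cong:
  assumes "\<And>x. OV x \<in> fv_tm t \<Longrightarrow> \<sigma> x = \<sigma>' x" "\<And>n k. RV n k \<in> fv_tm t \<Longrightarrow> \<tau> n k = \<tau>' n k"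
  shows "subst_tm \<sigma> \<tau> t = subst_tm \<sigma>' \<tau>' t"
  using assms by (cases t) auto

text \<open>The new bound variable is determined by \<open>fv_image\<close> on the free variables,
  so substitutions that agree there also rename alike and the results are literally equal.\<close>

lemma subst_cong:
  assumes "\<And>x. OV x \<in> fv p \<Longrightarrow> \<sigma> x = \<sigma>' x" "\<And>n k. RV n k \<in> fv p \<Longrightarrow> \<tau> n k = \<tau>' n k"
  shows "subst \<sigma> \<tau> p = subst \<sigma>' \<tau>' p"
  using assms
proof (induction p arbitrary: \<sigma> \<sigma>' \<tau> \<tau>')
  case (Eq s t)
  then show ?case by (auto intro!: subst_tm_cong)
next
  case (Pred k t ts)
  have "map (subst_tm \<sigma> \<tau>) (t # ts) = map (subst_tm \<sigma>' \<tau>') (t # ts)"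
    by (intro map_cong refl subst_tm_cong Pred.prems) auto
  then show ?case using Pred.prems by simp
next
  case (Less s t)
  then show ?case by (auto intro!: subst_tm_cong)
next
  case (Imp p q)
  then show ?case by (metis UnCI fv.simps(6) subst.simps(6))
next
  case (AllO x p)
  have *: "fv_image \<sigma> \<tau> (fv p - {OV x}) = fv_image \<sigma>' \<tau>' (fv p - {OV x})"
    using AllO.prems by (intro fv_image_cong) auto
  show ?case using AllO.prems unfolding subst.simps Let_def *
    by (auto intro!: AllO.IH)
next
  case (AllR n k p)
  have *: "fv_image \<sigma> \<tau> (fv p - {RV n k}) = fv_image \<sigma>' \<tau>' (fv p - {RV n k})"
    using AllR.prems by (intro fv_image_cong) auto
  show ?case using AllR.prems unfolding subst.simps Let_def *
    by (auto intro!: AllR.IH)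
qed auto

text \<open>Hides the \<open>LEAST\<close> of the definition: later arguments only need that the new
  bound variable is fresh, and a fresh one exists because a formula has finitely many free
  variables.\<close>

lemma subst_AllO:
  obtains y where "OV y \<notin> fv_image \<sigma> \<tau> (fv p - {OV x})"
    "subst \<sigma> \<tau> (AllO x p) = AllO y (subst (\<sigma>(x := Var y)) \<tau> p)"
proof -
  have "\<exists>y. OV y \<notin> fv_image \<sigma> \<tau> (fv p - {OV x})" by (intro fresh_OV) simp
  then have "OV (LEAST y. OV y \<notin> fv_image \<sigma> \<tau> (fv p - {OV x})) \<notin> fv_image \<sigma> \<tau> (fv p - {OV x})"
    by (rule LeastI_ex)
  then show thesis using that by (auto simp: Let_def)
qed

lemma subst_AllR:
  obtains j where "RV n j \<notin> fv_image \<sigma> \<tau> (fv p - {RV n k})"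
    "subst \<sigma> \<tau> (AllR n k p) = AllR n j (subst \<sigma> (\<tau>(n := (\<tau> n)(k := j))) p)"
proof -
  have "\<exists>j. RV n j \<notin> fv_image \<sigma> \<tau> (fv p - {RV n k})" by (intro fresh_RV) simp
  then have "RV n (LEAST j. RV n j \<notin> fv_image \<sigma> \<tau> (fv p - {RV n k})) \<notin> fv_image \<sigma> \<tau> (fv p - {RV n k})"
    by (rule LeastI_ex)
  then show thesis using that by (auto simp: Let_def)
qed

lemma fv_image_updO:
  assumes "OV y \<notin> fv_image \<sigma> \<tau> (A - {OV x})"
  shows "fv_image (\<sigma>(x := Var y)) \<tau> A - {OV y} = fv_image \<sigma> \<tau> (A - {OV x})"
proof -
  have eq: "fv_image (\<sigma>(x := Var y)) \<tau> (A - {OV x}) = fv_image \<sigma> \<tau> (A - {OV x})"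
    by (rule fv_image_cong) auto
  show ?thesis
  proof (cases "OV x \<in> A")
    case True
    then have "A = insert (OV x) (A - {OV x})" by auto
    then have "fv_image (\<sigma>(x := Var y)) \<tau> A
      = insert (OV y) (fv_image (\<sigma>(x := Var y)) \<tau> (A - {OV x}))"
      by (metis fun_upd_same fv_image_simps(3) fv_tm.simps(1) insert_is_Un)
    with eq assms show ?thesis by auto
  next
    case False
    then show ?thesis using eq assms by simp
  qed
qed

lemma fv_image_updR:
  assumes "RV n j \<notin> fv_image \<sigma> \<tau> (A - {RV n k})"
  shows "fv_image \<sigma> (\<tau>(n := (\<tau> n)(k := j))) A - {RV n j} = fv_image \<sigma> \<tau> (A - {RV n k})"
proof -
  have eq: "fv_image \<sigma> (\<tau>(n := (\<tau> n)(k := j))) (A - {RV n k}) = fv_image \<sigma> \<tau> (A - {RV n k})"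
    by (rule fv_image_cong) auto
  show ?thesis
  proof (cases "RV n k \<in> A")
    case True
    then have "A = insert (RV n k) (A - {RV n k})" by auto
    then have "fv_image \<sigma> (\<tau>(n := (\<tau> n)(k := j))) A
      = insert (RV n j) (fv_image \<sigma> (\<tau>(n := (\<tau> n)(k := j))) (A - {RV n k}))"
      by (metis fun_upd_same fv_image_simps(4))
    with eq assms show ?thesis by auto
  next
    case False
    then show ?thesis using eq assms by simp
  qed
qed

lemma fv_subst: "fv (subst \<sigma> \<tau> p) = fv_image \<sigma> \<tau> (fv p)"
proof (induction p arbitrary: \<sigma> \<tau>)
  case (Pred k t ts)
  then show ?case by (simp add: fv_subst_tm fv_image_UN)
next
  case (AllO x p)
  show ?case by (rule subst_AllO[of \<sigma> \<tau> p x]) (simp add: AllO.IH fv_image_updO del: subst.simps fun_upd_apply)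
next
  case (AllR n k p)
  show ?case by (rule subst_AllR[of n \<sigma> \<tau> p k]) (simp add: AllR.IH fv_image_updR del: subst.simps fun_upd_apply)
qed (simp_all add: fv_subst_tm)

lemma fv_image_fv_image:
  "fv_image \<sigma>' \<tau>' (fv_image \<sigma> \<tau> A) = fv_image (\<lambda>x. subst_tm \<sigma>' \<tau>' (\<sigma> x)) (\<lambda>n k. \<tau>' n (\<tau> n k)) A"
proof -
  have "fv_image \<sigma>' \<tau>' (fv_image \<sigma> \<tau> A)
    = (\<Union>v\<in>A. fv_image \<sigma>' \<tau>' (case v of OV x \<Rightarrow> fv_tm (\<sigma> x) | RV n k \<Rightarrow> {RV n (\<tau> n k)}))"
    unfolding fv_image_def[of \<sigma> \<tau>] fv_image_UN ..
  also have "\<dots> = fv_image (\<lambda>x. subst_tm \<sigma>' \<tau>' (\<sigma> x)) (\<lambda>n k. \<tau>' n (\<tau> n k)) A"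
    unfolding fv_image_def[of _ _ A]
    by (intro SUP_cong refl) (auto simp: fv_subst_tm split: var.split)
  finally show ?thesis .
qed

lemma subst_tm_subst_tm:
  "subst_tm \<sigma>' \<tau>' (subst_tm \<sigma> \<tau> t) = subst_tm (\<lambda>x. subst_tm \<sigma>' \<tau>' (\<sigma> x)) (\<lambda>n k. \<tau>' n (\<tau> n k)) t"
  by (cases t) auto

text \<open>This is a syntactic identity, not merely one up to renaming, because the bound variable chosen
  by \<^const>\<open>subst\<close> depends only on the free variables of the result.\<close>

lemma subst_subst:
  "subst \<sigma>' \<tau>' (subst \<sigma> \<tau> p) = subst (\<lambda>x. subst_tm \<sigma>' \<tau>' (\<sigma> x)) (\<lambda>n k. \<tau>' n (\<tau> n k)) p"
proof (induction p arbitrary: \<sigma> \<tau> \<sigma>' \<tau>')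
  case (AllO x p)
  let ?\<rho> = "\<lambda>x. subst_tm \<sigma>' \<tau>' (\<sigma> x)" and ?\<upsilon> = "\<lambda>n k. \<tau>' n (\<tau> n k)"
  obtain y where y: "OV y \<notin> fv_image \<sigma> \<tau> (fv p - {OV x})"
    "subst \<sigma> \<tau> (AllO x p) = AllO y (subst (\<sigma>(x := Var y)) \<tau> p)"
    by (rule subst_AllO)
  let ?p = "subst (\<sigma>(x := Var y)) \<tau> p"
  have fv: "fv_image \<sigma>' \<tau>' (fv ?p - {OV y}) = fv_image ?\<rho> ?\<upsilon> (fv p - {OV x})"
    using y(1) by (simp add: fv_subst fv_image_updO fv_image_fv_image)
  define z where "z = (LEAST z. OV z \<notin> fv_image ?\<rho> ?\<upsilon> (fv p - {OV x}))"
  have "subst \<sigma>' \<tau>' (AllO y ?p) = AllO z (subst (\<sigma>'(y := Var z)) \<tau>' ?p)"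
    by (simp only: subst.simps Let_def fv z_def)
  also have "subst (\<sigma>'(y := Var z)) \<tau>' ?p
    = subst (\<lambda>w. subst_tm (\<sigma>'(y := Var z)) \<tau>' ((\<sigma>(x := Var y)) w)) ?\<upsilon> p"
    by (rule AllO.IH)
  also have "\<dots> = subst (?\<rho>(x := Var z)) ?\<upsilon> p"
  proof (rule subst_cong)
    fix w assume w: "OV w \<in> fv p"
    show "subst_tm (\<sigma>'(y := Var z)) \<tau>' ((\<sigma>(x := Var y)) w) = (?\<rho>(x := Var z)) w"
    proof (cases "w = x")
      case False
      then have "OV y \<notin> fv_tm (\<sigma> w)" using y(1) w by (force simp: fv_image_def)
      then show ?thesis using False by (auto intro: subst_tm_cong)
    qed simp
  qed simp
  also have "AllO z \<dots> = subst ?\<rho> ?\<upsilon> (AllO x p)"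
    by (simp only: subst.simps Let_def z_def)
  finally show ?case by (simp only: y(2))
next
  case (AllR n k p)
  let ?\<rho> = "\<lambda>x. subst_tm \<sigma>' \<tau>' (\<sigma> x)" and ?\<upsilon> = "\<lambda>n k. \<tau>' n (\<tau> n k)"
  obtain j where j: "RV n j \<notin> fv_image \<sigma> \<tau> (fv p - {RV n k})"
    "subst \<sigma> \<tau> (AllR n k p) = AllR n j (subst \<sigma> (\<tau>(n := (\<tau> n)(k := j))) p)"
    by (rule subst_AllR)
  let ?p = "subst \<sigma> (\<tau>(n := (\<tau> n)(k := j))) p"
  have fv: "fv_image \<sigma>' \<tau>' (fv ?p - {RV n j}) = fv_image ?\<rho> ?\<upsilon> (fv p - {RV n k})"
    using j(1) by (simp add: fv_subst fv_image_updR fv_image_fv_image)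
  define z where "z = (LEAST z. RV n z \<notin> fv_image ?\<rho> ?\<upsilon> (fv p - {RV n k}))"
  let ?\<tau>' = "\<tau>'(n := (\<tau>' n)(j := z))"
  have "subst \<sigma>' \<tau>' (AllR n j ?p) = AllR n z (subst \<sigma>' ?\<tau>' ?p)"
    by (simp only: subst.simps Let_def fv z_def)
  also have "subst \<sigma>' ?\<tau>' ?p
    = subst (\<lambda>w. subst_tm \<sigma>' ?\<tau>' (\<sigma> w)) (\<lambda>m i. ?\<tau>' m ((\<tau>(n := (\<tau> n)(k := j))) m i)) p"
    by (rule AllR.IH)
  also have "\<dots> = subst ?\<rho> (?\<upsilon>(n := (?\<upsilon> n)(k := z))) p"
  proof (rule subst_cong)
    fix w assume w: "OV w \<in> fv p"
    then have "RV n j \<notin> fv_tm (\<sigma> w)" using j(1) by (force simp: fv_image_def)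
    then show "subst_tm \<sigma>' ?\<tau>' (\<sigma> w) = ?\<rho> w" by (intro subst_tm_cong) auto
  next
    fix m i assume "RV m i \<in> fv p"
    then show "?\<tau>' m ((\<tau>(n := (\<tau> n)(k := j))) m i) = (?\<upsilon>(n := (?\<upsilon> n)(k := z))) m i"
      using j(1) by (force simp: fv_image_def)
  qed
  also have "AllR n z \<dots> = subst ?\<rho> ?\<upsilon> (AllR n k p)"
    by (simp only: subst.simps Let_def z_def)
  finally show ?case by (simp only: j(2))
qed (simp_all add: subst_tm_subst_tm del: subst_tm.simps)


section \<open>Semantics\<close>

lemma val_cong:
  assumes "\<And>x. OV x \<in> fv_tm t \<Longrightarrow> e x = e' x" "\<And>n k. RV n k \<in> fv_tm t \<Longrightarrow> r n k = r' n k"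
  shows "val M e r t = val M e' r' t"
  using assms by (cases t) auto

lemma sat_cong:
  assumes "\<And>x. OV x \<in> fv p \<Longrightarrow> e x = e' x" "\<And>n k. RV n k \<in> fv p \<Longrightarrow> r n k = r' n k"
  shows "sat M e r p \<longleftrightarrow> sat M e' r' p"
  using assms
proof (induction p arbitrary: e e' r r')
  case (Eq s t)
  then have "val M e r s = val M e' r' s" "val M e r t = val M e' r' t"
    by (auto intro!: val_cong)
  then show ?case by simp
next
  case (Pred k t ts)
  have "map (val M e r) (t # ts) = map (val M e' r') (t # ts)"
    by (intro map_cong refl val_cong Pred.prems) auto
  moreover have "r (length ts) k = r' (length ts) k"
    by (rule Pred.prems) simp
  ultimately show ?case by (simp only: sat.simps)
next
  case (Less s t)
  then have "val M e r s = val M e' r' s" "val M e r t = val M e' r' t"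
    by (auto intro!: val_cong)
  then show ?case by simp
next
  case (Imp p q)
  then show ?case by (metis UnCI fv.simps(6) sat.simps(6))
next
  case (AllO x p)
  show ?case unfolding sat.simps
    by (intro ball_cong refl AllO.IH) (use AllO.prems in auto)
next
  case (AllR n k p)
  show ?case unfolding sat.simps
    by (intro ball_cong refl AllR.IH) (use AllR.prems in auto)
qed auto

lemma val_subst: "val M e r (subst_tm \<sigma> \<tau> t) = val M (\<lambda>x. val M e r (\<sigma> x)) (\<lambda>n k. r n (\<tau> n k)) t"
  by (cases t) auto

text \<open>Freshness of the new bound variable means that reassigning it does not disturb the
  values of the terms substituted for the other free variables.\<close>

lemma sat_subst:
  "sat M e r (subst \<sigma> \<tau> p) \<longleftrightarrow> sat M (\<lambda>x. val M e r (\<sigma> x)) (\<lambda>n k. r n (\<tau> n k)) p"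
proof (induction p arbitrary: \<sigma> \<tau> e r)
  case (Pred k t ts)
  then show ?case by (simp add: val_subst comp_def)
next
  case (AllO x p)
  obtain y where y: "OV y \<notin> fv_image \<sigma> \<tau> (fv p - {OV x})"
    "subst \<sigma> \<tau> (AllO x p) = AllO y (subst (\<sigma>(x := Var y)) \<tau> p)"
    by (rule subst_AllO)
  have *: "val M (e(y := a)) r (\<sigma> w) = val M e r (\<sigma> w)" if "OV w \<in> fv p" "w \<noteq> x" for w a
  proof (rule val_cong)
    have "OV y \<notin> fv_tm (\<sigma> w)" using y(1) that by (force simp: fv_image_def)
    then show "(e(y := a)) v = e v" if "OV v \<in> fv_tm (\<sigma> w)" for v using that by auto
  qed simp
  show ?case unfolding y(2) sat.simps AllO.IH
    by (intro ball_cong refl sat_cong) (auto simp: *)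
next
  case (AllR n k p)
  obtain j where j: "RV n j \<notin> fv_image \<sigma> \<tau> (fv p - {RV n k})"
    "subst \<sigma> \<tau> (AllR n k p) = AllR n j (subst \<sigma> (\<tau>(n := (\<tau> n)(k := j))) p)"
    by (rule subst_AllR)
  have *: "val M e (r(n := (r n)(j := a))) (\<sigma> w) = val M e r (\<sigma> w)" if "OV w \<in> fv p" for w a
  proof (rule val_cong)
    have "RV n j \<notin> fv_tm (\<sigma> w)" using j(1) that by (force simp: fv_image_def)
    then show "(r(n := (r n)(j := a))) m i = r m i" if "RV m i \<in> fv_tm (\<sigma> w)" for m i
      using that by auto
  qed simp
  have **: "\<tau> n i \<noteq> j" if "RV n i \<in> fv p" "i \<noteq> k" for i
    using j(1) that by (force simp: fv_image_def)
  show ?case unfolding j(2) sat.simps AllR.IH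
    by (intro ball_cong refl sat_cong) (use ** in \<open>auto simp: *\<close>)
qed (simp_all add: val_subst)

text \<open>Later entries override earlier ones, as with the nested quantifiers of
  \<open>AllOs\<close>.\<close>

primrec upds :: "(nat \<Rightarrow> 'a) \<Rightarrow> nat list \<Rightarrow> 'a list \<Rightarrow> nat \<Rightarrow> 'a" where
  "upds e [] as = e"
| "upds e (x # xs) as = upds (e(x := hd as)) xs (tl as)"

lemma upds_other [simp]: "x \<notin> set xs \<Longrightarrow> upds e xs as x = e x"
  by (induction xs arbitrary: e as) auto

lemma map_upds [simp]: "distinct xs \<Longrightarrow> length as = length xs \<Longrightarrow> map (upds e xs as) xs = as"
  by (induction xs arbitrary: e as) (auto simp: length_Suc_conv)

lemma sat_AllOs:
  "sat M e r (AllOs xs p) \<longleftrightarrow>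
   (\<forall>as. length as = length xs \<longrightarrow> set as \<subseteq> dom M \<longrightarrow> sat M (upds e xs as) r p)"
proof (induction xs arbitrary: e)
  case (Cons x xs)
  have "sat M e r (AllOs (x # xs) p) \<longleftrightarrow>
    (\<forall>a\<in>dom M. \<forall>as. length as = length xs \<longrightarrow> set as \<subseteq> dom M \<longrightarrow> sat M (upds (e(x := a)) xs as) r p)"
    by (simp add: Cons.IH del: fun_upd_apply)
  also have "\<dots> \<longleftrightarrow> (\<forall>as. length as = length (x # xs) \<longrightarrow> set as \<subseteq> dom M \<longrightarrow>
    sat M (upds e (x # xs) as) r p)" (is "?L \<longleftrightarrow> ?R")
  proof
    assume ?L
    then show ?R by (auto simp: length_Suc_conv)
  next
    assume R: ?R
    show ?L
    proof (intro ballI allI impI)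
      fix a as assume "a \<in> dom M" "length as = length xs" "set as \<subseteq> dom M"
      then show "sat M (upds (e(x := a)) xs as) r p" using R[rule_format, of "a # as"] by simp
    qed
  qed
  finally show ?case .
qed simp

section \<open>Validity and soundness\<close>

definition proper_env :: "'a model \<Rightarrow> (nat \<Rightarrow> 'a) \<Rightarrow> (nat \<Rightarrow> nat \<Rightarrow> 'a list set) \<Rightarrow> bool" where
  "proper_env M e r \<longleftrightarrow> (\<forall>x. e x \<in> dom M) \<and> (\<forall>n k. r n k \<in> rels M n)"

definition valid_in :: "'a model \<Rightarrow> fm \<Rightarrow> bool" where
  "valid_in M p \<longleftrightarrow> (\<forall>e r. proper_env M e r \<longrightarrow> sat M e r p)"

lemma is_model_iff: "is_model I M T \<longleftrightarrow> henkin_structure I M \<and> (\<forall>p\<in>T. valid_in M p)"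
  unfolding is_model_def valid_in_def proper_env_def by auto

lemma proper_env_updO: "proper_env M e r \<Longrightarrow> a \<in> dom M \<Longrightarrow> proper_env M (e(x := a)) r"
  by (auto simp: proper_env_def)

lemma proper_env_updR:
  "proper_env M e r \<Longrightarrow> A \<in> rels M n \<Longrightarrow> proper_env M e (r(n := (r n)(k := A)))"
  by (auto simp: proper_env_def)

lemma sat_instO: "sat M e r (instO x t p) \<longleftrightarrow> sat M (e(x := val M e r t)) r p"
  unfolding instO_def sat_subst by (rule sat_cong) auto

lemma sat_instR: "sat M e r (instR n k j p) \<longleftrightarrow> sat M e (r(n := (r n)(k := r n j))) p"
  unfolding instR_def sat_subst by (rule sat_cong) auto

text \<open>All abstraction symbols must be interpreted here because \<open>InstO\<close> may
  instantiate with any term \<open>Ab i k\<close>, whose value then has to be an object.\<close>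

lemma soundness_total:
  assumes M: "henkin_structure UNIV M" and T: "\<forall>p\<in>T. valid_in M p" and "T \<turnstile> p"
  shows "valid_in M p"
  using \<open>T \<turnstile> p\<close>
proof induction
  case (GenO p x)
  then show ?case by (auto simp: valid_in_def intro: proper_env_updO)
next
  case (GenR p n k)
  then show ?case by (auto simp: valid_in_def intro: proper_env_updR)
next
  case (InstO x p t)
  have "val M e r t \<in> dom M" if "proper_env M e r" for e r
    using that M by (cases t) (auto simp: proper_env_def henkin_structure_def)
  then show ?case by (auto simp: valid_in_def sat_instO)
next
  case (InstR n k p j)
  then show ?case by (auto simp: valid_in_def sat_instR proper_env_def)
next
  case (DistO x p q)
  have "sat M (e(x := a)) r p \<longleftrightarrow> sat M e r p" for e r a
    using DistO by (intro sat_cong) auto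
  then show ?case by (auto simp: valid_in_def)
next
  case (DistR n k p q)
  have "sat M e (r(n := (r n)(k := A))) p \<longleftrightarrow> sat M e r p" for e r A
    using DistR by (intro sat_cong) auto
  then show ?case by (auto simp: valid_in_def)
next
  case (Ext x xs n j k)
  show ?case unfolding valid_in_def
  proof (intro allI impI)
    fix e r assume env: "proper_env M e r"
    have *: "r n i \<subseteq> {as. set as \<subseteq> dom M \<and> length as = Suc n}" for i
      using env M unfolding proper_env_def henkin_structure_def by blast
    have "r n j = r n k"
      if H: "\<And>as. length as = Suc n \<Longrightarrow> set as \<subseteq> dom M \<Longrightarrow>
        map (upds e (x # xs) as) (x # xs) \<in> r n j \<longleftrightarrow> map (upds e (x # xs) as) (x # xs) \<in> r n k"
    proof -
      have "as \<in> r n j \<longleftrightarrow> as \<in> r n k" if "length as = Suc n" "set as \<subseteq> dom M" for as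
        using H[OF that] Ext that(1) by (simp only: map_upds length_Cons)
      then show ?thesis using *[of j] *[of k] by blast
    qed
    then show "sat M e r (Imp (AllOs (x # xs) (Iff (Pred j (Var x) (map Var xs)) (Pred k (Var x) (map Var xs)))) (EqR n j k))"
      using Ext(2) unfolding sat.simps(6) sat_AllOs
      by (auto simp: comp_def)
  qed
qed (use T in \<open>auto simp: valid_in_def sat_instO sat_instR\<close>)

lemma sat_reduct:
  assumes "dom M' = dom M" "rels M' = rels M"
    and "LessSym \<in> syms p \<Longrightarrow> lt M' = lt M" "\<And>i. AbSym i \<in> syms p \<Longrightarrow> ab M' i = ab M i"
  shows "sat M' e r p \<longleftrightarrow> sat M e r p"
proof -
  have v: "val M' e r t = val M e r t" if "\<And>i. AbSym i \<in> syms_tm t \<Longrightarrow> ab M' i = ab M i" for e r t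
    using that by (cases t) auto
  show ?thesis using assms(3,4)
  proof (induction p arbitrary: e r)
    case (Eq s t)
    have "val M' e r s = val M e r s" "val M' e r t = val M e r t"
      by (rule v, simp add: Eq)+
    then show ?case by simp
  next
    case (Pred k t ts)
    have "map (val M' e r) (t # ts) = map (val M e r) (t # ts)"
      by (intro map_cong refl v Pred) auto
    then show ?case by (simp only: sat.simps)
  next
    case (Less s t)
    have "val M' e r s = val M e r s" "val M' e r t = val M e r t"
      by (rule v, simp add: Less)+
    then show ?case using Less by simp
  next
    case (Imp p q)
    then show ?case by simp
  next
    case (AllO x p)
    then show ?case by (simp add: assms(1))
  next
    case (AllR n k p)
    then show ?case by (simp add: assms(2))
  qed auto
qed

text \<open>Derivations may mention symbols outside of the signature, which \<open>M\<close> interprets arbitrarily;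
  they are first made total.\<close>

lemma soundness:
  assumes M: "is_model I M T" and T: "T \<subseteq> lang I" and p: "p \<in> lang I" and "T \<turnstile> p"
  shows "valid_in M p"
proof -
  obtain d where d: "d \<in> dom M" using M by (auto simp: is_model_def henkin_structure_def)
  define N where "N = M\<lparr>ab := \<lambda>i X. if i \<in> I then ab M i X else d\<rparr>"
  have sat: "sat N e r q \<longleftrightarrow> sat M e r q" if "q \<in> lang I" for e r q
    using that by (intro sat_reduct) (auto simp: N_def lang_def)
  then have valid: "valid_in N q \<longleftrightarrow> valid_in M q" if "q \<in> lang I" for q
    using that by (simp add: valid_in_def proper_env_def N_def)
  have "henkin_structure UNIV N"
    using M d by (auto simp: N_def is_model_def henkin_structure_def)
  moreover have "\<forall>q\<in>T. valid_in N q" using M T valid by (auto simp: is_model_iff)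
  ultimately have "valid_in N p" using \<open>T \<turnstile> p\<close> by (rule soundness_total)
  then show ?thesis using p valid by simp
qed


section \<open>Completeness\<close>

text \<open>Hypotheses in \<open>H\<close> may only be used with modus ponens, and generalization is
  confined to theorems of \<open>T\<close>. This gives the deduction theorem without any condition
  on variables.\<close>

inductive drv :: "fm set \<Rightarrow> fm set \<Rightarrow> fm \<Rightarrow> bool" for T H :: "fm set" where
  Hyp: "p \<in> H \<Longrightarrow> drv T H p"
| Thm: "T \<turnstile> p \<Longrightarrow> drv T H p"
| MP: "drv T H (Imp p q) \<Longrightarrow> drv T H p \<Longrightarrow> drv T H q"

lemma drv_mono: "drv T H p \<Longrightarrow> H \<subseteq> H' \<Longrightarrow> drv T H' p"
  by (induction rule: drv.induct) (auto intro: drv.intros)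

lemma drv_empty: "drv T {} p \<Longrightarrow> T \<turnstile> p"
  by (induction rule: drv.induct) (auto intro: prv.MP)

lemma prv_refl: "T \<turnstile> Imp p p"
  by (meson prv.MP prv.K prv.S)

lemma drv_ImpI: "drv T (insert p H) q \<Longrightarrow> drv T H (Imp p q)"
proof (induction rule: drv.induct)
  case (Hyp q)
  then show ?case by (metis drv.simps insertE prv.K prv_refl)
next
  case (Thm q)
  then show ?case by (meson drv.Thm prv.K prv.MP)
next
  case (MP q q')
  then show ?case by (meson drv.MP drv.Thm prv.S)
qed

lemma drv_ccontr: "drv T (insert (Neg p) H) Bot \<Longrightarrow> drv T H p"
  by (meson drv.MP drv.Thm drv_ImpI prv.DN)

lemma drv_cases:
  assumes "drv T (insert a H) p" "drv T (insert (Neg a) H) p"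
  shows "drv T H p"
proof (rule drv_ccontr)
  let ?H = "insert (Neg p) H"
  have np: "drv T ?H (Neg p)" by (rule drv.Hyp) simp
  have "drv T ?H (Imp a p)" "drv T ?H (Imp (Neg a) p)"
    using assms by (auto intro!: drv_ImpI elim: drv_mono)
  moreover have "drv T (insert a ?H) Bot"
    by (meson calculation(1) drv.Hyp drv.MP drv_mono insertI1 np subset_insertI)
  then have "drv T ?H (Neg a)" by (rule drv_ImpI)
  ultimately show "drv T ?H Bot" using np by (meson drv.MP)
qed

section \<open>Propositional completeness, with atoms and quantified formulas as letters\<close>

fun peval :: "(fm \<Rightarrow> bool) \<Rightarrow> fm \<Rightarrow> bool" where
  "peval v Bot \<longleftrightarrow> False"
| "peval v (Imp p q) \<longleftrightarrow> (peval v p \<longrightarrow> peval v q)"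
| "peval v p \<longleftrightarrow> v p"

fun prime_parts :: "fm \<Rightarrow> fm set" where
  "prime_parts Bot = {}"
| "prime_parts (Imp p q) = prime_parts p \<union> prime_parts q"
| "prime_parts p = {p}"

lemma finite_prime_parts: "finite (prime_parts p)"
  by (induction p) auto

definition lits :: "(fm \<Rightarrow> bool) \<Rightarrow> fm set \<Rightarrow> fm set" where
  "lits v A = (\<lambda>p. if v p then p else Neg p) ` A"

text \<open>Kalmar's argument: the literals that are true under \<open>v\<close> decide every
  formula built from their letters. A formula true under all \<open>v\<close> then follows from all
  sets of literals, and \<open>drv_lits\<close> removes the letters one at a time by case
  distinction.\<close>

lemma kalmar:
  assumes "prime_parts p \<subseteq> A"
  shows "drv T (lits v A) (if peval v p then p else Neg p)"
  using assms
proof (induction p)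
  case Bot
  then show ?case by (simp add: drv.Thm prv_refl)
next
  case (Imp p q)
  let ?H = "lits v A"
  have IH: "drv T ?H (if peval v p then p else Neg p)" "drv T ?H (if peval v q then q else Neg q)"
    using Imp by auto
  consider "peval v q" | "\<not> peval v p" | "peval v p" "\<not> peval v q" by blast
  then show ?case
  proof cases
    case 1
    then show ?thesis using IH(2) by simp (meson drv.MP drv.Thm prv.K)
  next
    case 2
    then have np: "drv T ?H (Neg p)" using IH(1) by simp
    have "drv T (insert (Neg q) (insert p ?H)) Bot"
      using np by (meson drv.Hyp drv.MP drv_mono insertI1 subset_insertI)
    then have "drv T ?H (Imp p q)" by (rule drv_ImpI[OF drv_ccontr])
    then show ?thesis using 2 by simp
  next
    case 3
    let ?H' = "insert (Imp p q) ?H"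
    have p: "drv T ?H p" and q: "drv T ?H (Neg q)" using IH 3 by auto
    have "drv T ?H' p" "drv T ?H' (Neg q)" using p q by (auto elim: drv_mono)
    moreover have "drv T ?H' (Imp p q)" by (rule drv.Hyp) simp
    ultimately have "drv T ?H' Bot" by (meson drv.MP)
    then show ?thesis using 3 by (simp add: drv_ImpI)
  qed
qed (auto simp: lits_def intro!: drv.Hyp)

lemma drv_lits:
  assumes "finite A" "\<And>v. drv T (lits v A) p"
  shows "T \<turnstile> p"
  using assms
proof (induction A)
  case empty
  then show ?case by (simp add: lits_def drv_empty)
next
  case (insert a A)
  show ?case
  proof (rule insert.IH)
    fix v
    have *: "lits (v(a := b)) (insert a A) = insert (if b then a else Neg a) (lits v A)" for b
      using insert.hyps(2) by (auto simp: lits_def)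
    show "drv T (lits v A) p"
      using insert.prems[of "v(a := True)"] insert.prems[of "v(a := False)"]
      unfolding * by (auto intro: drv_cases[of T a])
  qed
qed

text \<open>From here on propositional steps inside the calculus are settled by truth
  tables.\<close>

lemma prv_taut: "(\<And>v. peval v p) \<Longrightarrow> T \<turnstile> p"
  using kalmar[of p "prime_parts p" T] by (auto intro: drv_lits[OF finite_prime_parts[of p]])

lemma prv_taut1: "T \<turnstile> p \<Longrightarrow> (\<And>v. peval v p \<Longrightarrow> peval v q) \<Longrightarrow> T \<turnstile> q"
  by (rule prv.MP[OF prv_taut[of "Imp p q"]]) auto

lemma prv_taut2:
  "T \<turnstile> p \<Longrightarrow> T \<turnstile> p' \<Longrightarrow> (\<And>v. peval v p \<Longrightarrow> peval v p' \<Longrightarrow> peval v q) \<Longrightarrow> T \<turnstile> q"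
  by (rule prv.MP[OF prv.MP[OF prv_taut[of "Imp p (Imp p' q)"]]]) auto

section \<open>Renaming of bound variables\<close>

lemma fv_image_id [simp]: "fv_image Var (\<lambda>n k. k) A = A"
  by (auto simp: fv_image_def split: var.splits)

lemma subst_tm_id [simp]: "subst_tm Var (\<lambda>n k. k) t = t"
  by (cases t) auto

lemma instO_Var_back:
  assumes "OV y \<notin> fv (AllO x p)"
  shows "instO y t (instO x (Var y) p) = instO x t p"
  unfolding instO_def subst_subst using assms by (intro subst_cong) auto

lemma instR_back:
  assumes "RV n j \<notin> fv (AllR n k p)"
  shows "instR n j i (instR n k j p) = instR n k i p"
  unfolding instR_def subst_subst using assms by (intro subst_cong) auto

lemma instO_self: "instO x (Var x) p = subst Var (\<lambda>n k. k) p"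
  by (simp add: instO_def)

lemma instR_self: "instR n k k p = subst Var (\<lambda>n k. k) p"
  unfolding instR_def by (intro subst_cong) auto

lemma fv_instO_Var: "OV y \<notin> fv (AllO x p) \<Longrightarrow> fv (instO x (Var y) p) - {OV y} = fv p - {OV x}"
  unfolding instO_def fv_subst by (subst fv_image_updO) auto

lemma fv_instR: "RV n j \<notin> fv (AllR n k p) \<Longrightarrow> fv (instR n k j p) - {RV n j} = fv p - {RV n k}"
  using fv_image_updR[of n j Var "\<lambda>n k. k" "fv p" k] by (simp add: instR_def fv_subst id_def)

text \<open>Even the identity substitution renames bound variables, so it only yields a variant of
  \<open>p\<close>. Both directions go through the induction together since \<open>Imp\<close> is
  contravariant in its first argument.\<close>

lemma prv_rename:
  "T \<turnstile> Imp p (subst Var (\<lambda>n k. k) p)" "T \<turnstile> Imp (subst Var (\<lambda>n k. k) p) p"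
proof (induction p)
  case (Imp p q)
  { case 1 show ?case using Imp(2) Imp(3) by (rule prv_taut2) auto }
  { case 2 show ?case using Imp(1) Imp(4) by (rule prv_taut2) auto }
next
  case (AllO x p)
  obtain y where y: "OV y \<notin> fv (AllO x p)"
    "subst Var (\<lambda>n k. k) (AllO x p) = AllO y (instO x (Var y) p)"
    by (rule subst_AllO[of Var "\<lambda>n k. k" p x]) (simp add: instO_def del: subst.simps)
  { case 1 show ?case unfolding y(2)
      using y(1) by (meson prv.DistO prv.GenO prv.InstO prv.MP) }
  { case 2
    have "T \<turnstile> Imp (AllO y (instO x (Var y) p)) (subst Var (\<lambda>n k. k) p)"
      by (metis instO_Var_back instO_self prv.InstO y(1))
    then have "T \<turnstile> Imp (AllO y (instO x (Var y) p)) p"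
      using AllO(2) by (rule prv_taut2) auto
    moreover have "OV x \<notin> fv (AllO y (instO x (Var y) p))"
      using fv_instO_Var[OF y(1)] by simp
    ultimately show ?case unfolding y(2) by (meson prv.DistO prv.GenO prv.MP) }
next
  case (AllR n k p)
  obtain j where j: "RV n j \<notin> fv (AllR n k p)"
    "subst Var (\<lambda>n k. k) (AllR n k p) = AllR n j (instR n k j p)"
    by (rule subst_AllR[of n Var "\<lambda>n k. k" p k]) (simp add: instR_def id_def del: subst.simps)
  { case 1 show ?case unfolding j(2)
      using j(1) by (meson prv.DistR prv.GenR prv.InstR prv.MP) }
  { case 2
    have "T \<turnstile> Imp (AllR n j (instR n k j p)) (subst Var (\<lambda>n k. k) p)"
      by (metis instR_back instR_self prv.InstR j(1))
    then have "T \<turnstile> Imp (AllR n j (instR n k j p)) p"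
      using AllR(2) by (rule prv_taut2) auto
    moreover have "RV n k \<notin> fv (AllR n j (instR n k j p))"
      using fv_instR[OF j(1)] by simp
    ultimately show ?case unfolding j(2) by (meson prv.DistR prv.GenR prv.MP) }
qed (auto simp: prv_refl map_idI)

text \<open>Generalizing over a witness variable \<open>y\<close> produces the renamed quantifier;
  this leads back to the original formula.\<close>

lemma prv_alphaO:
  assumes "OV y \<notin> fv (AllO x p)"
  shows "T \<turnstile> Imp (AllO y (instO x (Var y) p)) (AllO x p)"
proof -
  have "T \<turnstile> Imp (AllO y (instO x (Var y) p)) (subst Var (\<lambda>n k. k) p)"
    by (metis instO_Var_back instO_self prv.InstO assms)
  then have "T \<turnstile> Imp (AllO y (instO x (Var y) p)) p"
    using prv_rename(2) by (rule prv_taut2) auto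
  moreover have "OV x \<notin> fv (AllO y (instO x (Var y) p))"
    using fv_instO_Var[OF assms] by simp
  ultimately show ?thesis by (meson prv.DistO prv.GenO prv.MP)
qed

lemma prv_alphaR:
  assumes "RV n j \<notin> fv (AllR n k p)"
  shows "T \<turnstile> Imp (AllR n j (instR n k j p)) (AllR n k p)"
proof -
  have "T \<turnstile> Imp (AllR n j (instR n k j p)) (subst Var (\<lambda>n k. k) p)"
    by (metis instR_back instR_self prv.InstR assms)
  then have "T \<turnstile> Imp (AllR n j (instR n k j p)) p"
    using prv_rename(2) by (rule prv_taut2) auto
  moreover have "RV n k \<notin> fv (AllR n j (instR n k j p))"
    using fv_instR[OF assms] by simp
  ultimately show ?thesis by (meson prv.DistR prv.GenR prv.MP)
qed

section \<open>Maximal consistent sets with witnesses\<close>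

instance otm :: countable by countable_datatype
instance fm :: countable by countable_datatype

text \<open>As theorems of \<open>T\<close> are read universally, consistency of an open
  \<open>g\<close> means that it is not refuted for all values of its variables; the free variables
  of \<open>g\<close> behave like constants.\<close>

definition consistent :: "fm set \<Rightarrow> fm \<Rightarrow> bool" where
  "consistent T g \<longleftrightarrow> \<not> T \<turnstile> Neg g"

text \<open>Variables not free in the finitely many formulas chosen so far serve as Henkin constants.\<close>

definition witness :: "fm \<Rightarrow> fm \<Rightarrow> fm" where
  "witness g q = (case q of
     AllO x p \<Rightarrow> Neg (instO x (Var (SOME y. OV y \<notin> fv g \<union> fv q)) p)
   | AllR n k p \<Rightarrow> Neg (instR n k (SOME j. RV n j \<notin> fv g \<union> fv q) p)
   | _ \<Rightarrow> Neg q)"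

text \<open>The choices made so far form one conjunction instead of new axioms: axioms could be
  generalized over, while the free variables of \<open>g\<close> have to stay fixed.\<close>

definition extend :: "fm set \<Rightarrow> fm \<Rightarrow> fm \<Rightarrow> fm" where
  "extend T g q = (if consistent T (Conj g q) then Conj g q else Conj (Conj g (Neg q)) (witness g q))"

text \<open>Suppose neither choice is consistent. Then \<open>g\<close> refutes \<open>q\<close>,
  and it also proves the instance of \<open>q\<close> at a variable that is not free in
  \<open>g\<close>; generalization gives \<open>q\<close> itself, so \<open>g\<close> was
  inconsistent already.\<close>

lemma consistent_extend:
  assumes "consistent T g"
  shows "consistent T (extend T g q)"
proof (cases "consistent T (Conj g q)")
  case False
  have gq: "T \<turnstile> Imp g (Neg q)"
    using False unfolding consistent_def not_not by (rule prv_taut1) auto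
  show ?thesis unfolding extend_def if_not_P[OF False] unfolding consistent_def
  proof
    assume w: "T \<turnstile> Neg (Conj (Conj g (Neg q)) (witness g q))"
    have other: "T \<turnstile> Imp g q" if "witness g q = Neg q"
      using gq w by (rule prv_taut2) (auto simp: that)
    have "T \<turnstile> Imp g q"
    proof (cases q)
      case (AllO x p)
      define y where "y = (SOME y. OV y \<notin> fv g \<union> fv q)"
      have "OV y \<notin> fv g \<union> fv q" unfolding y_def by (rule someI_ex) (simp add: fresh_OV[of "fv g \<union> fv q", simplified])
      then have y: "OV y \<notin> fv g" "OV y \<notin> fv (AllO x p)" using AllO by auto
      have "T \<turnstile> Imp g (instO x (Var y) p)"
        using gq w by (rule prv_taut2) (auto simp: witness_def AllO y_def)
      then have "T \<turnstile> Imp g (AllO y (instO x (Var y) p))"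
        using y(1) by (meson prv.DistO prv.GenO prv.MP)
      then show ?thesis
        using prv_alphaO[OF y(2)] unfolding AllO by (rule prv_taut2) auto
    next
      case (AllR n k p)
      define j where "j = (SOME j. RV n j \<notin> fv g \<union> fv q)"
      have "RV n j \<notin> fv g \<union> fv q" unfolding j_def by (rule someI_ex) (simp add: fresh_RV[of "fv g \<union> fv q", simplified])
      then have j: "RV n j \<notin> fv g" "RV n j \<notin> fv (AllR n k p)" using AllR by auto
      have "T \<turnstile> Imp g (instR n k j p)"
        using gq w by (rule prv_taut2) (auto simp: witness_def AllR j_def)
      then have "T \<turnstile> Imp g (AllR n j (instR n k j p))"
        using j(1) by (meson prv.DistR prv.GenR prv.MP)
      then show ?thesis
        using prv_alphaR[OF j(2)] unfolding AllR by (rule prv_taut2) auto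
    qed (rule other, simp add: witness_def)+
    with gq have "T \<turnstile> Neg g" by (rule prv_taut2) auto
    with assms show False by (simp add: consistent_def)
  qed
qed (simp add: extend_def)

primrec chain :: "fm set \<Rightarrow> fm \<Rightarrow> nat \<Rightarrow> fm" where
  "chain T g 0 = g"
| "chain T g (Suc n) = extend T (chain T g n) (from_nat n)"

text \<open>The injection \<open>c\<close> places the terms into the prescribed type
  \<open>'a\<close>, in which the model has to live.\<close>

locale henkin =
  fixes T :: "fm set" and g :: fm and c :: "otm \<Rightarrow> 'a"
  assumes cons: "consistent T g" and inj_c: "inj c"
begin

definition G :: "fm set" where "G = {q. \<exists>n. T \<turnstile> Imp (chain T g n) q}"

lemma consistent_chain: "consistent T (chain T g n)"
  by (induction n) (simp_all add: cons consistent_extend)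

lemma chain_step: "T \<turnstile> Imp (chain T g (Suc n)) (chain T g n)"
  by (rule prv_taut) (auto simp: extend_def)

lemma chain_mono: "n \<le> m \<Longrightarrow> T \<turnstile> Imp (chain T g m) (chain T g n)"
proof (induction rule: dec_induct)
  case base
  show ?case by (rule prv_refl)
next
  case (step m)
  show ?case using chain_step step.IH by (rule prv_taut2) auto
qed

lemma G_chain: "chain T g n \<in> G"
  unfolding G_def using prv_refl by blast

lemma G_taut2:
  assumes "p \<in> G" "p' \<in> G" "\<And>v. peval v p \<Longrightarrow> peval v p' \<Longrightarrow> peval v q"
  shows "q \<in> G"
proof -
  obtain n m where "T \<turnstile> Imp (chain T g n) p" "T \<turnstile> Imp (chain T g m) p'"
    using assms unfolding G_def by blast
  then have "T \<turnstile> Imp (chain T g (max n m)) p" "T \<turnstile> Imp (chain T g (max n m)) p'"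
    by (auto intro: prv_taut2[OF chain_mono[of n "max n m"]] prv_taut2[OF chain_mono[of m "max n m"]])
  then have "T \<turnstile> Imp (chain T g (max n m)) q"
    by (rule prv_taut2) (use assms(3) in auto)
  then show ?thesis unfolding G_def by blast
qed

lemma G_taut1: "p \<in> G \<Longrightarrow> (\<And>v. peval v p \<Longrightarrow> peval v q) \<Longrightarrow> q \<in> G"
  by (rule G_taut2[of p p])

lemma G_prv: "T \<turnstile> p \<Longrightarrow> p \<in> G"
  unfolding G_def using prv.MP[OF prv.K] by blast

lemma G_MP: "Imp p q \<in> G \<Longrightarrow> p \<in> G \<Longrightarrow> q \<in> G"
  by (erule (1) G_taut2) auto

lemma G_Bot: "Bot \<notin> G"
  using consistent_chain by (auto simp: G_def consistent_def)

text \<open>The formula \<open>q\<close> is treated at stage \<open>to_nat q\<close>, so the next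
  element of the chain contains the decision together with the witness.\<close>

lemma G_decides: "q \<in> G \<or> Neg q \<in> G \<and> (\<exists>h. witness h q \<in> G)"
proof -
  let ?h = "chain T g (to_nat q)"
  have "Conj ?h q \<in> G \<or> Conj (Conj ?h (Neg q)) (witness ?h q) \<in> G"
    using G_chain[of "Suc (to_nat q)"] by (simp add: extend_def split: if_splits)
  then show ?thesis
  proof
    assume "Conj ?h q \<in> G"
    then have "q \<in> G" by (rule G_taut1) auto
    then show ?thesis ..
  next
    assume *: "Conj (Conj ?h (Neg q)) (witness ?h q) \<in> G"
    have "Neg q \<in> G" by (rule G_taut1[OF *]) auto
    moreover have "witness ?h q \<in> G" by (rule G_taut1[OF *]) auto
    ultimately show ?thesis by blast
  qed
qed

lemma G_Neg: "Neg q \<in> G \<longleftrightarrow> q \<notin> G"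
proof
  assume "Neg q \<in> G"
  then show "q \<notin> G" using G_MP G_Bot by blast
next
  assume "q \<notin> G"
  then show "Neg q \<in> G" using G_decides by blast
qed

lemma G_Imp: "Imp p q \<in> G \<longleftrightarrow> (p \<in> G \<longrightarrow> q \<in> G)"
proof (cases "p \<in> G \<and> q \<notin> G")
  case False
  then consider "q \<in> G" | "Neg p \<in> G" using G_Neg by blast
  then have "Imp p q \<in> G"
  proof cases
    case 1
    then show ?thesis by (rule G_taut1) auto
  next
    case 2
    then show ?thesis by (rule G_taut1) auto
  qed
  then show ?thesis using False by blast
qed (use G_MP in blast)

lemma G_witness: "q \<notin> G \<Longrightarrow> \<exists>h. witness h q \<in> G"
  using G_decides by blast

lemma G_AllO: "AllO x p \<in> G \<longleftrightarrow> (\<forall>t. instO x t p \<in> G)"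
proof
  show "AllO x p \<in> G \<Longrightarrow> \<forall>t. instO x t p \<in> G"
    using G_MP G_prv prv.InstO by blast
  assume "\<forall>t. instO x t p \<in> G"
  then show "AllO x p \<in> G"
    using G_witness[of "AllO x p"] by (auto simp: witness_def G_Neg)
qed

lemma G_AllR: "AllR n k p \<in> G \<longleftrightarrow> (\<forall>j. instR n k j p \<in> G)"
proof
  show "AllR n k p \<in> G \<Longrightarrow> \<forall>j. instR n k j p \<in> G"
    using G_MP G_prv prv.InstR by blast
  assume "\<forall>j. instR n k j p \<in> G"
  then show "AllR n k p \<in> G"
    using G_witness[of "AllR n k p"] by (auto simp: witness_def G_Neg)
qed

lemma G_rename: "subst Var (\<lambda>n k. k) p \<in> G \<longleftrightarrow> p \<in> G"
  using G_MP G_prv prv_rename by blast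

text \<open>Stated for arbitrary \<open>\<sigma>\<close> and \<open>\<tau>\<close> because
  assignments into the term model appear as substitutions in \<open>truth\<close>; instantiating the
  renamed quantifier amounts to updating \<open>\<sigma>\<close>.\<close>

lemma G_subst_AllO: "subst \<sigma> \<tau> (AllO x p) \<in> G \<longleftrightarrow> (\<forall>t. subst (\<sigma>(x := t)) \<tau> p \<in> G)"
proof -
  obtain y where y: "OV y \<notin> fv_image \<sigma> \<tau> (fv p - {OV x})"
    "subst \<sigma> \<tau> (AllO x p) = AllO y (subst (\<sigma>(x := Var y)) \<tau> p)"
    by (rule subst_AllO)
  have "instO y t (subst (\<sigma>(x := Var y)) \<tau> p) = subst (\<sigma>(x := t)) \<tau> p" for t
    unfolding instO_def subst_subst
  proof (rule subst_cong)
    fix w assume w: "OV w \<in> fv p"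
    show "subst_tm (Var(y := t)) (\<lambda>n k. k) ((\<sigma>(x := Var y)) w) = (\<sigma>(x := t)) w"
    proof (cases "w = x")
      case False
      then have "OV y \<notin> fv_tm (\<sigma> w)" using y(1) w by (force simp: fv_image_def)
      then have "subst_tm (Var(y := t)) (\<lambda>n k. k) (\<sigma> w) = subst_tm Var (\<lambda>n k. k) (\<sigma> w)"
        by (intro subst_tm_cong) auto
      then show ?thesis using False by simp
    qed simp
  qed simp
  then show ?thesis unfolding y(2) G_AllO by simp
qed

lemma G_subst_AllR:
  "subst \<sigma> \<tau> (AllR n k p) \<in> G \<longleftrightarrow> (\<forall>i. subst \<sigma> (\<tau>(n := (\<tau> n)(k := i))) p \<in> G)"
proof -
  obtain j where j: "RV n j \<notin> fv_image \<sigma> \<tau> (fv p - {RV n k})"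
    "subst \<sigma> \<tau> (AllR n k p) = AllR n j (subst \<sigma> (\<tau>(n := (\<tau> n)(k := j))) p)"
    by (rule subst_AllR)
  have "instR n j i (subst \<sigma> (\<tau>(n := (\<tau> n)(k := j))) p) = subst \<sigma> (\<tau>(n := (\<tau> n)(k := i))) p" for i
    unfolding instR_def subst_subst
  proof (rule subst_cong)
    fix w assume "OV w \<in> fv p"
    then have "RV n j \<notin> fv_tm (\<sigma> w)" using j(1) by (force simp: fv_image_def)
    then have "subst_tm Var ((\<lambda>n k. k)(n := id(j := i))) (\<sigma> w) = subst_tm Var (\<lambda>n k. k) (\<sigma> w)"
      by (intro subst_tm_cong) auto
    then show "subst_tm Var ((\<lambda>n k. k)(n := id(j := i))) (\<sigma> w) = \<sigma> w" by simp
  next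
    fix m l assume "RV m l \<in> fv p"
    then show "((\<lambda>n k. k)(n := id(j := i))) m ((\<tau>(n := (\<tau> n)(k := j))) m l)
        = (\<tau>(n := (\<tau> n)(k := i))) m l"
      using j(1) by (force simp: fv_image_def)
  qed
  then show ?thesis unfolding j(2) G_AllR by simp
qed

lemma G_subst_AllOs:
  assumes "\<And>ts. length ts = length xs \<Longrightarrow> subst (upds \<sigma> xs ts) \<tau> p \<in> G"
  shows "subst \<sigma> \<tau> (AllOs xs p) \<in> G"
  using assms
proof (induction xs arbitrary: \<sigma>)
  case (Cons x xs)
  have "subst (\<sigma>(x := t)) \<tau> (AllOs xs p) \<in> G" for t
  proof (rule Cons.IH)
    fix ts :: "otm list" assume "length ts = length xs"
    then show "subst (upds (\<sigma>(x := t)) xs ts) \<tau> p \<in> G" using Cons.prems[of "t # ts"] by simp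
  qed
  then show ?case using G_subst_AllO by simp
qed simp

section \<open>The term model\<close>

lemma G_Leibniz: "Eq s t \<in> G \<Longrightarrow> instO x s p \<in> G \<Longrightarrow> instO x t p \<in> G"
  using G_MP G_prv prv.LeibnizO by blast

lemma G_refl: "Eq t t \<in> G"
  by (rule G_prv) (rule prv.ReflO)

lemma subst_tm_fresh: "OV x \<notin> fv_tm t \<Longrightarrow> subst_tm (Var(x := s)) (\<lambda>n k. k) t = t"
  by (cases t) auto

lemma G_sym: "Eq s t \<in> G \<Longrightarrow> Eq t s \<in> G"
proof -
  assume st: "Eq s t \<in> G"
  obtain x where "OV x \<notin> fv_tm s" using fresh_OV[of "fv_tm s"] by auto
  then show ?thesis
    using G_Leibniz[OF st, of x "Eq (Var x) s"] G_refl by (simp add: instO_def subst_tm_fresh)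
qed

lemma G_trans: "Eq s t \<in> G \<Longrightarrow> Eq t u \<in> G \<Longrightarrow> Eq s u \<in> G"
proof -
  assume st: "Eq s t \<in> G" and tu: "Eq t u \<in> G"
  obtain x where "OV x \<notin> fv_tm s" using fresh_OV[of "fv_tm s"] by auto
  then show ?thesis
    using G_Leibniz[OF tu, of x "Eq s (Var x)"] st by (simp add: instO_def subst_tm_fresh)
qed

text \<open>The quotient of the terms by the equations in \<open>G\<close>, realized inside
  \<open>'a\<close>: a class is represented by the code of a chosen member.\<close>

definition rep :: "otm \<Rightarrow> 'a" where "rep t = c (SOME s. Eq s t \<in> G)"

lemma rep_eq_iff: "rep s = rep t \<longleftrightarrow> Eq s t \<in> G"
proof
  assume "Eq s t \<in> G"
  then have "Eq u s \<in> G \<longleftrightarrow> Eq u t \<in> G" for u using G_sym G_trans by blast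
  then show "rep s = rep t" by (simp add: rep_def)
next
  have *: "Eq (SOME s. Eq s t \<in> G) t \<in> G" for t by (rule someI[of _ t]) (rule G_refl)
  assume "rep s = rep t"
  then have "(SOME u. Eq u s \<in> G) = (SOME u. Eq u t \<in> G)"
    using inj_c by (simp add: rep_def inj_eq)
  then show "Eq s t \<in> G" using *[of s] *[of t] G_sym G_trans by metis
qed

definition Pr :: "nat \<Rightarrow> otm list \<Rightarrow> fm" where "Pr k us = Pred k (hd us) (tl us)"

lemma subst_Pr:
  "us \<noteq> [] \<Longrightarrow> subst \<sigma> \<tau> (Pr k us) = Pr (\<tau> (length us - 1) k) (map (subst_tm \<sigma> \<tau>) us)"
  by (cases us) (auto simp: Pr_def)

lemma Pr_replace1:
  assumes "Eq s t \<in> G" "Pr k (pre @ s # post) \<in> G"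
  shows "Pr k (pre @ t # post) \<in> G"
proof -
  have "finite (\<Union> (fv_tm ` (set pre \<union> set post)))" by auto
  then obtain x where x: "OV x \<notin> \<Union> (fv_tm ` (set pre \<union> set post))" using fresh_OV by blast
  then have "map (subst_tm (Var(x := u)) (\<lambda>n k. k)) pre = pre"
    "map (subst_tm (Var(x := u)) (\<lambda>n k. k)) post = post" for u
    by (auto intro!: map_idI subst_tm_fresh)
  then have "instO x u (Pr k (pre @ Var x # post)) = Pr k (pre @ u # post)" for u
    by (simp add: instO_def subst_Pr)
  then show ?thesis using G_Leibniz[OF assms(1), of x "Pr k (pre @ Var x # post)"] assms(2) by simp
qed

lemma Pr_replace:
  "list_all2 (\<lambda>s t. Eq s t \<in> G) us vs \<Longrightarrow> Pr k (pre @ us) \<in> G \<Longrightarrow> Pr k (pre @ vs) \<in> G"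
proof (induction us vs arbitrary: pre rule: list_all2_induct)
  case (Cons u us v vs)
  then have "Pr k (pre @ v # us) \<in> G" using Pr_replace1 by blast
  then show ?case using Cons.IH[of "pre @ [v]"] by simp
qed simp

definition Rl :: "nat \<Rightarrow> nat \<Rightarrow> 'a list set" where
  "Rl n k = {map rep us | us. length us = Suc n \<and> Pr k us \<in> G}"

lemma mem_Rl:
  assumes "length us = Suc n"
  shows "map rep us \<in> Rl n k \<longleftrightarrow> Pr k us \<in> G"
proof
  assume "map rep us \<in> Rl n k"
  then obtain vs where vs: "map rep us = map rep vs" "Pr k vs \<in> G" by (auto simp: Rl_def)
  then have "list_all2 (\<lambda>s t. Eq s t \<in> G) vs us"
    by (metis (mono_tags, lifting) length_map list_all2_conv_all_nth nth_map rep_eq_iff)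
  then show "Pr k us \<in> G" using Pr_replace[of vs us k "[]"] vs by simp
qed (use assms in \<open>auto simp: Rl_def\<close>)

text \<open>From left to right this is Leibniz's law. From right to left extensionality enters: if
  the two relations agree on all terms, every instance of the equivalence lies in \<open>G\<close>,
  hence so does its universal closure over the tuple.\<close>

lemma EqR_iff: "EqR n j k \<in> G \<longleftrightarrow> Rl n j = Rl n k"
proof
  have sub: "Rl n j \<subseteq> Rl n k" if "EqR n j k \<in> G" for j k
  proof
    fix a assume "a \<in> Rl n j"
    then obtain us where us: "a = map rep us" "length us = Suc n" "Pr j us \<in> G"
      by (auto simp: Rl_def)
    obtain l where l: "RV n l \<notin> \<Union> (fv_tm ` set us)"
      using fresh_RV[of "\<Union> (fv_tm ` set us)"] by auto
    have "instR n l i (Pr l us) = Pr i us" for i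
    proof -
      have "map (subst_tm Var ((\<lambda>n k. k)(n := id(l := i)))) us = us"
      proof (rule map_idI)
        fix u assume "u \<in> set us"
        then have "subst_tm Var ((\<lambda>n k. k)(n := id(l := i))) u = subst_tm Var (\<lambda>n k. k) u"
          using l by (intro subst_tm_cong) auto
        then show "subst_tm Var ((\<lambda>n k. k)(n := id(l := i))) u = u" by simp
      qed
      moreover have "us \<noteq> []" using us(2) by auto
      ultimately show ?thesis using us(2) by (simp add: instR_def subst_Pr del: fun_upd_apply) simp
    qed
    then have "Pr k us \<in> G"
      using G_MP[OF G_MP[OF G_prv[OF prv.LeibnizR[of T n j k l "Pr l us"]] that]] us(3) by simp
    then show "a \<in> Rl n k" using us by (auto simp: Rl_def)
  qed
  assume e: "EqR n j k \<in> G"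
  have "Imp (instR n l j (EqR n l j)) (instR n l k (EqR n l j)) \<in> G" for l
    using G_MP[OF G_prv[OF prv.LeibnizR] e] .
  \<comment> \<open>\<open>Suc j\<close> is just a variable other than \<open>j\<close>, so that
    only the left side of \<open>EqR n l j\<close> is replaced; this is symmetry.\<close>
  from this[of "Suc j"] have "EqR n k j \<in> G"
    using G_prv[OF prv.ReflR] by (simp add: instR_def G_Imp)
  with e sub show "Rl n j = Rl n k" by blast
next
  assume eq: "Rl n j = Rl n k"
  define xs where "xs = [1..<Suc n]"
  have xs: "distinct (0 # xs)" "length xs = n" by (auto simp: xs_def)
  let ?p = "Iff (Pred j (Var 0) (map Var xs)) (Pred k (Var 0) (map Var xs))"
  have "subst Var (\<lambda>n k. k) (AllOs (0 # xs) ?p) \<in> G"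
  proof (rule G_subst_AllOs)
    fix ts :: "otm list" assume ts: "length ts = length (0 # xs)"
    let ?s = "subst (upds Var (0 # xs) ts) (\<lambda>n k. k)"
    have "map (upds Var (0 # xs) ts) (0 # xs) = ts" using xs ts by (simp only: map_upds)
    then have "?s (Pred i (Var 0) (map Var xs)) = Pr i ts" for i
      by (cases ts) (auto simp: Pr_def comp_def)
    moreover have "Pr j ts \<in> G \<longleftrightarrow> Pr k ts \<in> G" using mem_Rl[of ts n j] mem_Rl[of ts n k] eq ts xs(2) by simp
    moreover have "?s ?p = Iff (?s (Pred j (Var 0) (map Var xs))) (?s (Pred k (Var 0) (map Var xs)))"
      by simp
    ultimately show "?s ?p \<in> G" by (simp add: G_Imp G_Bot)
  qed
  then have "AllOs (0 # xs) ?p \<in> G" by (simp only: G_rename)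
  then show "EqR n j k \<in> G" using G_MP G_prv prv.Ext[OF xs] by blast
qed

lemma Less_cong:
  assumes "Eq s s' \<in> G" "Eq t t' \<in> G" "Less s t \<in> G"
  shows "Less s' t' \<in> G"
proof -
  obtain x where "OV x \<notin> fv_tm t" using fresh_OV[of "fv_tm t"] by auto
  then have "Less s' t \<in> G"
    using G_Leibniz[OF assms(1), of x "Less (Var x) t"] assms(3) by (simp add: instO_def subst_tm_fresh)
  moreover obtain x where "OV x \<notin> fv_tm s'" using fresh_OV[of "fv_tm s'"] by auto
  ultimately show ?thesis
    using G_Leibniz[OF assms(2), of x "Less s' (Var x)"] by (simp add: instO_def subst_tm_fresh)
qed

lemma Ab_cong:
  assumes "Rl 0 j = Rl 0 k"
  shows "Eq (Ab i j) (Ab i k) \<in> G"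
proof -
  have e: "EqR 0 j k \<in> G" using assms EqR_iff by simp
  have "Imp (instR 0 (Suc j) j (Eq (Ab i j) (Ab i (Suc j)))) (instR 0 (Suc j) k (Eq (Ab i j) (Ab i (Suc j)))) \<in> G"
    using G_MP[OF G_prv[OF prv.LeibnizR] e] .
  then show ?thesis using G_refl by (simp add: instR_def G_Imp)
qed

definition M :: "'a model" where
  "M = \<lparr>dom = range rep, rels = (\<lambda>n. range (Rl n)),
        lt = (\<lambda>a b. \<exists>s t. a = rep s \<and> b = rep t \<and> Less s t \<in> G),
        ab = (\<lambda>i A. rep (Ab i (SOME k. Rl 0 k = A)))\<rparr>"

text \<open>The operator is applied to a relation and must pick one of its names;
  \<open>Ab_cong\<close> makes the choice immaterial.\<close>

lemma ab_M: "ab M i (Rl 0 k) = rep (Ab i k)"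
proof -
  have "Rl 0 (SOME j. Rl 0 j = Rl 0 k) = Rl 0 k" by (rule someI) (rule refl)
  then show ?thesis by (simp add: M_def rep_eq_iff Ab_cong)
qed

lemma val_M: "val M (\<lambda>x. rep (\<sigma> x)) (\<lambda>n k. Rl n (\<tau> n k)) t = rep (subst_tm \<sigma> \<tau> t)"
  by (cases t) (auto simp: ab_M)

text \<open>Objects and relations of \<open>M\<close> are all named, so every assignment comes from
  a pair of substitutions. Quantifiers over the model thereby become quantifiers over updated
  substitutions, which is what the closure properties of \<open>G\<close> describe.\<close>

lemma truth: "sat M (\<lambda>x. rep (\<sigma> x)) (\<lambda>n k. Rl n (\<tau> n k)) p \<longleftrightarrow> subst \<sigma> \<tau> p \<in> G"
proof (induction p arbitrary: \<sigma> \<tau>)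
  case (Eq s t)
  then show ?case by (simp add: val_M rep_eq_iff)
next
  case (EqR n j k)
  then show ?case by (simp add: EqR_iff)
next
  case (Pred k t ts)
  have "map (val M (\<lambda>x. rep (\<sigma> x)) (\<lambda>n k. Rl n (\<tau> n k))) (t # ts)
    = map rep (map (subst_tm \<sigma> \<tau>) (t # ts))"
    by (simp add: val_M)
  then show ?case
    using mem_Rl[of "map (subst_tm \<sigma> \<tau>) (t # ts)" "length ts" "\<tau> (length ts) k"]
    unfolding sat.simps by (simp only:) (simp add: Pr_def)
next
  case (Less s t)
  have "lt M (rep s) (rep t) \<longleftrightarrow> Less s t \<in> G" for s t
  proof
    assume "lt M (rep s) (rep t)"
    then obtain s' t' where "rep s = rep s'" "rep t = rep t'" "Less s' t' \<in> G"
      by (auto simp: M_def)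
    then show "Less s t \<in> G" using Less_cong rep_eq_iff by metis
  qed (auto simp: M_def)
  then show ?case by (simp add: val_M)
next
  case Bot
  then show ?case by (simp add: G_Bot)
next
  case (Imp p q)
  then show ?case by (simp add: G_Imp)
next
  case (AllO x p)
  have *: "(\<lambda>y. rep (\<sigma> y))(x := rep t) = (\<lambda>y. rep ((\<sigma>(x := t)) y))" for t by auto
  have "sat M (\<lambda>x. rep (\<sigma> x)) (\<lambda>n k. Rl n (\<tau> n k)) (AllO x p) \<longleftrightarrow>
    (\<forall>t. sat M ((\<lambda>y. rep (\<sigma> y))(x := rep t)) (\<lambda>n k. Rl n (\<tau> n k)) p)"
    by (simp add: M_def)
  then show ?case unfolding * AllO.IH G_subst_AllO .
next
  case (AllR n k p)
  have *: "(\<lambda>n k. Rl n (\<tau> n k))(n := (\<lambda>k. Rl n (\<tau> n k))(k := Rl n i))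
    = (\<lambda>m l. Rl m ((\<tau>(n := (\<tau> n)(k := i))) m l))" for i by (intro ext) auto
  have "sat M (\<lambda>x. rep (\<sigma> x)) (\<lambda>n k. Rl n (\<tau> n k)) (AllR n k p) \<longleftrightarrow>
    (\<forall>i. sat M (\<lambda>x. rep (\<sigma> x)) ((\<lambda>n k. Rl n (\<tau> n k))(n := (\<lambda>k. Rl n (\<tau> n k))(k := Rl n i))) p)"
    by (simp add: M_def)
  then show ?case unfolding * AllR.IH G_subst_AllR .
qed

lemma truth_id: "sat M (\<lambda>x. rep (Var x)) Rl p \<longleftrightarrow> p \<in> G"
  using truth[of Var "\<lambda>n k. k" p] by (simp add: G_rename)

lemma henkin_M: "henkin_structure UNIV M"
proof -
  have "rep t \<in> dom M" for t by (simp add: M_def)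
  then show ?thesis by (auto simp: henkin_structure_def M_def Rl_def)
qed

end

section \<open>From the canonical assignment to validity\<close>

definition gen :: "var \<Rightarrow> fm \<Rightarrow> fm" where
  "gen v p = (case v of OV x \<Rightarrow> AllO x p | RV n k \<Rightarrow> AllR n k p)"

lemma gen_simps [simp]: "gen (OV x) p = AllO x p" "gen (RV n k) p = AllR n k p"
  by (simp_all add: gen_def)

lemma prv_gens: "T \<turnstile> p \<Longrightarrow> T \<turnstile> foldr gen vs p"
  by (induction vs) (auto simp: gen_def intro: prv.GenO prv.GenR split: var.split)

lemma sat_gens:
  assumes "sat M e0 r0 (foldr gen vs p)" "proper_env M e r"
    "\<And>x. OV x \<notin> set vs \<Longrightarrow> e x = e0 x" "\<And>n k. RV n k \<notin> set vs \<Longrightarrow> r n k = r0 n k"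
  shows "sat M e r p"
  using assms
proof (induction vs arbitrary: e0 r0)
  case Nil
  then have "e = e0" "r = r0" by (auto intro!: ext)
  with Nil show ?case by simp
next
  case (Cons v vs)
  show ?case
  proof (cases v)
    case (OV x)
    then have "sat M (e0(x := e x)) r0 (foldr gen vs p)"
      using Cons.prems(1,2) by (simp add: proper_env_def)
    then show ?thesis
      by (rule Cons.IH) (use Cons.prems OV in auto)
  next
    case (RV n k)
    then have "sat M e0 (r0(n := (r0 n)(k := r n k))) (foldr gen vs p)"
      using Cons.prems(1,2) by (simp add: proper_env_def)
    then show ?thesis
      by (rule Cons.IH) (use Cons.prems RV in auto)
  qed
qed

text \<open>The truth lemma, through \<open>truth_id\<close>, evaluates formulas under the canonical
  assignment. Axioms must hold under all assignments, which is obtained from their universal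
  closures, as these are theorems too.\<close>

lemma valid_inI:
  assumes p: "\<And>vs. sat M e0 r0 (foldr gen vs p)" and proper: "proper_env M e0 r0"
  shows "valid_in M p"
  unfolding valid_in_def
proof (intro allI impI)
  fix e r assume er: "proper_env M e r"
  obtain vs where vs: "set vs = fv p" using finite_list[OF finite_fv] by blast
  let ?e = "\<lambda>x. if OV x \<in> fv p then e x else e0 x"
  let ?r = "\<lambda>n k. if RV n k \<in> fv p then r n k else r0 n k"
  have "sat M ?e ?r p"
    by (rule sat_gens[OF p[of vs]]) (use er proper vs in \<open>auto simp: proper_env_def\<close>)
  moreover have "sat M ?e ?r p \<longleftrightarrow> sat M e r p" by (rule sat_cong) auto
  ultimately show "sat M e r p" by simp
qed

theorem completeness:
  assumes "infinite (UNIV :: 'a set)" and "\<not> T \<turnstile> p"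
  shows "\<exists>M :: 'a model. henkin_structure UNIV M \<and> (\<forall>q\<in>T. valid_in M q) \<and> \<not> valid_in M p"
proof -
  obtain f :: "nat \<Rightarrow> 'a" where f: "inj f" using infinite_countable_subset[OF assms(1)] by blast
  have "consistent T (Neg p)"
    using assms(2) prv.MP[OF prv.DN] by (auto simp: consistent_def)
  moreover have "inj (\<lambda>t :: otm. f (to_nat t))"
    using inj_compose[OF f inj_to_nat] by (simp add: comp_def)
  ultimately interpret henkin T "Neg p" "\<lambda>t. f (to_nat t)" by unfold_locales
  have env: "proper_env M (\<lambda>x. rep (Var x)) Rl" by (simp add: proper_env_def M_def)
  have "sat M (\<lambda>x. rep (Var x)) Rl (foldr gen vs q)" if "q \<in> T" for q vs
    using that by (simp only: truth_id G_prv prv_gens prv.Ax)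
  then have "valid_in M q" if "q \<in> T" for q using that env by (intro valid_inI)
  moreover have "\<not> valid_in M p"
  proof -
    have "Neg p \<in> G" using G_chain[of 0] by simp
    then have "\<not> sat M (\<lambda>x. rep (Var x)) Rl p" by (simp add: truth_id G_Neg)
    then show ?thesis using env by (auto simp: valid_in_def)
  qed
  ultimately show ?thesis using henkin_M by blast
qed


lemma proves_iff_valid:
  assumes "infinite (UNIV :: 'a set)" "T \<subseteq> lang I" "p \<in> lang I"
  shows "T \<turnstile> p \<longleftrightarrow> (\<forall>M :: 'a model. is_model I M T \<longrightarrow> valid_in M p)"
proof
  assume "T \<turnstile> p"
  then show "\<forall>M :: 'a model. is_model I M T \<longrightarrow> valid_in M p"
    using soundness assms(2,3) by blast
next
  assume *: "\<forall>M :: 'a model. is_model I M T \<longrightarrow> valid_in M p"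
  show "T \<turnstile> p"
  proof (rule ccontr)
    assume "\<not> T \<turnstile> p"
    then obtain M :: "'a model" where "henkin_structure UNIV M" "\<forall>q\<in>T. valid_in M q" "\<not> valid_in M p"
      using completeness[OF assms(1)] by blast
    moreover from this(1) have "henkin_structure I M" by (auto simp: henkin_structure_def)
    ultimately show False using * unfolding is_model_iff by blast
  qed
qed

section \<open>Sets and functions inside a model\<close>

definition singles :: "'a set \<Rightarrow> 'a list set" where "singles A = (\<lambda>a. [a]) ` A"

definition pairs :: "('a \<Rightarrow> 'a \<Rightarrow> bool) \<Rightarrow> 'a list set" where "pairs R = {[a, b] | a b. R a b}"

lemma mem_singles [simp]: "[a] \<in> singles A \<longleftrightarrow> a \<in> A"
  by (auto simp: singles_def)

lemma mem_pairs [simp]: "[a, b] \<in> pairs R \<longleftrightarrow> R a b"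
  by (auto simp: pairs_def)

lemma map_singles: "map f ` singles A = singles (f ` A)"
  by (simp add: singles_def image_image)

lemma sat_ExR: "sat M e r (ExR n k p) \<longleftrightarrow> (\<exists>A\<in>rels M n. sat M e (r(n := (r n)(k := A))) p)"
  by simp

lemma sat_ExO: "sat M e r (ExO x p) \<longleftrightarrow> (\<exists>a\<in>dom M. sat M (e(x := a)) r p)"
  by simp

lemma sat_Conj: "sat M e r (Conj p q) \<longleftrightarrow> sat M e r p \<and> sat M e r q"
  by simp

lemma sat_Iff: "sat M e r (Iff p q) \<longleftrightarrow> (sat M e r p \<longleftrightarrow> sat M e r q)"
  by auto

locale base_model =
  fixes I :: "nat set" and M :: "'a model"
  assumes henkin: "henkin_structure I M"
    and base: "p \<in> base_theory I \<Longrightarrow> valid_in M p"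
begin

text \<open>Membership in the Henkin model is the recurring side condition: sets and relations of
  the metatheory count only if they are internal in this sense.\<close>

definition iset :: "'a set \<Rightarrow> bool" where "iset A \<longleftrightarrow> singles A \<in> rels M 0"

definition irel :: "('a \<Rightarrow> 'a \<Rightarrow> bool) \<Rightarrow> bool" where "irel R \<longleftrightarrow> pairs R \<in> rels M 1"

lemma rels_subset: "A \<in> rels M n \<Longrightarrow> A \<subseteq> {as. set as \<subseteq> dom M \<and> length as = Suc n}"
  using henkin unfolding henkin_structure_def by blast

lemma iset_subset: "iset A \<Longrightarrow> A \<subseteq> dom M"
  using rels_subset[of "singles A" 0] by (auto simp: iset_def singles_def)

lemma irel_dom: "irel R \<Longrightarrow> R a b \<Longrightarrow> a \<in> dom M \<and> b \<in> dom M"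
  using subsetD[OF rels_subset[of "pairs R" 1], of "[a, b]"] by (auto simp: irel_def)

lemma rels_0_cases: "X \<in> rels M 0 \<Longrightarrow> \<exists>A. iset A \<and> X = singles A"
proof -
  assume X: "X \<in> rels M 0"
  have "X = singles {a. [a] \<in> X}"
    using rels_subset[OF X] by (auto simp: singles_def image_iff length_Suc_conv)
  with X show ?thesis unfolding iset_def by metis
qed

lemma rels_1_cases: "X \<in> rels M (Suc 0) \<Longrightarrow> \<exists>R. irel R \<and> X = pairs R"
proof -
  assume X: "X \<in> rels M (Suc 0)"
  have "X = pairs (\<lambda>a b. [a, b] \<in> X)"
    using rels_subset[OF X] by (auto simp: pairs_def length_Suc_conv)
  with X show ?thesis unfolding irel_def by (metis One_nat_def)
qed

lemma ball_rels_0: "(\<forall>X\<in>rels M 0. P X) \<longleftrightarrow> (\<forall>A. iset A \<longrightarrow> P (singles A))"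
  using rels_0_cases by (auto simp: iset_def)

lemma ball_rels_1: "(\<forall>X\<in>rels M (Suc 0). P X) \<longleftrightarrow> (\<forall>R. irel R \<longrightarrow> P (pairs R))"
  using rels_1_cases by (auto simp: irel_def)

definition obj :: 'a where "obj = (SOME a. a \<in> dom M)"

definition rel0 :: "nat \<Rightarrow> 'a list set" where "rel0 n = (SOME A. A \<in> rels M n)"

lemma obj_in [simp]: "obj \<in> dom M"
  unfolding obj_def using henkin by (auto simp: henkin_structure_def intro: someI_ex)

lemma rel0_in [simp]: "rel0 n \<in> rels M n"
  unfolding rel0_def by (rule someI_ex) (use henkin in \<open>auto simp: henkin_structure_def\<close>)

text \<open>The listed sets occupy the first concept variables and the listed relations the first
  binary variables. All other variables get an arbitrary relation of the right arity, so that the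
  assignment is proper.\<close>

definition params :: "'a set list \<Rightarrow> ('a \<Rightarrow> 'a \<Rightarrow> bool) list \<Rightarrow> nat \<Rightarrow> nat \<Rightarrow> 'a list set" where
  "params As Rs n k =
     (if n = 0 \<and> k < length As then singles (As ! k)
      else if n = 1 \<and> k < length Rs then pairs (Rs ! k) else rel0 n)"

lemma params_simps [simp]:
  "k < length As \<Longrightarrow> params As Rs 0 k = singles (As ! k)"
  "k < length Rs \<Longrightarrow> params As Rs (Suc 0) k = pairs (Rs ! k)"
  by (auto simp: params_def)

lemma proper_params:
  assumes "\<forall>A\<in>set As. iset A" "\<forall>R\<in>set Rs. irel R" "\<forall>x. e x \<in> dom M"
  shows "proper_env M e (params As Rs)"
  using assms by (auto simp: proper_env_def params_def iset_def irel_def)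

text \<open>The variable for the new relation is taken fresh for \<open>p\<close>, so that every
  relation variable of \<open>p\<close> is available as a parameter.\<close>

lemma comprehension_holds:
  assumes "p \<in> lang I" "distinct (x # xs)" "proper_env M e r"
  shows "\<exists>R\<in>rels M (length xs). \<forall>as. length as = Suc (length xs) \<longrightarrow> set as \<subseteq> dom M \<longrightarrow>
    (as \<in> R \<longleftrightarrow> sat M (upds e (x # xs) as) r p)"
proof -
  let ?n = "length xs"
  obtain X where X: "RV ?n X \<notin> fv p" using fresh_RV[of "fv p"] by auto
  have "ExR ?n X (AllOs (x # xs) (Iff (Pred X (Var x) (map Var xs)) p)) \<in> base_theory I"
    using assms X unfolding base_theory_def comprehension_def by blast
  then have "sat M e r (ExR ?n X (AllOs (x # xs) (Iff (Pred X (Var x) (map Var xs)) p)))"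
    using base assms(3) unfolding valid_in_def by blast
  then obtain R where R: "R \<in> rels M ?n"
    "sat M e (r(?n := (r ?n)(X := R))) (AllOs (x # xs) (Iff (Pred X (Var x) (map Var xs)) p))"
    unfolding sat_ExR by blast
  have "as \<in> R \<longleftrightarrow> sat M (upds e (x # xs) as) r p" if as: "length as = Suc ?n" "set as \<subseteq> dom M" for as
  proof -
    let ?e = "upds e (x # xs) as" and ?r = "r(?n := (r ?n)(X := R))"
    have "sat M ?e ?r (Iff (Pred X (Var x) (map Var xs)) p)"
      using R(2) as unfolding sat_AllOs by (simp del: sat.simps)
    then have "map ?e (x # xs) \<in> R \<longleftrightarrow> sat M ?e ?r p"
      unfolding sat_Iff by (simp add: comp_def)
    moreover have "map ?e (x # xs) = as" using assms(2) as(1) by (simp only: map_upds length_Cons)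
    moreover have "sat M ?e ?r p \<longleftrightarrow> sat M ?e r p" using X by (intro sat_cong) auto
    ultimately show ?thesis by simp
  qed
  then show ?thesis using R(1) by blast
qed

text \<open>The element to be tested is always \<open>Var 0\<close>, joined by \<open>Var 1\<close>
  in \<open>irelI\<close>. The other object variables carry object parameters through
  \<open>e\<close>.\<close>

lemma isetI:
  assumes "p \<in> lang I" "\<forall>A\<in>set As. iset A" "\<forall>R\<in>set Rs. irel R" "\<forall>x. e x \<in> dom M"
    and "\<And>a. a \<in> S \<Longrightarrow> a \<in> dom M"
    and "\<And>a. a \<in> dom M \<Longrightarrow> a \<in> S \<longleftrightarrow> sat M (e(0 := a)) (params As Rs) p"
  shows "iset S"
proof -
  obtain R where R: "R \<in> rels M 0"
    "\<forall>as. length as = 1 \<longrightarrow> set as \<subseteq> dom M \<longrightarrow> (as \<in> R \<longleftrightarrow> sat M (upds e [0] as) (params As Rs) p)"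
    using comprehension_holds[OF assms(1) _ proper_params[OF assms(2-4)], of 0 "[]"] by auto
  obtain A where A: "iset A" "R = singles A" using rels_0_cases[OF R(1)] by blast
  have "a \<in> A \<longleftrightarrow> a \<in> S" if "a \<in> dom M" for a
    using R(2)[rule_format, of "[a]"] that assms(6) A by simp
  then have "S = A" using assms(5) iset_subset[OF A(1)] by blast
  then show ?thesis using A by simp
qed

lemma irelI:
  assumes "p \<in> lang I" "\<forall>A\<in>set As. iset A" "\<forall>R\<in>set Rs. irel R" "\<forall>x. e x \<in> dom M"
    and "\<And>a b. S a b \<Longrightarrow> a \<in> dom M \<and> b \<in> dom M"
    and "\<And>a b. a \<in> dom M \<Longrightarrow> b \<in> dom M \<Longrightarrow> S a b \<longleftrightarrow> sat M (e(0 := a, 1 := b)) (params As Rs) p"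
  shows "irel S"
proof -
  obtain R where R: "R \<in> rels M 1"
    "\<forall>as. length as = 2 \<longrightarrow> set as \<subseteq> dom M \<longrightarrow> (as \<in> R \<longleftrightarrow> sat M (upds e [0, 1] as) (params As Rs) p)"
    using comprehension_holds[OF assms(1) _ proper_params[OF assms(2-4)], of 0 "[1]"]
    by (auto simp: numeral_2_eq_2)
  obtain Q where Q: "irel Q" "R = pairs Q" using rels_1_cases R(1) by auto
  have "Q a b \<longleftrightarrow> S a b" if "a \<in> dom M" "b \<in> dom M" for a b
    using R(2)[rule_format, of "[a, b]"] that assms(6) Q by simp
  then have "S = Q" using assms(5) irel_dom[OF Q(1)] by (intro ext) blast
  then show ?thesis using Q by simp
qed

section \<open>Least elements and closure properties of internal sets and functions\<close>

lemma iset_least: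
  assumes "iset A" "A \<noteq> {}"
  shows "\<exists>a\<in>A. \<forall>b\<in>A. \<not> lt M b a"
proof -
  let ?p = "In 0 0"
  let ?q = "Imp (ExO 0 ?p) (ExO 0 (Conj ?p (AllO 1 (Imp (Less (Var 1) (Var 0)) (Neg (instO 0 (Var 1) ?p))))))"
  have "?p \<in> lang I" "(1::nat) \<noteq> 0" "OV 1 \<notin> fv ?p" by (auto simp: lang_def)
  then have "?q \<in> base_theory I"
    unfolding base_theory_def global_choice_def by blast
  moreover have "proper_env M (\<lambda>_. obj) (params [A] [])"
    using assms by (intro proper_params) auto
  ultimately have "sat M (\<lambda>_. obj) (params [A] []) ?q"
    using base unfolding valid_in_def by blast
  then show ?thesis using assms iset_subset[OF assms(1)] by (auto simp: sat_instO)
qed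

lemma linear_order:
  shows lt_irrefl: "a \<in> dom M \<Longrightarrow> \<not> lt M a a"
    and lt_trans: "a \<in> dom M \<Longrightarrow> b \<in> dom M \<Longrightarrow> c \<in> dom M \<Longrightarrow> lt M a b \<Longrightarrow> lt M b c \<Longrightarrow> lt M a c"
    and lt_total: "a \<in> dom M \<Longrightarrow> b \<in> dom M \<Longrightarrow> lt M a b \<or> a = b \<or> lt M b a"
proof -
  have *: "sat M (\<lambda>_. obj) (params [] []) q" if "q \<in> linear_order_axioms" for q
  proof -
    have "q \<in> base_theory I" using that by (simp add: base_theory_def global_choice_def)
    moreover have "proper_env M (\<lambda>_. obj) (params [] [])" by (intro proper_params) auto
    ultimately show ?thesis using base unfolding valid_in_def by blast
  qed
  let ?sat = "sat M (\<lambda>_. obj) (params [] [])"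
  let ?irrefl = "AllO 0 (Neg (Less (Var 0) (Var 0)))"
    and ?trans = "AllOs [0, 1, 2] (Imp (Conj (Less (Var 0) (Var 1)) (Less (Var 1) (Var 2))) (Less (Var 0) (Var 2)))"
    and ?total = "AllOs [0, 1] (Disj (Less (Var 0) (Var 1)) (Disj (Eq (Var 0) (Var 1)) (Less (Var 1) (Var 0))))"
  have "?sat ?irrefl \<longleftrightarrow> (\<forall>a\<in>dom M. \<not> lt M a a)"
    "?sat ?trans \<longleftrightarrow> (\<forall>a\<in>dom M. \<forall>b\<in>dom M. \<forall>c\<in>dom M. \<not> (lt M a b \<longrightarrow> \<not> lt M b c) \<longrightarrow> lt M a c)"
    "?sat ?total \<longleftrightarrow> (\<forall>a\<in>dom M. \<forall>b\<in>dom M. \<not> lt M a b \<longrightarrow> a \<noteq> b \<longrightarrow> lt M b a)"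
    by simp_all
  moreover have "?sat ?irrefl" "?sat ?trans" "?sat ?total"
    by (rule *, unfold linear_order_axioms_def, blast)+
  ultimately have "\<forall>a\<in>dom M. \<not> lt M a a"
    "\<forall>a\<in>dom M. \<forall>b\<in>dom M. \<forall>c\<in>dom M. \<not> (lt M a b \<longrightarrow> \<not> lt M b c) \<longrightarrow> lt M a c"
    "\<forall>a\<in>dom M. \<forall>b\<in>dom M. \<not> lt M a b \<longrightarrow> a \<noteq> b \<longrightarrow> lt M b a"
    by blast+
  then show "a \<in> dom M \<Longrightarrow> \<not> lt M a a"
    and "a \<in> dom M \<Longrightarrow> b \<in> dom M \<Longrightarrow> c \<in> dom M \<Longrightarrow> lt M a b \<Longrightarrow> lt M b c \<Longrightarrow> lt M a c"
    and "a \<in> dom M \<Longrightarrow> b \<in> dom M \<Longrightarrow> lt M a b \<or> a = b \<or> lt M b a"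
    by blast+
qed

lemma iset_dom: "iset (dom M)"
  by (rule isetI[of "Eq (Var 0) (Var 0)" "[]" "[]" "\<lambda>_. obj"]) (auto simp: lang_def)

lemma iset_Diff: "iset A \<Longrightarrow> iset B \<Longrightarrow> iset (A - B)"
  by (rule isetI[of "Conj (In 0 0) (Neg (In 0 1))" "[A, B]" "[]" "\<lambda>_. obj"])
    (auto simp: lang_def dest: iset_subset)

lemma iset_remove: "iset A \<Longrightarrow> a \<in> dom M \<Longrightarrow> iset (A - {a})"
  by (rule isetI[of "Conj (In 0 0) (Neg (Eq (Var 0) (Var 1)))" "[A]" "[]" "\<lambda>_. a"])
    (auto simp: lang_def dest: iset_subset)

lemma iset_rng: "i \<in> I \<Longrightarrow> iset (rng M i)"
  using henkin
  by (intro isetI[of "ExR 0 0 (Eq (Ab i 0) (Var 0))" "[]" "[]" "\<lambda>_. obj"])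
    (auto simp: lang_def rng_def henkin_structure_def)

text \<open>Only the graph over \<open>A\<close> has to be internal; outside of \<open>A\<close> the
  values of \<open>f\<close> are arbitrary.\<close>

definition ifun :: "'a set \<Rightarrow> ('a \<Rightarrow> 'a) \<Rightarrow> bool" where
  "ifun A f \<longleftrightarrow> irel (\<lambda>a b. a \<in> A \<and> b = f a)"

lemma ifun_range: "ifun A f \<Longrightarrow> a \<in> A \<Longrightarrow> a \<in> dom M \<and> f a \<in> dom M"
  unfolding ifun_def by (drule irel_dom) auto

lemma irel_functional:
  assumes "irel R" "\<And>a. a \<in> A \<Longrightarrow> \<exists>b. R a b" "\<And>a b. R a b \<Longrightarrow> a \<in> A" "\<And>a b b'. R a b \<Longrightarrow> R a b' \<Longrightarrow> b = b'"
  shows "\<exists>f. ifun A f \<and> R = (\<lambda>a b. a \<in> A \<and> b = f a)"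
proof -
  define f where "f a = (SOME b. R a b)" for a
  have f: "R a (f a)" if "a \<in> A" for a unfolding f_def using assms(2)[OF that] by (rule someI_ex)
  have "R = (\<lambda>a b. a \<in> A \<and> b = f a)" using f assms(3,4) by (intro ext) blast
  with assms(1) show ?thesis unfolding ifun_def by blast
qed

lemma ifun_id: "iset A \<Longrightarrow> ifun A (\<lambda>a. a)"
  unfolding ifun_def
  by (rule irelI[of "Conj (In 0 0) (Eq (Var 0) (Var 1))" "[A]" "[]" "\<lambda>_. obj"])
    (auto simp: lang_def dest: iset_subset)

lemma ifun_subset: "ifun A f \<Longrightarrow> iset B \<Longrightarrow> B \<subseteq> A \<Longrightarrow> ifun B f"
  unfolding ifun_def
  by (rule irelI[of "Conj (In 0 0) (Maps 0 0 1)" "[B]" "[\<lambda>a b. a \<in> A \<and> b = f a]" "\<lambda>_. obj"])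
    (auto simp: lang_def ifun_range simp flip: ifun_def)

lemma iset_image: "ifun A f \<Longrightarrow> iset B \<Longrightarrow> B \<subseteq> A \<Longrightarrow> iset (f ` B)"
  by (rule isetI[of "ExO 1 (Conj (In 1 0) (Maps 0 1 0))" "[B]" "[\<lambda>a b. a \<in> A \<and> b = f a]" "\<lambda>_. obj"])
    (auto simp: lang_def ifun_range dest: iset_subset simp flip: ifun_def)

lemma ifun_inv: "ifun A f \<Longrightarrow> inj_on f A \<Longrightarrow> ifun (f ` A) (the_inv_into A f)"
  unfolding ifun_def[of "f ` A"]
  by (rule irelI[of "Maps 0 1 0" "[]" "[\<lambda>a b. a \<in> A \<and> b = f a]" "\<lambda>_. obj"])
    (auto simp: lang_def ifun_range the_inv_into_f_f simp flip: ifun_def)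

lemma ifun_join:
  assumes "ifun A f" "ifun B g" "A \<inter> B = {}"
  shows "ifun (A \<union> B) (\<lambda>a. if a \<in> A then f a else g a)"
  unfolding ifun_def[of "A \<union> B"]
  by (rule irelI[of "Disj (Maps 0 0 1) (Maps 1 0 1)" "[]"
        "[\<lambda>a b. a \<in> A \<and> b = f a, \<lambda>a b. a \<in> B \<and> b = g a]" "\<lambda>_. obj"])
    (use assms in \<open>auto simp: lang_def ifun_range simp flip: ifun_def\<close>)

end

lemma inj_on_join:
  assumes "inj_on f A" "inj_on g B" "f ` A \<inter> g ` B = {}"
  shows "inj_on (\<lambda>a. if a \<in> A then f a else g a) (A \<union> B)"
proof (rule inj_onI)
  fix x y assume "x \<in> A \<union> B" "y \<in> A \<union> B" "(if x \<in> A then f x else g x) = (if y \<in> A then f y else g y)"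
  then show "x = y" using assms by (cases "x \<in> A"; cases "y \<in> A") (auto dest: inj_onD)
qed


section \<open>Comparability and Cantor-Bernstein inside a model\<close>

context base_model
begin

text \<open>The comparison is the least relation \<open>Q\<close> between \<open>A\<close> and \<open>B\<close> that contains \<open>(a, b)\<close>
  as soon as it relates the predecessors of \<open>a\<close> and of \<open>b\<close> to each other. Being impredicatively
  definable, it needs no recursion along the order.\<close>

definition matched :: "'a set \<Rightarrow> 'a set \<Rightarrow> ('a \<Rightarrow> 'a \<Rightarrow> bool) \<Rightarrow> 'a \<Rightarrow> 'a \<Rightarrow> bool" where
  "matched A B Q a b \<longleftrightarrow>
     (\<forall>a'\<in>A. lt M a' a \<longrightarrow> (\<exists>b'\<in>B. lt M b' b \<and> Q a' b')) \<and>
     (\<forall>b'\<in>B. lt M b' b \<longrightarrow> (\<exists>a'\<in>A. lt M a' a \<and> Q a' b'))"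

definition comparison :: "'a set \<Rightarrow> 'a set \<Rightarrow> 'a \<Rightarrow> 'a \<Rightarrow> bool" where
  "comparison A B a b \<longleftrightarrow> a \<in> A \<and> b \<in> B \<and>
     (\<forall>Q. irel Q \<longrightarrow> (\<forall>a\<in>A. \<forall>b\<in>B. matched A B Q a b \<longrightarrow> Q a b) \<longrightarrow> Q a b)"

lemma matched_mono: "matched A B Q a b \<Longrightarrow> (\<And>a b. Q a b \<Longrightarrow> Q' a b) \<Longrightarrow> matched A B Q' a b"
  unfolding matched_def by blast

text \<open>\<open>A\<close> and \<open>B\<close> sit in the concept variables 0 and 1, and
  \<open>Q\<close> in the binary variable \<open>k\<close>. The variables 4 and 5 are bound, so
  \<open>x\<close> and \<open>y\<close> must avoid them.\<close>

definition Matched_fm :: "nat \<Rightarrow> nat \<Rightarrow> nat \<Rightarrow> fm" where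
  "Matched_fm k x y = Conj
     (AllO 4 (Imp (In 4 0) (Imp (Less (Var 4) (Var x)) (ExO 5 (Conj (In 5 1) (Conj (Less (Var 5) (Var y)) (Maps k 4 5)))))))
     (AllO 5 (Imp (In 5 1) (Imp (Less (Var 5) (Var y)) (ExO 4 (Conj (In 4 0) (Conj (Less (Var 4) (Var x)) (Maps k 4 5)))))))"

lemma syms_Matched_fm: "syms (Matched_fm k x y) = {LessSym}"
  by (auto simp: Matched_fm_def)

lemma sat_Matched_fm:
  assumes "iset A" "iset B" "r 0 0 = singles A" "r 0 1 = singles B" "r 1 k = pairs Q" "{x, y} \<inter> {4, 5} = {}"
  shows "sat M e r (Matched_fm k x y) \<longleftrightarrow> matched A B Q (e x) (e y)"
proof -
  have "sat M e r (Matched_fm k x y) \<longleftrightarrow>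
     (\<forall>a'\<in>dom M. a' \<in> A \<longrightarrow> lt M a' (e x) \<longrightarrow> (\<exists>b'\<in>dom M. b' \<in> B \<and> lt M b' (e y) \<and> Q a' b')) \<and>
     (\<forall>b'\<in>dom M. b' \<in> B \<longrightarrow> lt M b' (e y) \<longrightarrow> (\<exists>a'\<in>dom M. a' \<in> A \<and> lt M a' (e x) \<and> Q a' b'))"
    using assms(3-6) by (simp add: Matched_fm_def) blast
  then show ?thesis
    using iset_subset[OF assms(1)] iset_subset[OF assms(2)] unfolding matched_def by blast
qed

lemma irel_comparison:
  assumes A: "iset A" and B: "iset B"
  shows "irel (comparison A B)"
proof -
  let ?p = "Conj (In 0 0) (Conj (In 1 1) (AllR 1 0 (Imp
    (AllO 2 (Imp (In 2 0) (AllO 3 (Imp (In 3 1) (Imp (Matched_fm 0 2 3) (Maps 0 2 3)))))) (Maps 0 0 1))))"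
  show ?thesis
  proof (rule irelI[of ?p "[A, B]" "[]" "\<lambda>_. obj"])
  fix a b assume ab: "a \<in> dom M" "b \<in> dom M"
  show "comparison A B a b \<longleftrightarrow> sat M ((\<lambda>_. obj)(0 := a, 1 := b)) (params [A, B] []) (?p)"
    using ab iset_subset[OF A] iset_subset[OF B]
    by (simp add: ball_rels_1 sat_Matched_fm[OF assms] comparison_def) blast
qed (use assms in \<open>auto simp: comparison_def lang_def syms_Matched_fm dest: iset_subset\<close>)
qed

text \<open>A least relation is closed under its own rule because the rule is monotone in
  \<open>Q\<close>.\<close>

lemma comparison_intro:
  assumes "a \<in> A" "b \<in> B" "matched A B (comparison A B) a b"
  shows "comparison A B a b"
  unfolding comparison_def
proof (intro conjI allI impI assms)
  fix Q assume Q: "irel Q" "\<forall>a\<in>A. \<forall>b\<in>B. matched A B Q a b \<longrightarrow> Q a b"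
  have "matched A B Q a b"
    by (rule matched_mono[OF assms(3)]) (use Q in \<open>auto simp: comparison_def\<close>)
  then show "Q a b" using Q assms by blast
qed

text \<open>Inversion for the least relation: the pairs that are already matched form an internal
  relation closed under the rule, so by minimality there are no others.\<close>

lemma comparison_matched:
  assumes A: "iset A" and B: "iset B" and ab: "comparison A B a b"
  shows "matched A B (comparison A B) a b"
proof -
  let ?C = "comparison A B"
  let ?Q = "\<lambda>a b. ?C a b \<and> matched A B ?C a b"
  have CD: "?C a b \<Longrightarrow> a \<in> A \<and> b \<in> B \<and> a \<in> dom M \<and> b \<in> dom M" for a b
    using iset_subset[OF A] iset_subset[OF B] unfolding comparison_def by blast
  have "irel ?Q"
  proof (rule irelI[of "Conj (Maps 0 0 1) (Matched_fm 0 0 1)" "[A, B]" "[?C]" "\<lambda>_. obj"])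
    fix a b assume ab: "a \<in> dom M" "b \<in> dom M"
    show "?C a b \<and> matched A B ?C a b \<longleftrightarrow>
        sat M ((\<lambda>_. obj)(0 := a, 1 := b)) (params [A, B] [?C]) (Conj (Maps 0 0 1) (Matched_fm 0 0 1))"
      by (simp add: sat_Matched_fm[OF A B])
  qed (use A B irel_comparison[OF A B] CD in \<open>auto simp: lang_def syms_Matched_fm\<close>)
  moreover have "?Q a b" if "a \<in> A" "b \<in> B" "matched A B ?Q a b" for a b
  proof -
    have "matched A B ?C a b" by (rule matched_mono[OF that(3)]) simp
    then show ?thesis using comparison_intro that by blast
  qed
  ultimately have "?Q a b" using ab unfolding comparison_def[of A B a b] by blast
  then show ?thesis ..
qed

text \<open>The rule is symmetric in the two sides, and the converse of an internal relation is
  internal.\<close>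

lemma comparison_sym: "comparison B A b a \<longleftrightarrow> comparison A B a b" if "iset A" "iset B"
proof -
  have *: "comparison A B a b" if "comparison B A b a" "iset A" "iset B" for A B a b
  proof -
    have "irel (\<lambda>b a. comparison A B a b)"
      by (rule irelI[of "Maps 0 1 0" "[]" "[comparison A B]" "\<lambda>_. obj"])
        (use irel_comparison[OF that(2,3)] irel_dom in \<open>auto simp: lang_def\<close>)
    moreover have "comparison A B a b" if "b \<in> B" "a \<in> A" "matched B A (\<lambda>b a. comparison A B a b) b a" for a b
      using that by (intro comparison_intro) (auto simp: matched_def)
    ultimately show ?thesis using that(1) unfolding comparison_def[of B A] by blast
  qed
  show ?thesis using *[of A B] *[of B A] that by blast
qed

text \<open>Let \<open>x\<close> be least with two partners \<open>y < y'\<close>. Matching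
  \<open>x\<close> with \<open>y'\<close> gives some \<open>x' < x\<close> with partner
  \<open>y\<close>, and matching \<open>x\<close> with \<open>y\<close> gives \<open>x'\<close> a
  partner below \<open>y\<close>. So \<open>x'\<close> has two partners as well.\<close>

lemma comparison_functional:
  assumes A: "iset A" and B: "iset B" and ab: "comparison A B a b" "comparison A B a b'"
  shows "b = b'"
proof (rule ccontr)
  let ?C = "comparison A B"
  assume "b \<noteq> b'"
  let ?S = "{a. \<exists>b b'. ?C a b \<and> ?C a b' \<and> b \<noteq> b'}"
  have CD: "?C a b \<Longrightarrow> a \<in> A \<and> b \<in> B \<and> a \<in> dom M \<and> b \<in> dom M" for a b
    using iset_subset[OF A] iset_subset[OF B] unfolding comparison_def by blast
  have "iset ?S"
    by (rule isetI[of "ExO 1 (ExO 2 (Conj (Maps 0 0 1) (Conj (Maps 0 0 2) (Neg (Eq (Var 1) (Var 2))))))"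
          "[]" "[?C]" "\<lambda>_. obj"])
      (use irel_comparison[OF A B] CD in \<open>auto simp: lang_def\<close>)
  moreover have "?S \<noteq> {}" using ab \<open>b \<noteq> b'\<close> by blast
  ultimately obtain x where x: "x \<in> ?S" "\<forall>y\<in>?S. \<not> lt M y x" using iset_least by blast
  then obtain y y' where y: "?C x y" "?C x y'" "y \<noteq> y'" by blast
  have False if y: "?C x y" "?C x y'" "lt M y y'" for y y'
  proof -
    obtain x' where x': "lt M x' x" "?C x' y" "x' \<in> A"
      using comparison_matched[OF A B y(2)] y CD unfolding matched_def by blast
    then obtain y'' where y'': "lt M y'' y" "?C x' y''"
      using comparison_matched[OF A B y(1)] unfolding matched_def by blast
    then have "y'' \<noteq> y" using lt_irrefl CD y(1) by blast
    then have "x' \<in> ?S" using x' y'' by blast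
    then show False using x(2) x'(1) by blast
  qed
  then show False using y lt_total[of y y'] CD by blast
qed

text \<open>If both sides had elements without partner, take the least ones \<open>a\<close> and
  \<open>b\<close>. Every predecessor of \<open>a\<close> has a partner, which cannot be
  \<open>b\<close> and cannot lie above \<open>b\<close>, since then \<open>b\<close> would have a
  partner too. The same holds with the sides exchanged, so \<open>a\<close> and \<open>b\<close> are
  matched after all.\<close>

lemma comparability:
  assumes A: "iset A" and B: "iset B"
  shows "(\<exists>f. ifun A f \<and> inj_on f A \<and> f ` A \<subseteq> B) \<or> (\<exists>f. ifun B f \<and> inj_on f B \<and> f ` B \<subseteq> A)"
proof -
  let ?C = "comparison A B"
  have CD: "?C a b \<Longrightarrow> a \<in> A \<and> b \<in> B \<and> a \<in> dom M \<and> b \<in> dom M" for a b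
    using iset_subset[OF A] iset_subset[OF B] unfolding comparison_def by blast
  have fun1: "?C a b \<Longrightarrow> ?C a b' \<Longrightarrow> b = b'" for a b b'
    using comparison_functional[OF A B] .
  have fun2: "?C a b \<Longrightarrow> ?C a' b \<Longrightarrow> a = a'" for a a' b
    using comparison_functional[OF B A] comparison_sym[OF A B] by blast
  have total: "(\<forall>a\<in>A. \<exists>b. ?C a b) \<or> (\<forall>b\<in>B. \<exists>a. ?C a b)"
  proof (rule ccontr)
    assume "\<not> ?thesis"
    moreover have "iset {a \<in> A. \<nexists>b. ?C a b}"
      by (rule isetI[of "Conj (In 0 0) (Neg (ExO 1 (Maps 0 0 1)))" "[A]" "[?C]" "\<lambda>_. obj"])
        (use irel_comparison[OF A B] A CD in \<open>auto simp: lang_def dest: iset_subset\<close>)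
    moreover have "iset {b \<in> B. \<nexists>a. ?C a b}"
      by (rule isetI[of "Conj (In 0 0) (Neg (ExO 1 (Maps 0 1 0)))" "[B]" "[?C]" "\<lambda>_. obj"])
        (use irel_comparison[OF A B] B CD in \<open>auto simp: lang_def dest: iset_subset\<close>)
    ultimately obtain a b where a: "a \<in> {a \<in> A. \<nexists>b. ?C a b}" "\<forall>a'\<in>{a \<in> A. \<nexists>b. ?C a b}. \<not> lt M a' a"
      and b: "b \<in> {b \<in> B. \<nexists>a. ?C a b}" "\<forall>b'\<in>{b \<in> B. \<nexists>a. ?C a b}. \<not> lt M b' b"
      using iset_least[of "{a \<in> A. \<nexists>b. ?C a b}"] iset_least[of "{b \<in> B. \<nexists>a. ?C a b}"] by blast
    have "matched A B ?C a b" unfolding matched_def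
    proof (intro conjI ballI impI)
      fix a' assume a': "a' \<in> A" "lt M a' a"
      then obtain b' where b': "?C a' b'" using a(2) by blast
      have "\<not> lt M b b'"
      proof
        assume "lt M b b'"
        then show False using comparison_matched[OF A B b'] b(1) unfolding matched_def by blast
      qed
      moreover have "b' \<noteq> b" using b' b(1) by blast
      ultimately have "lt M b' b" using lt_total[of b b'] b(1) iset_subset[OF B] CD[OF b'] by blast
      then show "\<exists>b'\<in>B. lt M b' b \<and> ?C a' b'" using b' CD by blast
    next
      fix b' assume b'': "b' \<in> B" "lt M b' b"
      then obtain a' where a': "?C a' b'" using b(2) by blast
      have "\<not> lt M a a'"
      proof
        assume "lt M a a'"
        then show False using comparison_matched[OF A B a'] a(1) unfolding matched_def by blast
      qed
      moreover have "a' \<noteq> a" using a' a(1) by blast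
      ultimately have "lt M a' a" using lt_total[of a a'] a(1) iset_subset[OF A] CD[OF a'] by blast
      then show "\<exists>a'\<in>A. lt M a' a \<and> ?C a' b'" using a' CD by blast
    qed
    then show False using comparison_intro a(1) b(1) by blast
  qed
  have *: "\<exists>f. ifun A f \<and> inj_on f A \<and> f ` A \<subseteq> B"
    if R: "irel R" "\<forall>a\<in>A. \<exists>b. R a b" "\<And>a b. R a b \<Longrightarrow> a \<in> A \<and> b \<in> B"
      "\<And>a b b'. R a b \<Longrightarrow> R a b' \<Longrightarrow> b = b'" "\<And>a a' b. R a b \<Longrightarrow> R a' b \<Longrightarrow> a = a'" for R A B
  proof -
    obtain f where f: "ifun A f" "R = (\<lambda>a b. a \<in> A \<and> b = f a)"
      using irel_functional[OF R(1), of A] R(2-4) by blast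
    have "inj_on f A"
    proof (rule inj_onI)
      fix a b assume "a \<in> A" "b \<in> A" "f a = f b"
      then show "a = b" using R(5)[of a "f a" b] unfolding f(2) by simp
    qed
    moreover have "f ` A \<subseteq> B"
    proof
      fix b assume "b \<in> f ` A"
      then obtain a where "R a b" unfolding f(2) by blast
      then show "b \<in> B" using R(3) by blast
    qed
    ultimately show ?thesis using f(1) by blast
  qed
  from total show ?thesis
  proof
    assume tot: "\<forall>a\<in>A. \<exists>b. ?C a b"
    have "\<exists>f. ifun A f \<and> inj_on f A \<and> f ` A \<subseteq> B"
      by (rule *[OF irel_comparison[OF A B] tot]) (use CD fun1 fun2 in blast)+
    then show ?thesis ..
  next
    assume tot: "\<forall>b\<in>B. \<exists>a. ?C a b"
    have "comparison B A = (\<lambda>b a. ?C a b)"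
      using comparison_sym[OF A B] by (intro ext) blast
    then have "irel (\<lambda>b a. ?C a b)" using irel_comparison[OF B A] by simp
    then have "\<exists>f. ifun B f \<and> inj_on f B \<and> f ` B \<subseteq> A"
      by (rule *[OF _ tot]) (use CD fun1 fun2 in blast)+
    then show ?thesis ..
  qed
qed

text \<open>As \<open>R\<close> lies in \<open>V\<close>, one of the two injections is the
  inclusion. \<open>C\<close> is the least internal set that contains \<open>V - R\<close> and is
  closed under \<open>g\<close>; shifting \<open>C\<close> by \<open>g\<close> and fixing the rest
  maps \<open>V\<close> bijectively onto \<open>R\<close>, and \<open>q\<close> is the inverse.
  \<open>C\<close> is an intersection of internal sets because a union of iterates of
  \<open>g\<close> formed in the metatheory need not be internal.\<close>

lemma cantor_bernstein:
  assumes g: "ifun (dom M) g" "inj_on g (dom M)" "g ` dom M \<subseteq> R" and R: "iset R"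
  shows "\<exists>q. ifun R q \<and> inj_on q R \<and> q ` R = dom M"
proof -
  define closed where "closed Z \<longleftrightarrow> dom M - R \<subseteq> Z \<and> (\<forall>x\<in>Z. g x \<in> Z)" for Z
  define C where "C = {x \<in> dom M. \<forall>Z. iset Z \<longrightarrow> closed Z \<longrightarrow> x \<in> Z}"
  have Rd: "R \<subseteq> dom M" using R by (rule iset_subset)
  let ?p = "AllR 0 1 (Imp (Conj (AllO 1 (Imp (Neg (In 1 0)) (In 1 1)))
      (AllO 1 (AllO 2 (Imp (In 1 1) (Imp (Maps 0 1 2) (In 2 1)))))) (In 0 1))"
  have C: "iset C"
  proof (rule isetI[of ?p "[R]" "[\<lambda>a b. a \<in> dom M \<and> b = g a]" "\<lambda>_. obj"])
    fix a assume a: "a \<in> dom M"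
    have cl: "closed Z \<longleftrightarrow> (\<forall>x\<in>dom M. x \<notin> R \<longrightarrow> x \<in> Z) \<and>
      (\<forall>x\<in>dom M. \<forall>y\<in>dom M. x \<in> Z \<longrightarrow> x \<in> dom M \<and> y = g x \<longrightarrow> y \<in> Z)" if "iset Z" for Z
      using iset_subset[OF that] ifun_range[OF g(1)] unfolding closed_def by blast
    have "sat M ((\<lambda>_. obj)(0 := a)) (params [R] [\<lambda>a b. a \<in> dom M \<and> b = g a]) ?p \<longleftrightarrow>
      (\<forall>Z. iset Z \<longrightarrow> closed Z \<longrightarrow> a \<in> Z)"
      using cl by (simp add: ball_rels_0) blast
    then show "a \<in> C \<longleftrightarrow> sat M ((\<lambda>_. obj)(0 := a)) (params [R] [\<lambda>a b. a \<in> dom M \<and> b = g a]) ?p"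
      using a by (simp only: C_def mem_Collect_eq simp_thms)
  qed (use R g(1) in \<open>auto simp: lang_def C_def ifun_def\<close>)
  have Cd: "C \<subseteq> dom M" by (auto simp: C_def)
  have Cc: "closed C"
    unfolding closed_def
  proof (intro conjI subsetI ballI)
    fix x assume "x \<in> dom M - R"
    then show "x \<in> C" by (auto simp: C_def closed_def)
  next
    fix x assume "x \<in> C"
    then show "g x \<in> C" using ifun_range[OF g(1)] by (auto simp: C_def closed_def)
  qed
  \<comment> \<open>Removing from \<open>C\<close> a point of \<open>R\<close> that is not a value
    of \<open>g\<close> on \<open>C\<close> would leave a smaller closed set.\<close>
  have surj: "\<exists>x\<in>C. g x = y" if y: "y \<in> C" "y \<in> R" for y
  proof (rule ccontr)
    assume "\<not> ?thesis"
    then have "closed (C - {y})" using Cc y by (auto simp: closed_def)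
    moreover have "iset (C - {y})" using C Cd y by (intro iset_remove) auto
    ultimately show False using y by (auto simp: C_def)
  qed
  let ?h = "\<lambda>x. if x \<in> C then g x else x"
  have un: "C \<union> (dom M - C) = dom M" using Cd by blast
  have h: "ifun (dom M) ?h"
    using ifun_join[OF ifun_subset[OF g(1) C Cd] ifun_id[OF iset_Diff[OF iset_dom C]]] un by auto
  have "inj_on ?h (C \<union> (dom M - C))"
    using inj_on_subset[OF g(2) Cd] Cc
    by (intro inj_on_join) (auto simp: closed_def)
  then have inj: "inj_on ?h (dom M)" by (simp only: un)
  have "?h ` dom M = R"
  proof
    show "?h ` dom M \<subseteq> R" using g(3) Cc by (auto simp: closed_def)
    show "R \<subseteq> ?h ` dom M"
    proof
      fix y assume y: "y \<in> R"
      show "y \<in> ?h ` dom M"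
      proof (cases "y \<in> C")
        case True
        then obtain x where "x \<in> C" "g x = y" using surj y by blast
        then show ?thesis using Cd by (intro image_eqI[of _ _ x]) auto
      next
        case False
        then show ?thesis using y Rd by (intro image_eqI[of _ _ y]) auto
      qed
    qed
  qed
  then have "ifun R (the_inv_into (dom M) ?h)" using ifun_inv[OF h inj] by simp
  moreover have "bij_betw (the_inv_into (dom M) ?h) R (dom M)"
    using inj \<open>?h ` dom M = R\<close> by (intro bij_betw_the_inv_into) (simp add: bij_betw_def)
  ultimately show ?thesis unfolding bij_betw_def by blast
qed

end


section \<open>Changing the abstraction operators of a model\<close>

text \<open>Guarded existential quantifiers that introduce a name for each argument before the
  statement \<open>q\<close> about all of them is made.\<close>

definition binds :: "(nat \<times> fm) list \<Rightarrow> fm \<Rightarrow> fm" where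
  "binds ws q = foldr (\<lambda>(z, g) q. ExO z (Conj g q)) ws q"

lemma binds_simps [simp]:
  "binds [] q = q" "binds ((z, g) # ws) q = ExO z (Conj g (binds ws q))"
  by (simp_all add: binds_def)

lemma syms_binds: "syms (binds ws q) \<subseteq> syms q \<union> (\<Union>w\<in>set ws. syms (snd w))"
  by (induction ws) auto

text \<open>Each guard is required to be insensitive to the other variables in \<open>Z\<close>; the
  choices of the witnesses are then independent of each other and can be collected into one
  list.\<close>

lemma sat_binds:
  assumes "list_all2 (\<lambda>(z, g) G. z \<in> Z \<and>
      (\<forall>e a. (\<forall>x. x \<notin> Z \<longrightarrow> e x = e0 x) \<longrightarrow> a \<in> dom M \<longrightarrow> (sat M (e(z := a)) r g \<longleftrightarrow> G a))) ws Gs"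
    and "\<forall>x. x \<notin> Z \<longrightarrow> e x = e0 x"
  shows "sat M e r (binds ws q) \<longleftrightarrow>
    (\<exists>as. list_all2 (\<lambda>G a. a \<in> dom M \<and> G a) Gs as \<and> sat M (upds e (map fst ws) as) r q)"
  using assms
proof (induction ws Gs arbitrary: e rule: list_all2_induct)
  case (Cons w ws G Gs)
  obtain z g where w: "w = (z, g)" by (cases w)
  have z: "z \<in> Z" "\<And>a. a \<in> dom M \<Longrightarrow> sat M (e(z := a)) r g \<longleftrightarrow> G a"
    using Cons.hyps(1) Cons.prems unfolding w by auto
  have "sat M e r (binds (w # ws) q) \<longleftrightarrow>
      (\<exists>a\<in>dom M. sat M (e(z := a)) r g \<and> sat M (e(z := a)) r (binds ws q))"
    by (simp add: w)
  also have "\<dots> \<longleftrightarrow> (\<exists>a\<in>dom M. G a \<and>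
      (\<exists>as. list_all2 (\<lambda>G a. a \<in> dom M \<and> G a) Gs as \<and> sat M (upds (e(z := a)) (map fst ws) as) r q))"
  proof (intro bex_cong refl conj_cong)
    fix a assume a: "a \<in> dom M"
    show "sat M (e(z := a)) r g \<longleftrightarrow> G a" using z a by blast
    show "sat M (e(z := a)) r (binds ws q) \<longleftrightarrow>
      (\<exists>as. list_all2 (\<lambda>G a. a \<in> dom M \<and> G a) Gs as \<and> sat M (upds (e(z := a)) (map fst ws) as) r q)"
      by (rule Cons.IH) (use Cons.prems z in auto)
  qed
  also have "\<dots> \<longleftrightarrow> (\<exists>as. list_all2 (\<lambda>G a. a \<in> dom M \<and> G a) (G # Gs) as \<and>
      sat M (upds e (map fst (w # ws)) as) r q)" (is "?L \<longleftrightarrow> ?R")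
  proof
    assume ?L
    then obtain a as where "a \<in> dom M" "G a" "list_all2 (\<lambda>G a. a \<in> dom M \<and> G a) Gs as"
      "sat M (upds (e(z := a)) (map fst ws) as) r q" by blast
    then show ?R by (intro exI[of _ "a # as"]) (simp add: w)
  next
    assume ?R
    then obtain as where as: "list_all2 (\<lambda>G a. a \<in> dom M \<and> G a) (G # Gs) as"
      "sat M (upds e (map fst (w # ws)) as) r q" by blast
    then obtain a as' where "as = a # as'" by (auto simp: list_all2_Cons1)
    with as show ?L by (intro bexI[of _ a] conjI exI[of _ as']) (auto simp: w)
  qed
  finally show ?case .
qed simp

context base_model
begin

text \<open>The image consists of the tuples that are componentwise related by the graph of
  \<open>f\<close> to some tuple in \<open>R\<close>. Since the arity varies, the defining formula
  is built with \<open>binds\<close>.\<close>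

lemma rels_image:
  assumes f: "ifun A f" and R: "R \<in> rels M n" "\<And>as. as \<in> R \<Longrightarrow> set as \<subseteq> A"
  shows "map f ` R \<in> rels M n"
proof -
  \<comment> \<open>The variables \<open>0 # ys\<close> stand for the image tuple and
    \<open>zs\<close> for its preimage, \<open>Suc n\<close> of each kind.\<close>
  define ys where "ys = [1..<Suc n]"
  define zs where "zs = [Suc n..<2 * Suc n]"
  define ws where "ws = map2 (\<lambda>z y. (z, Maps 0 z y)) zs (0 # ys)"
  \<comment> \<open>The graph of \<open>f\<close> occupies \<open>RV 1 0\<close>, so a binary
    \<open>R\<close> has to move to index 1.\<close>
  define k where "k = (if n = 1 then 1 else 0 :: nat)"
  define r where "r = (params [] [\<lambda>a b. a \<in> A \<and> b = f a])(n := ((params [] [\<lambda>a b. a \<in> A \<and> b = f a]) n)(k := R))"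
  let ?q = "Pred k (Var (hd zs)) (map Var (tl zs))"
  have len: "length ys = n" "length zs = Suc n" by (auto simp: ys_def zs_def)
  have dist: "distinct (0 # ys)" "distinct zs" "set zs \<inter> set (0 # ys) = {}"
    by (auto simp: ys_def zs_def)
  have fstws: "map fst ws = zs" using len by (simp add: ws_def comp_def case_prod_unfold)
  have r: "r 1 0 = pairs (\<lambda>a b. a \<in> A \<and> b = f a)" "r n k = R"
    by (auto simp: r_def k_def params_def)
  have "proper_env M (\<lambda>_. obj) (params [] [\<lambda>a b. a \<in> A \<and> b = f a])"
    using f by (intro proper_params) (auto simp: ifun_def)
  then have env: "proper_env M (\<lambda>_. obj) r"
    unfolding r_def by (rule proper_env_updR[OF _ R(1)])
  have "syms (binds ws ?q) \<subseteq> {}"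
    by (rule order_trans[OF syms_binds]) (auto simp: ws_def)
  then have "binds ws ?q \<in> lang I" by (simp add: lang_def)
  then obtain S where S: "S \<in> rels M n" "\<And>bs. length bs = Suc n \<Longrightarrow> set bs \<subseteq> dom M \<Longrightarrow>
      bs \<in> S \<longleftrightarrow> sat M (upds (\<lambda>_. obj) (0 # ys) bs) r (binds ws ?q)"
    using comprehension_holds[OF _ dist(1) env] len by metis
  have "bs \<in> S \<longleftrightarrow> bs \<in> map f ` R" if bs: "length bs = Suc n" "set bs \<subseteq> dom M" for bs
  proof -
    let ?e = "upds (\<lambda>_. obj) (0 # ys) bs"
    let ?Gs = "map (\<lambda>b a. a \<in> A \<and> b = f a) bs"
    have nth: "?e ((0 # ys) ! i) = bs ! i" if "i < Suc n" for i
    proof -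
      have "map ?e (0 # ys) ! i = bs ! i" using map_upds[OF dist(1), of bs "\<lambda>_. obj"] bs len by simp
      moreover have "map ?e (0 # ys) ! i = ?e ((0 # ys) ! i)" using that len by (intro nth_map) simp
      ultimately show ?thesis by simp
    qed
    have "sat M ?e r (binds ws ?q) \<longleftrightarrow> (\<exists>as. list_all2 (\<lambda>G a. a \<in> dom M \<and> G a) ?Gs as \<and>
        sat M (upds ?e (map fst ws) as) r ?q)"
    proof (rule sat_binds[where Z = "set zs" and ?e0.0 = ?e])
      show "list_all2 (\<lambda>(z, g) G. z \<in> set zs \<and> (\<forall>e a. (\<forall>x. x \<notin> set zs \<longrightarrow> e x = ?e x) \<longrightarrow>
          a \<in> dom M \<longrightarrow> (sat M (e(z := a)) r g \<longleftrightarrow> G a))) ws ?Gs"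
        unfolding list_all2_conv_all_nth
      proof (intro conjI allI impI)
        show "length ws = length ?Gs" using len bs by (simp add: ws_def)
        fix i assume "i < length ws"
        then have i: "i < Suc n" using len by (simp add: ws_def)
        then have w: "ws ! i = (zs ! i, Maps 0 (zs ! i) ((0 # ys) ! i))" "zs ! i \<in> set zs"
          "(0 # ys) ! i \<notin> set zs"
          using len dist(3) nth_mem[of i "0 # ys"] by (auto simp: ws_def)
        have "?Gs ! i = (\<lambda>a. a \<in> A \<and> bs ! i = f a)" using i bs by simp
        with w show "(case ws ! i of (z, g) \<Rightarrow> \<lambda>G. z \<in> set zs \<and> (\<forall>e a. (\<forall>x. x \<notin> set zs \<longrightarrow> e x = ?e x) \<longrightarrow>
          a \<in> dom M \<longrightarrow> (sat M (e(z := a)) r g \<longleftrightarrow> G a))) (?Gs ! i)"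
          using nth[OF i] r(1) by (auto simp del: upds.simps)
      qed
    qed simp
    also have "\<dots> \<longleftrightarrow> (\<exists>as. list_all2 (\<lambda>G a. a \<in> dom M \<and> G a) ?Gs as \<and> as \<in> R)"
    proof (intro ex_cong1 conj_cong refl)
      fix as assume "list_all2 (\<lambda>G a. a \<in> dom M \<and> G a) ?Gs as"
      then have as: "length as = length zs" using bs len by (auto dest: list_all2_lengthD)
      have zs: "hd zs # tl zs = zs" using len by (cases zs) auto
      have "map (val M (upds ?e zs as) r) (Var (hd zs) # map Var (tl zs)) = map (upds ?e zs as) (hd zs # tl zs)"
        by (simp add: comp_def del: upds.simps)
      also have "\<dots> = as" unfolding zs using dist(2) as by (rule map_upds)
      finally have "map (val M (upds ?e zs as) r) (Var (hd zs) # map Var (tl zs)) = as" .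
      then show "sat M (upds ?e (map fst ws) as) r ?q \<longleftrightarrow> as \<in> R"
        unfolding fstws sat.simps using len r(2) by simp
    qed
    also have "\<dots> \<longleftrightarrow> bs \<in> map f ` R"
    proof
      assume "\<exists>as. list_all2 (\<lambda>G a. a \<in> dom M \<and> G a) ?Gs as \<and> as \<in> R"
      then obtain as where as: "list_all2 (\<lambda>G a. a \<in> dom M \<and> G a) ?Gs as" "as \<in> R" by blast
      then have "bs = map f as" by (auto simp: list_all2_conv_all_nth intro!: nth_equalityI)
      then show "bs \<in> map f ` R" using as(2) by blast
    next
      assume "bs \<in> map f ` R"
      then obtain as where as: "as \<in> R" "bs = map f as" by blast
      have "set as \<subseteq> A" "set as \<subseteq> dom M" using R as(1) rels_subset by blast+
      then have "list_all2 (\<lambda>G a. a \<in> dom M \<and> G a) ?Gs as"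
        unfolding as(2) by (auto simp: list_all2_conv_all_nth)
      then show "\<exists>as. list_all2 (\<lambda>G a. a \<in> dom M \<and> G a) ?Gs as \<and> as \<in> R" using as by blast
    qed
    finally show ?thesis using S(2)[OF bs] by simp
  qed
  moreover have "S \<subseteq> {bs. set bs \<subseteq> dom M \<and> length bs = Suc n}" using rels_subset[OF S(1)] .
  moreover have "map f ` R \<subseteq> {bs. set bs \<subseteq> dom M \<and> length bs = Suc n}"
    using rels_subset[OF R(1)] R(2) ifun_range[OF f] by fastforce
  ultimately have "map f ` R = S" by blast
  then show ?thesis using S(1) by simp
qed

end

text \<open>\<open>reinterpret N s\<close> replaces \<open>\<partial>\<^sub>i(X)\<close> by the image of \<open>\<partial>\<^bsub>s i\<^esub>(X)\<close> under the function whose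
  graph is the parameter \<open>RV 1 (N + i)\<close>. Atoms without abstraction terms are left alone, so that
  the instances of the schemas are mapped to instances.\<close>

primrec ab_free :: "otm \<Rightarrow> bool" where
  "ab_free (Var x) = True"
| "ab_free (Ab i k) = False"

primrec ov_bound :: "otm \<Rightarrow> nat" where
  "ov_bound (Var x) = Suc x"
| "ov_bound (Ab i k) = 0"

primrec graph_fm :: "nat \<Rightarrow> (nat \<Rightarrow> nat) \<Rightarrow> otm \<Rightarrow> nat \<Rightarrow> fm" where
  "graph_fm N s (Var x) z = Eq (Var z) (Var x)"
| "graph_fm N s (Ab i k) z = Pred (N + i) (Ab (s i) k) [Var z]"

text \<open>The sum of the bounds is at least \<open>Suc x\<close> for every \<open>Var x\<close> in
  \<open>us\<close>, hence no variable from there on occurs as an argument.\<close>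

definition fresh_vars :: "otm list \<Rightarrow> nat list" where
  "fresh_vars us = map (\<lambda>i. sum_list (map ov_bound us) + i) [0..<length us]"

definition reinterpret_atom :: "nat \<Rightarrow> (nat \<Rightarrow> nat) \<Rightarrow> otm list \<Rightarrow> (otm list \<Rightarrow> fm) \<Rightarrow> fm" where
  "reinterpret_atom N s us F =
     (if \<forall>u\<in>set us. ab_free u then F us
      else binds (map2 (\<lambda>z u. (z, graph_fm N s u z)) (fresh_vars us) us) (F (map Var (fresh_vars us))))"

primrec reinterpret :: "nat \<Rightarrow> (nat \<Rightarrow> nat) \<Rightarrow> fm \<Rightarrow> fm" where
  "reinterpret N s (Eq t u) = reinterpret_atom N s [t, u] (\<lambda>us. Eq (us ! 0) (us ! 1))"
| "reinterpret N s (EqR n j k) = EqR n j k"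
| "reinterpret N s (Pred k t ts) = reinterpret_atom N s (t # ts) (\<lambda>us. Pred k (hd us) (tl us))"
| "reinterpret N s (Less t u) = reinterpret_atom N s [t, u] (\<lambda>us. Less (us ! 0) (us ! 1))"
| "reinterpret N s Bot = Bot"
| "reinterpret N s (Imp p q) = Imp (reinterpret N s p) (reinterpret N s q)"
| "reinterpret N s (AllO x p) = AllO x (reinterpret N s p)"
| "reinterpret N s (AllR n k p) = AllR n k (reinterpret N s p)"

text \<open>A strict bound for the relation variables outside of abstraction terms, whatever their
  arity. Those inside are concept variables and cannot clash with the binary parameters
  \<open>RV 1 (N + i)\<close>.\<close>

primrec rv_bound :: "fm \<Rightarrow> nat" where
  "rv_bound (Eq s t) = 0"
| "rv_bound (EqR n j k) = Suc (max j k)"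
| "rv_bound (Pred k t ts) = Suc k"
| "rv_bound (Less s t) = 0"
| "rv_bound Bot = 0"
| "rv_bound (Imp p q) = max (rv_bound p) (rv_bound q)"
| "rv_bound (AllO x p) = rv_bound p"
| "rv_bound (AllR n k p) = max (Suc k) (rv_bound p)"

lemma fresh_vars:
  shows length_fresh_vars: "length (fresh_vars us) = length us"
    and distinct_fresh_vars: "distinct (fresh_vars us)"
    and fresh_fresh_vars: "Var x \<in> set us \<Longrightarrow> x \<notin> set (fresh_vars us)"
proof -
  show "length (fresh_vars us) = length us" "distinct (fresh_vars us)"
    by (auto simp: fresh_vars_def distinct_map inj_on_def)
  assume "Var x \<in> set us"
  then have "Suc x \<le> sum_list (map ov_bound us)"
    by (metis member_le_sum_list image_eqI list.set_map ov_bound.simps(1) zero_le)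
  then show "x \<notin> set (fresh_vars us)" by (auto simp: fresh_vars_def)
qed

lemma reinterpret_AllOs: "reinterpret N s (AllOs xs p) = AllOs xs (reinterpret N s p)"
  by (induction xs) auto

lemma syms_atom:
  assumes "\<And>us'. length us' = length us \<Longrightarrow> syms (F us') \<subseteq> insert LessSym (\<Union> (syms_tm ` set us'))"
    and "\<And>i k. Ab i k \<in> set us \<Longrightarrow> s i \<in> I"
  shows "syms (reinterpret_atom N s us F) \<subseteq> insert LessSym (AbSym ` I)"
proof (cases "\<forall>u\<in>set us. ab_free u")
  case True
  have "syms_tm u = {}" if "ab_free u" for u using that by (cases u) auto
  then have "syms (F us) \<subseteq> {LessSym}" using True assms(1)[of us] by auto
  then show ?thesis using True by (auto simp: reinterpret_atom_def)
next
  case False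
  let ?ws = "map2 (\<lambda>z u. (z, graph_fm N s u z)) (fresh_vars us) us"
  have "syms (graph_fm N s u z) \<subseteq> AbSym ` I" if u: "u \<in> set us" for u z
  proof (cases u)
    case (Ab i k)
    then show ?thesis using assms(2) u by auto
  qed simp
  then have "(\<Union>w\<in>set ?ws. syms (snd w)) \<subseteq> AbSym ` I"
    by (auto simp: subset_iff dest!: set_zip_rightD)
  moreover have "syms (F (map Var (fresh_vars us))) \<subseteq> {LessSym}"
    using assms(1)[of "map Var (fresh_vars us)"] by (auto simp: length_fresh_vars)
  moreover have "reinterpret_atom N s us F = binds ?ws (F (map Var (fresh_vars us)))"
    unfolding reinterpret_atom_def by (rule if_not_P[OF False])
  ultimately show ?thesis
    using syms_binds[of ?ws "F (map Var (fresh_vars us))"] by (simp only:) blast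
qed

lemma reinterpret_lang:
  assumes s: "s ` I' \<subseteq> I" and "p \<in> lang I'"
  shows "reinterpret N s p \<in> lang I"
proof -
  have "syms p \<subseteq> insert LessSym (AbSym ` I') \<Longrightarrow> syms (reinterpret N s p) \<subseteq> insert LessSym (AbSym ` I)"
  proof (induction p)
    case (Eq t u)
    have "s i \<in> I" if "Ab i k \<in> set [t, u]" for i k
      using that Eq image_subset_iff[THEN iffD1, OF s] by auto
    then show ?case unfolding reinterpret.simps
      by (intro syms_atom) (auto simp: length_Suc_conv)
  next
    case (Pred k t ts)
    have "s i \<in> I" if "Ab i k \<in> set (t # ts)" for i k
      using that Pred image_subset_iff[THEN iffD1, OF s] by force
    then show ?case unfolding reinterpret.simps
      by (intro syms_atom) (auto simp: length_Suc_conv)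
  next
    case (Less t u)
    have "s i \<in> I" if "Ab i k \<in> set [t, u]" for i k
      using that Less image_subset_iff[THEN iffD1, OF s] by auto
    then show ?case unfolding reinterpret.simps
      by (intro syms_atom) (auto simp: length_Suc_conv)
  qed auto
  then show ?thesis using assms(2) by (simp add: lang_def)
qed


lemma fv_binds: "fv (binds ws q) \<subseteq> fv q \<union> (\<Union>w\<in>set ws. fv (snd w))"
  by (induction ws) auto

lemma fv_atom:
  assumes F: "\<And>us'. length us' = length us \<Longrightarrow> fv (F us') \<subseteq> V \<union> \<Union> (fv_tm ` set us')"
    and "RV n k \<in> fv (reinterpret_atom N s us F)"
  shows "RV n k \<in> V \<union> \<Union> (fv_tm ` set us) \<or> n = 1 \<and> N \<le> k"
proof (cases "\<forall>u\<in>set us. ab_free u")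
  case True
  then show ?thesis using F[of us] assms(2) by (auto simp: reinterpret_atom_def)
next
  case False
  let ?ws = "map2 (\<lambda>z u. (z, graph_fm N s u z)) (fresh_vars us) us"
  consider "RV n k \<in> fv (F (map Var (fresh_vars us)))" | u z where "u \<in> set us" "RV n k \<in> fv (graph_fm N s u z)"
    using assms(2) False fv_binds[of ?ws "F (map Var (fresh_vars us))"]
    by (auto simp: reinterpret_atom_def subset_iff dest!: set_zip_rightD)
  then show ?thesis
  proof cases
    case 1
    then show ?thesis using F[of "map Var (fresh_vars us)"] by (auto simp: length_fresh_vars)
  next
    case 2
    have "RV n k \<in> fv_tm u \<or> n = 1 \<and> N \<le> k" using 2(2) by (cases u) auto
    then show ?thesis using 2 by blast
  qed
qed

text \<open>This preserves the side conditions of the schemas: new relation variables have index at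
  least \<open>N\<close>, while the variable asserted to exist by an instance lies below
  \<open>N\<close>.\<close>

lemma fv_reinterpret: "RV n k \<in> fv (reinterpret N s p) \<Longrightarrow> RV n k \<in> fv p \<or> n = 1 \<and> N \<le> k"
proof (induction p)
  case (Eq t u)
  then have "RV n k \<in> fv (reinterpret_atom N s [t, u] (\<lambda>us. Eq (us ! 0) (us ! 1)))" by simp
  then have "RV n k \<in> {} \<union> \<Union> (fv_tm ` set [t, u]) \<or> n = 1 \<and> N \<le> k"
    by (rule fv_atom[rotated]) (auto simp: length_Suc_conv)
  then show ?case by auto
next
  case (Pred m t ts)
  then have "RV n k \<in> fv (reinterpret_atom N s (t # ts) (\<lambda>us. Pred m (hd us) (tl us)))" by simp
  then have "RV n k \<in> {RV (length ts) m} \<union> \<Union> (fv_tm ` set (t # ts)) \<or> n = 1 \<and> N \<le> k"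
    by (rule fv_atom[rotated]) (auto simp: length_Suc_conv)
  then show ?case by auto
next
  case (Less t u)
  then have "RV n k \<in> fv (reinterpret_atom N s [t, u] (\<lambda>us. Less (us ! 0) (us ! 1)))" by simp
  then have "RV n k \<in> {} \<union> \<Union> (fv_tm ` set [t, u]) \<or> n = 1 \<and> N \<le> k"
    by (rule fv_atom[rotated]) (auto simp: length_Suc_conv)
  then show ?case by auto
qed auto

context base_model
begin

definition with_graphs :: "nat \<Rightarrow> (nat \<Rightarrow> 'a list set) \<Rightarrow> (nat \<Rightarrow> nat \<Rightarrow> 'a list set) \<Rightarrow> nat \<Rightarrow> nat \<Rightarrow> 'a list set" where
  "with_graphs N J r = r(1 := \<lambda>k. if k < N then r 1 k else J (k - N))"

text \<open>Covers all atoms with object arguments at once, as \<open>F\<close> only has to depend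
  on the values of its arguments. The guards determine the fresh variables uniquely, namely as the
  values of the old arguments in \<open>M'\<close>.\<close>

lemma sat_reinterpret_atom:
  assumes J: "\<And>i X a. i \<in> I' \<Longrightarrow> X \<in> rels M 0 \<Longrightarrow> a \<in> dom M \<Longrightarrow> [ab M (s i) X, a] \<in> J i \<longleftrightarrow> a = ab M' i X"
    and M': "\<And>i X. i \<in> I' \<Longrightarrow> X \<in> rels M 0 \<Longrightarrow> ab M' i X \<in> dom M"
    and us: "\<And>i k. Ab i k \<in> set us \<Longrightarrow> i \<in> I'"
    and env: "proper_env M e r"
    and F: "\<And>e' us'. map (val M e' (with_graphs N J r)) us' = map (val M' e r) us \<Longrightarrow>
      sat M e' (with_graphs N J r) (F us') \<longleftrightarrow> sat M' e r (F us)"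
  shows "sat M e (with_graphs N J r) (reinterpret_atom N s us F) \<longleftrightarrow> sat M' e r (F us)"
proof (cases "\<forall>u\<in>set us. ab_free u")
  case True
  have "val M e (with_graphs N J r) u = val M' e r u" if "ab_free u" for u
    using that by (cases u) auto
  then have "map (val M e (with_graphs N J r)) us = map (val M' e r) us" using True by auto
  then show ?thesis using F True by (simp add: reinterpret_atom_def)
next
  case False
  let ?r = "with_graphs N J r" and ?zs = "fresh_vars us"
  let ?ws = "map2 (\<lambda>z u. (z, graph_fm N s u z)) ?zs us"
  let ?vs = "map (val M' e r) us"
  let ?Gs = "map (\<lambda>b a. a = b) ?vs"
  have fstws: "map fst ?ws = ?zs" by (simp add: comp_def case_prod_unfold length_fresh_vars)
  have dom: "val M' e r u \<in> dom M" if u: "u \<in> set us" for u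
  proof (cases u)
    case (Ab i k)
    then show ?thesis using u us M' env by (auto simp: proper_env_def)
  qed (use env in \<open>simp add: proper_env_def\<close>)
  have graph: "sat M (e'(z := a)) ?r (graph_fm N s u z) \<longleftrightarrow> a = val M' e r u"
    if "u \<in> set us" "\<forall>x. x \<notin> set ?zs \<longrightarrow> e' x = e x" "a \<in> dom M" "z \<in> set ?zs" for u e' z a
  proof (cases u)
    case (Var x)
    then have "x \<notin> set ?zs" using fresh_fresh_vars that(1) by blast
    then have "e' x = e x" "x \<noteq> z" using that by blast+
    then show ?thesis using Var by simp
  next
    case (Ab i k)
    then have "i \<in> I'" "r 0 k \<in> rels M 0" using us that(1) env by (auto simp: proper_env_def)
    then have "[ab M (s i) (r 0 k), a] \<in> J i \<longleftrightarrow> a = ab M' i (r 0 k)" using J that(3) by blast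
    then show ?thesis using Ab by (simp add: with_graphs_def)
  qed
  have "sat M e ?r (binds ?ws (F (map Var ?zs))) \<longleftrightarrow> (\<exists>as. list_all2 (\<lambda>G a. a \<in> dom M \<and> G a) ?Gs as \<and>
      sat M (upds e (map fst ?ws) as) ?r (F (map Var ?zs)))"
  proof (rule sat_binds[where Z = "set ?zs" and ?e0.0 = e])
    show "list_all2 (\<lambda>(z, g) G. z \<in> set ?zs \<and> (\<forall>e' a. (\<forall>x. x \<notin> set ?zs \<longrightarrow> e' x = e x) \<longrightarrow>
        a \<in> dom M \<longrightarrow> (sat M (e'(z := a)) ?r g \<longleftrightarrow> G a))) ?ws ?Gs"
      unfolding list_all2_conv_all_nth
    proof (intro conjI allI impI)
      show "length ?ws = length ?Gs" by (simp add: length_fresh_vars)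
      fix i assume "i < length ?ws"
      then have i: "i < length us" by simp
      then have "?ws ! i = (?zs ! i, graph_fm N s (us ! i) (?zs ! i))" "?zs ! i \<in> set ?zs"
        "?Gs ! i = (\<lambda>a. a = val M' e r (us ! i))"
        by (auto simp: length_fresh_vars)
      then show "(case ?ws ! i of (z, g) \<Rightarrow> \<lambda>G. z \<in> set ?zs \<and> (\<forall>e' a. (\<forall>x. x \<notin> set ?zs \<longrightarrow> e' x = e x) \<longrightarrow>
          a \<in> dom M \<longrightarrow> (sat M (e'(z := a)) ?r g \<longleftrightarrow> G a))) (?Gs ! i)"
        using graph[OF nth_mem[OF i]] by simp
    qed
  qed simp
  also have "\<dots> \<longleftrightarrow> sat M (upds e ?zs ?vs) ?r (F (map Var ?zs))"
  proof -
    have "list_all2 (\<lambda>G a. a \<in> dom M \<and> G a) ?Gs as \<longleftrightarrow> as = ?vs" for as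
      using dom by (auto simp: list_all2_conv_all_nth intro!: nth_equalityI)
    then show ?thesis unfolding fstws by (simp only: simp_thms)
  qed
  also have "\<dots> \<longleftrightarrow> sat M' e r (F us)"
  proof (rule F)
    have "map (val M (upds e ?zs ?vs) ?r) (map Var ?zs) = map (upds e ?zs ?vs) ?zs" by simp
    then show "map (val M (upds e ?zs ?vs) ?r) (map Var ?zs) = ?vs"
      by (simp add: length_fresh_vars distinct_fresh_vars)
  qed
  finally show ?thesis unfolding reinterpret_atom_def if_not_P[OF False] .
qed

lemma with_graphs_upd:
  "n \<noteq> 1 \<or> k < N \<Longrightarrow> (with_graphs N J r)(n := (with_graphs N J r n)(k := A)) = with_graphs N J (r(n := (r n)(k := A)))"
  by (intro ext) (auto simp: with_graphs_def)

lemma sat_reinterpret: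
  assumes J: "\<And>i X a. i \<in> I' \<Longrightarrow> X \<in> rels M 0 \<Longrightarrow> a \<in> dom M \<Longrightarrow> [ab M (s i) X, a] \<in> J i \<longleftrightarrow> a = ab M' i X"
    and ab: "\<And>i X. i \<in> I' \<Longrightarrow> X \<in> rels M 0 \<Longrightarrow> ab M' i X \<in> dom M"
    and M': "dom M' = dom M" "rels M' = rels M" "lt M' = lt M"
    and p: "p \<in> lang I'" "rv_bound p \<le> N"
    and env: "proper_env M e r"
  shows "sat M e (with_graphs N J r) (reinterpret N s p) \<longleftrightarrow> sat M' e r p"
  using p env
proof (induction p arbitrary: e r)
  case (Eq t u)
  let ?F = "\<lambda>us. Eq (us ! 0) (us ! 1)"
  have us: "i \<in> I'" if "Ab i k \<in> set [t, u]" for i k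
    using that Eq(1) by (auto simp: lang_def)
  have "sat M e' (with_graphs N J r) (?F us') \<longleftrightarrow> sat M' e r (?F [t, u])"
    if *: "map (val M e' (with_graphs N J r)) us' = map (val M' e r) [t, u]" for e' us'
  proof -
    obtain t' u' where "us' = [t', u']" using * by (auto simp: map_eq_Cons_conv)
    then show ?thesis using * by (simp add: M'(3))
  qed
  from sat_reinterpret_atom[where F = ?F, OF J ab us Eq(3) this] show ?case by simp
next
  case (EqR n j k)
  have "with_graphs N J r n j = r n j" "with_graphs N J r n k = r n k"
    using EqR(2) by (auto simp: with_graphs_def)
  then show ?case by simp
next
  case (Pred k t ts)
  let ?F = "\<lambda>us. Pred k (hd us) (tl us)"
  have us: "i \<in> I'" if "Ab i k \<in> set (t # ts)" for i k
    using that Pred(1) by (force simp: lang_def)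
  have "sat M e' (with_graphs N J r) (?F us') \<longleftrightarrow> sat M' e r (?F (t # ts))"
    if *: "map (val M e' (with_graphs N J r)) us' = map (val M' e r) (t # ts)" for e' us'
  proof -
    obtain t' ts' where us': "us' = t' # ts'" using * by (cases us') auto
    then have "length ts' = length ts" using * by (auto dest: map_eq_imp_length_eq)
    moreover have "with_graphs N J r n k = r n k" for n using Pred(2) by (simp add: with_graphs_def)
    ultimately show ?thesis using * by (simp add: us')
  qed
  from sat_reinterpret_atom[where F = ?F, OF J ab us Pred(3) this] show ?case by simp
next
  case (Less t u)
  let ?F = "\<lambda>us. Less (us ! 0) (us ! 1)"
  have us: "i \<in> I'" if "Ab i k \<in> set [t, u]" for i k
    using that Less(1) by (auto simp: lang_def)
  have "sat M e' (with_graphs N J r) (?F us') \<longleftrightarrow> sat M' e r (?F [t, u])"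
    if *: "map (val M e' (with_graphs N J r)) us' = map (val M' e r) [t, u]" for e' us'
  proof -
    obtain t' u' where "us' = [t', u']" using * by (auto simp: map_eq_Cons_conv)
    then show ?thesis using * by (simp add: M'(3))
  qed
  from sat_reinterpret_atom[where F = ?F, OF J ab us Less(3) this] show ?case by simp
next
  case (AllO x p)
  have "sat M (e(x := a)) (with_graphs N J r) (reinterpret N s p) \<longleftrightarrow> sat M' (e(x := a)) r p" if "a \<in> dom M" for a
    using AllO that by (intro AllO.IH) (auto simp: lang_def intro: proper_env_updO simp del: fun_upd_apply)
  then show ?case by (simp add: M')
next
  case (AllR n k p)
  have "sat M e (with_graphs N J (r(n := (r n)(k := A)))) (reinterpret N s p) \<longleftrightarrow> sat M' e (r(n := (r n)(k := A))) p"
    if "A \<in> rels M n" for A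
    using AllR that by (intro AllR.IH) (auto simp: lang_def intro: proper_env_updR simp del: fun_upd_apply)
  moreover have "k < N" using AllR by simp
  ultimately show ?case by (simp add: M' with_graphs_upd)
qed (auto simp: lang_def)

end


section \<open>The axiom schemas under the translation\<close>

lemma syms_subst:
  assumes "\<And>x. syms_tm (\<sigma> x) = {}"
  shows "syms (subst \<sigma> \<tau> p) = syms p"
  using assms
proof (induction p arbitrary: \<sigma> \<tau>)
  have tm: "syms_tm (subst_tm \<sigma> \<tau> t) = syms_tm t" if "\<And>x. syms_tm (\<sigma> x) = {}" for \<sigma> \<tau> t
    using that by (cases t) auto
  {
    case Eq
    then show ?case by (simp add: tm)
  next
    case Pred
    then show ?case by (simp add: tm)
  next
    case Less
    then show ?case by (simp add: tm)
  next
    case (AllO x p)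
    then show ?case by (simp add: Let_def)
  next
    case (AllR n k p)
    then show ?case by (simp add: Let_def)
  }
qed simp_all

lemma lang_Imp [simp]: "Imp p q \<in> lang I \<longleftrightarrow> p \<in> lang I \<and> q \<in> lang I"
  and lang_Bot [simp]: "Bot \<in> lang I"
  and lang_AllO [simp]: "AllO x p \<in> lang I \<longleftrightarrow> p \<in> lang I"
  and lang_AllR [simp]: "AllR n k p \<in> lang I \<longleftrightarrow> p \<in> lang I"
  and lang_Pred_Var [simp]: "Pred k (Var x) (map Var xs) \<in> lang I"
  by (auto simp: lang_def)

lemma lang_AllOs [simp]: "AllOs xs p \<in> lang I \<longleftrightarrow> p \<in> lang I"
  by (induction xs) auto

lemma base_theory_lang: "base_theory I \<subseteq> lang I"
proof -
  have "linear_order_axioms \<subseteq> lang I" by (auto simp: linear_order_axioms_def lang_def)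
  moreover have "instO x (Var y) p \<in> lang I" if "p \<in> lang I" for x y p
    using that by (simp add: lang_def instO_def syms_subst)
  then have "global_choice I - linear_order_axioms \<subseteq> lang I"
    by (auto simp: global_choice_def) (auto simp: lang_def)
  moreover have "comprehension I \<subseteq> lang I" by (auto simp: comprehension_def)
  moreover have "choice I \<subseteq> lang I" by (auto simp: choice_def simp del: map_append)
  ultimately show ?thesis by (auto simp: base_theory_def)
qed

lemma reinterpret_atom_Var: "reinterpret_atom N s (Var x # map Var xs) F = F (Var x # map Var xs)"
  by (auto simp: reinterpret_atom_def)

lemma reinterpret_comprehension:
  assumes "s ` I' \<subseteq> I" "p \<in> comprehension I'" "rv_bound p \<le> N"
  shows "reinterpret N s p \<in> comprehension I"
proof -
  obtain X x xs q where p: "p = ExR (length xs) X (AllOs (x # xs) (Iff (Pred X (Var x) (map Var xs)) q))"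
    "q \<in> lang I'" "distinct (x # xs)" "RV (length xs) X \<notin> fv q"
    using assms(2) unfolding comprehension_def by blast
  have "X < N" using assms(3) unfolding p(1) by simp
  then have "RV (length xs) X \<notin> fv (reinterpret N s q)" using p(4) fv_reinterpret by fastforce
  moreover have "reinterpret N s q \<in> lang I" using reinterpret_lang assms(1) p(2) by blast
  moreover have "reinterpret N s p = ExR (length xs) X
      (AllOs (x # xs) (Iff (Pred X (Var x) (map Var xs)) (reinterpret N s q)))"
    unfolding p(1) by (simp only: reinterpret.simps reinterpret_AllOs reinterpret_atom_Var list.sel)
  ultimately show ?thesis using p(3) unfolding comprehension_def by blast
qed

lemma reinterpret_choice:
  assumes "s ` I' \<subseteq> I" "p \<in> choice I'" "rv_bound p \<le> N"
  shows "reinterpret N s p \<in> choice I"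
proof -
  obtain x xs y ys Q R q where p: "p = Imp (AllOs (x # xs) (ExR (length ys) Q q))
          (ExR (length (xs @ y # ys)) R
             (AllOs (x # xs)
                (ExR (length ys) Q
                   (Conj (AllOs (y # ys)
                            (Iff (Pred Q (Var y) (map Var ys))
                                 (Pred R (Var x) (map Var (xs @ y # ys)))))
                         q))))"
    "q \<in> lang I'" "distinct (x # xs @ y # ys)" "RV (length (xs @ y # ys)) R \<notin> fv q"
    using assms(2) unfolding choice_def by blast
  have "R < N" using assms(3) unfolding p(1) by simp
  then have "RV (length (xs @ y # ys)) R \<notin> fv (reinterpret N s q)" using p(4) fv_reinterpret by fastforce
  moreover have "reinterpret N s q \<in> lang I" using reinterpret_lang assms(1) p(2) by blast
  moreover have "reinterpret N s p = Imp (AllOs (x # xs) (ExR (length ys) Q (reinterpret N s q)))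
          (ExR (length (xs @ y # ys)) R
             (AllOs (x # xs)
                (ExR (length ys) Q
                   (Conj (AllOs (y # ys)
                            (Iff (Pred Q (Var y) (map Var ys))
                                 (Pred R (Var x) (map Var (xs @ y # ys)))))
                         (reinterpret N s q)))))"
    unfolding p(1) by (simp only: reinterpret.simps reinterpret_AllOs reinterpret_atom_Var list.sel)
  ultimately show ?thesis using p(3) unfolding choice_def by blast
qed

context base_model
begin

text \<open>Comprehension and choice are translated to instances of themselves. The scheme of least
  elements contains \<open>instO\<close>, with which the translation need not commute syntactically;
  there the class is first turned into a concept of \<open>M\<close> by comprehension, and this
  concept has a least element.\<close>

lemma base_model_reinterpret:
  assumes J: "\<And>i X a. i \<in> I' \<Longrightarrow> X \<in> rels M 0 \<Longrightarrow> a \<in> dom M \<Longrightarrow> [ab M (s i) X, a] \<in> J i \<longleftrightarrow> a = ab M' i X"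
    and J_rels: "\<And>i. J i \<in> rels M 1"
    and ab: "\<And>i X. i \<in> I' \<Longrightarrow> X \<in> rels M 0 \<Longrightarrow> ab M' i X \<in> dom M"
    and M': "dom M' = dom M" "rels M' = rels M" "lt M' = lt M"
    and s: "s ` I' \<subseteq> I"
  shows "base_model I' M'"
proof
  show "henkin_structure I' M'"
    using henkin ab by (auto simp: henkin_structure_def M')
  fix p assume p: "p \<in> base_theory I'"
  have proper: "proper_env M e (with_graphs N J r)" if "proper_env M' e r" for e r N
    using that J_rels by (auto simp: proper_env_def with_graphs_def M')
  have sat: "sat M e (with_graphs N J r) (reinterpret N s q) \<longleftrightarrow> sat M' e r q"
    if "q \<in> lang I'" "rv_bound q \<le> N" "proper_env M' e r" for q N e r
    by (rule sat_reinterpret[OF J ab M' that(1,2)]) (use that(3) in \<open>simp_all add: proper_env_def M'\<close>)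
  have trans: "valid_in M' p" if "reinterpret (rv_bound p) s p \<in> base_theory I"
    unfolding valid_in_def
  proof (intro allI impI)
    fix e r assume env: "proper_env M' e r"
    have "sat M e (with_graphs (rv_bound p) J r) (reinterpret (rv_bound p) s p)"
      using base[OF that] proper[OF env] unfolding valid_in_def by blast
    then show "sat M' e r p" using sat[OF _ order_refl env] p base_theory_lang by blast
  qed
  consider "p \<in> comprehension I'" | "p \<in> choice I'" | "p \<in> linear_order_axioms"
    | x y q where "p = Imp (ExO x q) (ExO x (Conj q (AllO y (Imp (Less (Var y) (Var x)) (Neg (instO x (Var y) q))))))"
      "q \<in> lang I'" "y \<noteq> x" "OV y \<notin> fv q"
    using p unfolding base_theory_def global_choice_def by blast
  then show "valid_in M' p"
  proof cases
    case 1
    then show ?thesis using trans reinterpret_comprehension[OF s] by (auto simp: base_theory_def)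
  next
    case 2
    then show ?thesis using trans reinterpret_choice[OF s] by (auto simp: base_theory_def)
  next
    case 3
    have "sat M' e r p \<longleftrightarrow> sat M e r p" for e r
      by (rule sat_reduct) (use 3 M' in \<open>auto simp: linear_order_axioms_def\<close>)
    moreover have "valid_in M p" by (rule base) (use 3 in \<open>simp add: base_theory_def global_choice_def\<close>)
    ultimately show ?thesis by (simp add: valid_in_def proper_env_def M')
  next
    case 4
    let ?N = "rv_bound q"
    show ?thesis unfolding valid_in_def
    proof (intro allI impI)
      fix e r assume env: "proper_env M' e r"
      have "reinterpret ?N s q \<in> lang I" using reinterpret_lang[OF s 4(2)] .
      from comprehension_holds[OF this _ proper[OF env], of x "[]" ?N]
      obtain R where R: "R \<in> rels M 0" "\<And>a. a \<in> dom M \<Longrightarrow> [a] \<in> R \<longleftrightarrow>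
          sat M (e(x := a)) (with_graphs ?N J r) (reinterpret ?N s q)"
        by force
      have R': "[a] \<in> R \<longleftrightarrow> sat M' (e(x := a)) r q" if "a \<in> dom M" for a
      proof -
        have "proper_env M' (e(x := a)) r" using env that M' by (intro proper_env_updO) simp_all
        then show ?thesis using R(2)[OF that] sat[OF 4(2) order_refl] by blast
      qed
      obtain A where A: "iset A" "R = singles A" using rels_0_cases R(1) by blast
      have "sat M' e r (ExO x (Conj q (AllO y (Imp (Less (Var y) (Var x)) (Neg (instO x (Var y) q))))))"
        if "sat M' e r (ExO x q)"
      proof -
        have "A \<noteq> {}" using that R' unfolding sat_ExO A(2) M' by auto
        then obtain a where a: "a \<in> A" "\<forall>b\<in>A. \<not> lt M b a" using iset_least A(1) by blast
        have "a \<in> dom M" using a(1) iset_subset[OF A(1)] by blast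
        moreover have "\<not> sat M' ((e(x := a, y := b))(x := b)) r q" if "b \<in> dom M" "lt M b a" for b
        proof -
          have "\<not> sat M' (e(x := b)) r q" using R'[OF that(1)] that(2) a(2) A(2) by auto
          moreover have "sat M' ((e(x := a, y := b))(x := b)) r q \<longleftrightarrow> sat M' (e(x := b)) r q"
            using 4(4) by (intro sat_cong) auto
          ultimately show ?thesis by blast
        qed
        moreover have "sat M' (e(x := a)) r q" using R' a(1) A(2) calculation(1) by simp
        ultimately show ?thesis unfolding sat_ExO sat_Conj M'(1)
          using 4(3) by (intro bexI[of _ a]) (auto simp: sat_instO M')
      qed
      then show "sat M' e r p" unfolding 4(1) by (subst sat.simps(6)) (rule impI)
    qed
  qed
qed

end

section \<open>Models of the abstraction theories\<close>

text \<open>For the formulas \<open>E\<close> considered, the truth value depends on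
  \<open>RV 0 0\<close> and \<open>RV 0 1\<close> alone, so the undefined objects and the values at
  higher arities are placeholders.\<close>

definition holds :: "'a model \<Rightarrow> fm \<Rightarrow> 'a list set \<Rightarrow> 'a list set \<Rightarrow> bool" where
  "holds M E X Y \<longleftrightarrow> sat M (\<lambda>_. undefined) (\<lambda>_ k. if k = 0 then X else Y) E"

lemma sat_app2:
  assumes "fv E = {RV 0 0, RV 0 1}"
  shows "sat M e r (app2 E j k) \<longleftrightarrow> holds M E (r 0 j) (r 0 k)"
  unfolding app2_def sat_subst holds_def by (rule sat_cong) (auto simp: assms)

lemma is_model_abs_theory:
  assumes "fv E = {RV 0 0, RV 0 1}"
  shows "is_model I M (abs_theory I E) \<longleftrightarrow> base_model I M \<and>
    (\<forall>i\<in>I. \<forall>X\<in>rels M 0. \<forall>Y\<in>rels M 0. ab M i X = ab M i Y \<longleftrightarrow> holds M E X Y)"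
proof -
  have abs: "valid_in M (abstraction E i) \<longleftrightarrow>
      (\<forall>X\<in>rels M 0. \<forall>Y\<in>rels M 0. ab M i X = ab M i Y \<longleftrightarrow> holds M E X Y)" if "base_model I M" for i
  proof -
    interpret base_model I M by fact
    have "sat M e r (abstraction E i) \<longleftrightarrow>
      (\<forall>X\<in>rels M 0. \<forall>Y\<in>rels M 0. ab M i X = ab M i Y \<longleftrightarrow> holds M E X Y)" for e r
      unfolding abstraction_def sat.simps(8) sat_Iff sat_app2[OF assms] by simp
    moreover have "proper_env M (\<lambda>_. obj) (params [] [])" by (intro proper_params) auto
    ultimately show ?thesis unfolding valid_in_def by blast
  qed
  have "is_model I M (abs_theory I E) \<longleftrightarrow> base_model I M \<and> (\<forall>i\<in>I. valid_in M (abstraction E i))"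
    unfolding is_model_iff abs_theory_def base_model_def by blast
  then show ?thesis using abs by blast
qed

lemma is_model_abs_theoryD:
  assumes "fv E = {RV 0 0, RV 0 1}" "is_model I M (abs_theory I E)"
  shows "base_model I M"
    and "i \<in> I \<Longrightarrow> X \<in> rels M 0 \<Longrightarrow> Y \<in> rels M 0 \<Longrightarrow> ab M i X = ab M i Y \<longleftrightarrow> holds M E X Y"
  using assms(2) unfolding is_model_abs_theory[OF assms(1)] by blast+

lemma abs_theory_lang:
  assumes "syms E = {}"
  shows "abs_theory I E \<subseteq> lang I"
proof -
  have "abstraction E i \<in> lang I" if "i \<in> I" for i
    using that assms by (auto simp: abstraction_def app2_def lang_def syms_subst)
  then show ?thesis using base_theory_lang by (auto simp: abs_theory_def)
qed

lemma holds_reduct: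
  assumes "syms E = {}" "dom M' = dom M" "rels M' = rels M"
  shows "holds M' E = holds M E"
  unfolding holds_def by (intro ext sat_reduct) (use assms in auto)

text \<open>The selection \<open>s\<close> of old operators allows one operator to yield the two of
  \<open>A2_theory\<close>, and one of those two to serve as the operator of
  \<open>A_theory\<close>.\<close>

definition relabel :: "'a model \<Rightarrow> (nat \<Rightarrow> nat) \<Rightarrow> (nat \<Rightarrow> 'a \<Rightarrow> 'a) \<Rightarrow> 'a model" where
  "relabel M s j = M\<lparr>ab := \<lambda>i X. j i (ab M (s i) X)\<rparr>"

lemma relabel_simps [simp]:
  "dom (relabel M s j) = dom M" "rels (relabel M s j) = rels M" "lt (relabel M s j) = lt M"
  "ab (relabel M s j) i X = j i (ab M (s i) X)"
  "rng (relabel M s j) i = j i ` rng M (s i)"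
  by (auto simp: relabel_def rng_def)

text \<open>Injectivity of \<open>j i\<close> on the old range preserves the abstraction axiom; that
  \<open>j i\<close> is a function of the model preserves the schemas.\<close>

lemma is_model_relabel:
  assumes E: "fv E = {RV 0 0, RV 0 1}" "syms E = {}"
    and M: "is_model I M (abs_theory I E)" and s: "s ` I' \<subseteq> I"
    and j: "\<And>i. i \<in> I' \<Longrightarrow> base_model.ifun M (rng M (s i)) (j i)" "\<And>i. i \<in> I' \<Longrightarrow> inj_on (j i) (rng M (s i))"
  shows "is_model I' (relabel M s j) (abs_theory I' E)"
proof -
  interpret base_model I M by (rule is_model_abs_theoryD(1)[OF E(1) M])
  \<comment> \<open>For indices outside of \<open>I'\<close> any binary relation will do, as long as
    it belongs to the model and is thus admissible as a parameter.\<close>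
  let ?J = "\<lambda>i. if i \<in> I' then pairs (\<lambda>a b. a \<in> rng M (s i) \<and> b = j i a) else rel0 1"
  have rng: "ab M i X \<in> rng M i" if "X \<in> rels M 0" for i X using that by (simp add: rng_def)
  have "base_model I' (relabel M s j)"
  proof (rule base_model_reinterpret[of I' s ?J])
    show "?J i \<in> rels M 1" for i using j(1) by (auto simp: ifun_def irel_def)
    show "ab (relabel M s j) i X \<in> dom M" if "i \<in> I'" "X \<in> rels M 0" for i X
      using ifun_range[OF j(1)[OF that(1)] rng[OF that(2)]] by simp
    show "[ab M (s i) X, a] \<in> ?J i \<longleftrightarrow> a = ab (relabel M s j) i X" if "i \<in> I'" "X \<in> rels M 0" for i X a
      using that rng by simp
  qed (simp_all add: s)
  moreover have "ab (relabel M s j) i X = ab (relabel M s j) i Y \<longleftrightarrow> holds (relabel M s j) E X Y"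
    if "i \<in> I'" "X \<in> rels M 0" "Y \<in> rels M 0" for i X Y
  proof -
    have "ab (relabel M s j) i X = ab (relabel M s j) i Y \<longleftrightarrow> ab M (s i) X = ab M (s i) Y"
      using inj_on_eq_iff[OF j(2)[OF that(1)] rng rng] that by simp
    also have "\<dots> \<longleftrightarrow> holds M E X Y"
      by (rule is_model_abs_theoryD(2)[OF E(1) M]) (use that s in auto)
    also have "\<dots> \<longleftrightarrow> holds (relabel M s j) E X Y" using holds_reduct[OF E(2), of "relabel M s j" M] by simp
    finally show ?thesis .
  qed
  ultimately show ?thesis unfolding is_model_abs_theory[OF E(1)] by simp
qed


section \<open>The equivalences\<close>

definition invariant :: "fm \<Rightarrow> ('a model \<Rightarrow> 'a set \<Rightarrow> 'a set) \<Rightarrow> bool" where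
  "invariant E D \<longleftrightarrow> (\<forall>M X f. is_model {0} M (A_theory E) \<longrightarrow> base_model.iset M X \<longrightarrow> X \<subseteq> rng M 0 \<longrightarrow>
     base_model.ifun M (D M X) f \<longrightarrow> inj_on f (D M X) \<longrightarrow> holds M E (singles X) (singles (f ` X)))"

lemma invariantD:
  assumes "invariant E D" "is_model {0} M (A_theory E)" "base_model.iset M X" "X \<subseteq> rng M 0"
    "base_model.ifun M (D M X) f" "inj_on f (D M X)"
  shows "holds M E (singles X) (singles (f ` X))"
  using assms unfolding invariant_def by blast

lemma base_model_cong:
  assumes "base_model I M" "base_model I' M'" "rels M' = rels M"
  shows iset_cong: "base_model.iset M' X \<longleftrightarrow> base_model.iset M X"
    and ifun_rels_cong: "base_model.ifun M' X f \<longleftrightarrow> base_model.ifun M X f"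
  using assms by (simp_all add: base_model.iset_def base_model.ifun_def base_model.irel_def)

locale abstraction_formula =
  fixes E :: fm
  assumes fv_E: "fv E = {RV 0 0, RV 0 1}" and syms_E: "syms E = {}"
begin

lemmas modelD = is_model_abs_theoryD[OF fv_E]

text \<open>By the abstraction axiom \<open>E\<close> is equality of abstracts, which is
  symmetric.\<close>

lemma holds_sym:
  assumes M: "is_model I M (abs_theory I E)" "i \<in> I" and "X \<in> rels M 0" "Y \<in> rels M 0"
  shows "holds M E X Y \<longleftrightarrow> holds M E Y X"
  using modelD(2)[OF M assms(3,4)] modelD(2)[OF M assms(4,3)] by metis

lemma invariant_restrict:
  fixes D :: "'a model \<Rightarrow> 'a set \<Rightarrow> 'a set"
  assumes inv: "invariant E (\<lambda>(M :: 'a model) X. X)"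
    and D: "\<And>M X. is_model {0} M (A_theory E) \<Longrightarrow> X \<subseteq> rng M 0 \<Longrightarrow> X \<subseteq> D M X"
  shows "invariant E D"
  unfolding invariant_def
proof (intro allI impI)
  fix M :: "'a model" and X f
  assume M: "is_model {0} M (A_theory E)" and X: "base_model.iset M X" "X \<subseteq> rng M 0"
    and f: "base_model.ifun M (D M X) f" "inj_on f (D M X)"
  interpret base_model "{0}" M by (rule modelD(1)[OF M])
  have "ifun X f" using ifun_subset[OF f(1) X(1) D[OF M X(2)]] .
  moreover have "inj_on f X" using inj_on_subset[OF f(2) D[OF M X(2)]] .
  ultimately show "holds M E (singles X) (singles (f ` X))" using invariantD[OF inv M X] by blast
qed

lemma invariant_rng:
  assumes inv: "invariant E (\<lambda>(M :: 'a model) X. dom M)"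
  shows "invariant E (\<lambda>(M :: 'a model) X. rng M 0)"
  unfolding invariant_def
proof (intro allI impI)
  fix M :: "'a model" and X j
  assume M: "is_model {0} M (A_theory E)" and X: "base_model.iset M X" "X \<subseteq> rng M 0"
    and j: "base_model.ifun M (rng M 0) j" "inj_on j (rng M 0)"
  interpret base_model "{0}" M by (rule modelD(1)[OF M])
  define R where "R = rng M 0"
  have R: "iset R" unfolding R_def by (rule iset_rng) simp
  note X0 = X and X = X[folded R_def] and j = j[folded R_def]
  have jR: "iset (j ` R)" using iset_image[OF j(1) R] by simp
  have sub: "R \<subseteq> dom M" "j ` R \<subseteq> dom M" using iset_subset R jR by blast+
  have un: "R \<union> (dom M - R) = dom M" "j ` R \<union> (dom M - j ` R) = dom M" using sub by blast+
  from comparability[OF iset_Diff[OF iset_dom R] iset_Diff[OF iset_dom jR]]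
  show "holds M E (singles X) (singles (j ` X))"
  proof (elim disjE exE conjE)
    \<comment> \<open>Here \<open>h\<close> extends \<open>j\<close> to an injection of
      \<open>V\<close> with the same values on \<open>X\<close>.\<close>
    fix h assume h: "ifun (dom M - R) h" "inj_on h (dom M - R)" "h ` (dom M - R) \<subseteq> dom M - j ` R"
    let ?k = "\<lambda>a. if a \<in> R then j a else h a"
    have "ifun (dom M) ?k" using ifun_join[OF j(1) h(1)] un(1) by simp
    moreover have "inj_on ?k (R \<union> (dom M - R))" using j(2) h(2,3) by (intro inj_on_join) auto
    then have "inj_on ?k (dom M)" by (simp only: un(1))
    ultimately have "holds M E (singles X) (singles (?k ` X))"
      using invariantD[OF inv M X0] unfolding R_def by blast
    moreover have "?k ` X = j ` X" using X(2) by (intro image_cong) auto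
    ultimately show ?thesis by simp
  next
    \<comment> \<open>Here the inverse of \<open>j\<close> extends to \<open>V\<close>. It is
      applied to the image of \<open>X\<close>, which consists of values of
      \<open>j \<circ> \<partial>\<close>, and it leads back to \<open>X\<close>.\<close>
    fix h assume h: "ifun (dom M - j ` R) h" "inj_on h (dom M - j ` R)" "h ` (dom M - j ` R) \<subseteq> dom M - R"
    let ?i = "the_inv_into R j"
    let ?k = "\<lambda>a. if a \<in> j ` R then ?i a else h a"
    define N where "N = relabel M (\<lambda>_. 0) (\<lambda>_. j)"
    have N: "is_model {0} N (A_theory E)"
      unfolding N_def by (rule is_model_relabel[OF fv_E syms_E M]) (use j in \<open>auto simp: R_def\<close>)
    have rels_N: "rels N = rels M" by (simp add: N_def)
    note cong = base_model_cong[OF base_model_axioms modelD(1)[OF N] rels_N]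
    have i: "ifun (j ` R) ?i" "inj_on ?i (j ` R)" "?i ` j ` R = R"
      using ifun_inv[OF j] inj_on_the_inv_into[OF j(2)] the_inv_into_onto[OF j(2)] by simp_all
    have "ifun (dom M) ?k" using ifun_join[OF i(1) h(1)] un(2) by simp
    moreover have "inj_on ?k (j ` R \<union> (dom M - j ` R))" using i h(2,3) by (intro inj_on_join) auto
    then have "inj_on ?k (dom M)" by (simp only: un(2))
    moreover have jX: "iset (j ` X)" using iset_image[OF j(1) X] .
    moreover have "j ` X \<subseteq> rng N 0" using X(2) by (auto simp: N_def R_def)
    moreover have "dom N = dom M" by (simp add: N_def)
    ultimately have "holds N E (singles (j ` X)) (singles (?k ` j ` X))"
      using invariantD[OF inv N] cong by metis
    moreover have "?k ` j ` X = X"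
    proof -
      have "?k (j a) = a" if "a \<in> X" for a
        using that X(2) the_inv_into_f_f[OF j(2)] by auto
      then have "(\<lambda>a. ?k (j a)) ` X = (\<lambda>a. a) ` X" by (intro image_cong refl)
      then show ?thesis unfolding image_image by simp
    qed
    moreover have "holds N E = holds M E" by (rule holds_reduct[OF syms_E]) (simp_all add: N_def)
    ultimately have "holds M E (singles (j ` X)) (singles X)" by simp
    then show ?thesis using holds_sym[OF M] X(1) jX by (simp add: iset_def)
  qed
qed

lemma invariant_self:
  assumes inv: "invariant E (\<lambda>(M :: 'a model) X. rng M 0)"
  shows "invariant E (\<lambda>(M :: 'a model) X. X)"
  unfolding invariant_def
proof (intro allI impI)
  fix M :: "'a model" and X f
  assume M: "is_model {0} M (A_theory E)" and X: "base_model.iset M X" "X \<subseteq> rng M 0"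
    and f: "base_model.ifun M X f" "inj_on f X"
  interpret base_model "{0}" M by (rule modelD(1)[OF M])
  define R where "R = rng M 0"
  have R: "iset R" unfolding R_def by (rule iset_rng) simp
  note X0 = X and X = X[folded R_def]
  have fX: "iset (f ` X)" using iset_image[OF f(1) X(1)] by simp
  have un: "X \<union> (R - X) = R" "f ` X \<union> (dom M - f ` X) = dom M" using X(2) iset_subset[OF fX] by blast+
  from comparability[OF iset_Diff[OF R X(1)] iset_Diff[OF iset_dom fX]]
  show "holds M E (singles X) (singles (f ` X))"
  proof (elim disjE exE conjE)
    fix h assume h: "ifun (R - X) h" "inj_on h (R - X)" "h ` (R - X) \<subseteq> dom M - f ` X"
    let ?k = "\<lambda>a. if a \<in> X then f a else h a"
    have "ifun R ?k" using ifun_join[OF f(1) h(1)] un(1) by simp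
    moreover have "inj_on ?k (X \<union> (R - X))" using f(2) h(2,3) by (intro inj_on_join) auto
    then have "inj_on ?k R" by (simp only: un(1))
    ultimately have "holds M E (singles X) (singles (?k ` X))"
      using invariantD[OF inv M X0] unfolding R_def by blast
    moreover have "?k ` X = f ` X" by (intro image_cong) auto
    ultimately show ?thesis by simp
  next
    \<comment> \<open>Now \<open>?k\<close> inverts \<open>f\<close> on the image of
      \<open>X\<close> and sends everything else into \<open>R - X\<close>, so it embeds all of
      \<open>V\<close> into \<open>R\<close>.\<close>
    fix h assume h: "ifun (dom M - f ` X) h" "inj_on h (dom M - f ` X)" "h ` (dom M - f ` X) \<subseteq> R - X"
    let ?i = "the_inv_into X f"
    let ?k = "\<lambda>a. if a \<in> f ` X then ?i a else h a"
    have i: "ifun (f ` X) ?i" "inj_on ?i (f ` X)" "?i ` f ` X = X"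
      using ifun_inv[OF f] inj_on_the_inv_into[OF f(2)] the_inv_into_onto[OF f(2)] by simp_all
    have k: "ifun (dom M) ?k" using ifun_join[OF i(1) h(1)] un(2) by simp
    have "inj_on ?k (f ` X \<union> (dom M - f ` X))" using i h(2,3) by (intro inj_on_join) auto
    then have inj_k: "inj_on ?k (dom M)" by (simp only: un(2))
    have "?k ` dom M \<subseteq> R"
    proof
      fix b assume "b \<in> ?k ` dom M"
      then obtain a where a: "a \<in> dom M" "b = ?k a" by blast
      show "b \<in> R"
      proof (cases "a \<in> f ` X")
        case True
        then have "?i a \<in> X" using i(3) by blast
        then show ?thesis using True a(2) X(2) by auto
      next
        case False
        then have "h a \<in> R - X" using a(1) h(3) by blast
        then show ?thesis using False a(2) by auto
      qed
    qed
    then obtain q where q: "ifun R q" "inj_on q R" "q ` R = dom M"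
      using cantor_bernstein[OF k inj_k _ R] by blast
    \<comment> \<open>The range of \<open>q \<circ> \<partial>\<close> is \<open>V\<close>. Hence
      \<open>?k\<close> is an injection on the range and the image of \<open>X\<close> under
      \<open>f\<close> is a set of abstracts, as the hypothesis requires.\<close>
    define N where "N = relabel M (\<lambda>_. 0) (\<lambda>_. q)"
    have N: "is_model {0} N (A_theory E)"
      unfolding N_def by (rule is_model_relabel[OF fv_E syms_E M]) (use q in \<open>auto simp: R_def\<close>)
    have rels_N: "rels N = rels M" by (simp add: N_def)
    note cong = base_model_cong[OF base_model_axioms modelD(1)[OF N] rels_N]
    have "rng N 0 = dom M" using q(3) by (simp add: N_def R_def)
    then have "holds N E (singles (f ` X)) (singles (?k ` f ` X))"
      using invariantD[OF inv N] cong k inj_k fX iset_subset[OF fX] by metis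
    moreover have "?k ` f ` X = X"
    proof -
      have "?k (f a) = a" if "a \<in> X" for a
        using that the_inv_into_f_f[OF f(2)] by auto
      then have "(\<lambda>a. ?k (f a)) ` X = (\<lambda>a. a) ` X" by (intro image_cong refl)
      then show ?thesis unfolding image_image by simp
    qed
    moreover have "holds N E = holds M E" by (rule holds_reduct[OF syms_E]) (simp_all add: N_def)
    ultimately have "holds M E (singles (f ` X)) (singles X)" by simp
    then show ?thesis using holds_sym[OF M] X(1) fX by (simp add: iset_def)
  qed
qed

text \<open>Preservation of the operator at \<open>X\<close> reads
  \<open>j(\<partial>(X)) = j(\<partial>(j(X)))\<close>. Both abstracts lie in the range of
  \<partial>, where \<open>j\<close> is injective, so
  \<open>\<partial>(X) = \<partial>(j(X))\<close>, which is \<open>E(X, j(X))\<close>.\<close>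

lemma categorical_imp_invariant:
  notes One_nat_def [simp del]
  assumes cat: "naturally_relatively_categorical TYPE('a) E"
  shows "invariant E (\<lambda>(M :: 'a model) X. rng M 0)"
  unfolding invariant_def
proof (intro allI impI)
  fix M :: "'a model" and X j
  assume M: "is_model {0} M (A_theory E)" and X: "base_model.iset M X" "X \<subseteq> rng M 0"
    and j: "base_model.ifun M (rng M 0) j" "inj_on j (rng M 0)"
  interpret base_model "{0}" M by (rule modelD(1)[OF M])
  define N where "N = relabel M (\<lambda>_. 0) (\<lambda>i. if i = 1 then (\<lambda>a. a) else j)"
  have R: "iset (rng M 0)" by (rule iset_rng) simp
  have N: "is_model {1, 2} N (A2_theory E)"
    unfolding N_def by (rule is_model_relabel[OF fv_E syms_E M]) (use j ifun_id[OF R] in auto)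
  have ab_N: "ab N 1 Y = ab M 0 Y" "ab N 2 Y = j (ab M 0 Y)" and rels_N: "rels N = rels M" for Y
    by (simp_all add: N_def)
  have rng_N: "rng N 1 = rng M 0" by (simp add: N_def)
  have \<Gamma>: "nat_bij N a = j a" if "a \<in> rng M 0" for a
    unfolding nat_bij_def ab_N rels_N using that by (intro the_equality) (auto simp: rng_def)
  have iso: "is_isomorphism (nat_bij N) (nat_bij_rel N) (induced N 1) (induced N 2)"
    using cat N unfolding naturally_relatively_categorical_def by blast
  have XM: "singles X \<in> rels M 0" using X(1) by (simp add: iset_def)
  have jX: "singles (j ` X) \<in> rels M 0"
    using iset_image[OF j(1) X] by (simp add: iset_def)
  have "singles X \<in> srels (induced N 1) 0"
    using XM X(2) by (auto simp: induced_def rels_N rng_N singles_def)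
  then have "nat_bij N (ab N 1 (singles X)) = ab N 2 (nat_bij_rel N 0 (singles X))"
    using iso unfolding is_isomorphism_def by (simp add: induced_def)
  moreover have "nat_bij_rel N 0 (singles X) = singles (j ` X)"
  proof -
    have "nat_bij N ` X = j ` X" using \<Gamma> X(2) by (intro image_cong) auto
    then show ?thesis by (simp add: nat_bij_rel_def map_singles)
  qed
  moreover have "ab M 0 (singles X) \<in> rng M 0" "ab M 0 (singles (j ` X)) \<in> rng M 0"
    using XM jX by (auto simp: rng_def)
  ultimately have "ab M 0 (singles X) = ab M 0 (singles (j ` X))"
    using \<Gamma> j(2) by (simp add: ab_N inj_on_eq_iff)
  then show "holds M E (singles X) (singles (j ` X))" using modelD(2)[OF M _ XM jX] by simp
qed

text \<open>The graph of \<Gamma> is definable from the two operators, so \<Gamma> and its inverse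
  are functions of the model and carry its relations to relations of the model. The clause for the
  operator amounts to \<open>E(X, \<Gamma>(X))\<close>, an instance of invariance for \<Gamma>
  restricted to \<open>X\<close>.\<close>

lemma invariant_imp_categorical:
  notes One_nat_def [simp del]
  assumes inv: "invariant E (\<lambda>(M :: 'a model) X. X)"
  shows "naturally_relatively_categorical TYPE('a) E"
  unfolding naturally_relatively_categorical_def
proof (intro allI impI)
  fix M :: "'a model" assume M: "is_model {1, 2} M (A2_theory E)"
  interpret base_model "{1, 2}" M by (rule modelD(1)[OF M])
  let ?\<Gamma> = "nat_bij M" and ?R = "rng M 1"
  have ab: "ab M 1 X = ab M 1 Y \<longleftrightarrow> holds M E X Y" "ab M 2 X = ab M 2 Y \<longleftrightarrow> holds M E X Y"
    if "X \<in> rels M 0" "Y \<in> rels M 0" for X Y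
    using modelD(2)[OF M _ that] by simp_all
  have \<Gamma>: "?\<Gamma> (ab M 1 X) = ab M 2 X" if "X \<in> rels M 0" for X
    unfolding nat_bij_def
  proof (rule the_equality)
    show "\<exists>Y\<in>rels M 0. ab M 1 X = ab M 1 Y \<and> ab M 2 X = ab M 2 Y" using that by blast
    fix b assume "\<exists>Y\<in>rels M 0. ab M 1 X = ab M 1 Y \<and> b = ab M 2 Y"
    then obtain Y where Y: "Y \<in> rels M 0" "ab M 1 X = ab M 1 Y" "b = ab M 2 Y" by blast
    then show "b = ab M 2 X" using ab[OF that Y(1)] by simp
  qed
  have inj: "inj_on ?\<Gamma> ?R"
  proof (rule inj_onI)
    fix a b assume "a \<in> ?R" "b \<in> ?R" and eq: "?\<Gamma> a = ?\<Gamma> b"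
    then obtain X Y where XY: "X \<in> rels M 0" "Y \<in> rels M 0" "a = ab M 1 X" "b = ab M 1 Y"
      unfolding rng_def by blast
    then show "a = b" using eq \<Gamma> ab[OF XY(1,2)] by simp
  qed
  have im: "?\<Gamma> ` ?R = rng M 2"
    using \<Gamma> by (force simp: rng_def)
  have graph: "a \<in> ?R \<and> b = ?\<Gamma> a \<longleftrightarrow> (\<exists>X\<in>rels M 0. ab M 1 X = a \<and> ab M 2 X = b)" for a b
    using \<Gamma> by (auto simp: rng_def)
  have "iset ?R" "iset (rng M 2)" by (auto intro: iset_rng)
  then have rng_dom: "rng M 1 \<subseteq> dom M" "rng M 2 \<subseteq> dom M" using iset_subset by blast+
  have ifun_\<Gamma>: "ifun ?R ?\<Gamma>"
    unfolding ifun_def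
  proof (rule irelI[of "ExR 0 0 (Conj (Eq (Ab 1 0) (Var 0)) (Eq (Ab 2 0) (Var 1)))" "[]" "[]" "\<lambda>_. obj"])
    show "a \<in> ?R \<and> b = ?\<Gamma> a \<Longrightarrow> a \<in> dom M \<and> b \<in> dom M" for a b
      using im rng_dom by blast
    show "a \<in> ?R \<and> b = ?\<Gamma> a \<longleftrightarrow> sat M ((\<lambda>_. obj)(0 := a, 1 := b)) (params [] [])
        (ExR 0 0 (Conj (Eq (Ab 1 0) (Var 0)) (Eq (Ab 2 0) (Var 1))))" for a b
      unfolding graph sat_ExR sat_Conj by simp
  qed (auto simp: lang_def)
  let ?\<Delta> = "the_inv_into ?R ?\<Gamma>"
  have \<Delta>: "ifun (rng M 2) ?\<Delta>" using ifun_inv[OF ifun_\<Gamma> inj] im by simp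
  have \<Delta>\<Gamma>: "?\<Delta> (?\<Gamma> a) = a" if "a \<in> ?R" for a using the_inv_into_f_f[OF inj that] .
  have \<Gamma>\<Delta>: "?\<Gamma> (?\<Delta> b) = b" "?\<Delta> b \<in> ?R" if "b \<in> rng M 2" for b
    using that im f_the_inv_into_f[OF inj] the_inv_into_into[OF inj, of b ?R] by auto
  have map1: "map ?\<Delta> (map ?\<Gamma> as) = as" if "set as \<subseteq> ?R" for as
    using that \<Delta>\<Gamma> by (auto intro!: map_idI)
  have map2: "map ?\<Gamma> (map ?\<Delta> bs) = bs" if "set bs \<subseteq> rng M 2" for bs
    using that \<Gamma>\<Delta> by (auto intro!: map_idI)
  have inv1: "map ?\<Delta> ` map ?\<Gamma> ` Q = Q" if "\<And>as. as \<in> Q \<Longrightarrow> set as \<subseteq> ?R" for Q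
    unfolding image_image using map1 that by (simp cong: image_cong)
  have inv2: "map ?\<Gamma> ` map ?\<Delta> ` Q = Q" if "\<And>as. as \<in> Q \<Longrightarrow> set as \<subseteq> rng M 2" for Q
    unfolding image_image using map2 that by (simp cong: image_cong)
  have srels: "Q \<in> srels (induced M i) n \<longleftrightarrow> Q \<in> rels M n \<and> (\<forall>as\<in>Q. set as \<subseteq> rng M i \<and> length as = Suc n)"
    for Q i n by (auto simp: induced_def)
  show "is_isomorphism ?\<Gamma> (nat_bij_rel M) (induced M 1) (induced M 2)"
    unfolding is_isomorphism_def
  proof (intro conjI allI ballI impI)
    show "bij_betw ?\<Gamma> (sdom (induced M 1)) (sdom (induced M 2))"
      using inj im by (simp add: induced_def bij_betw_def)
  next
    fix n
    show "bij_betw (nat_bij_rel M n) (srels (induced M 1) n) (srels (induced M 2) n)"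
    proof (rule bij_betw_byWitness[where f' = "\<lambda>Q. map ?\<Delta> ` Q"])
      show "\<forall>Q\<in>srels (induced M 1) n. map ?\<Delta> ` nat_bij_rel M n Q = Q"
        unfolding nat_bij_rel_def by (intro ballI inv1) (simp add: srels)
      show "\<forall>Q\<in>srels (induced M 2) n. nat_bij_rel M n (map ?\<Delta> ` Q) = Q"
        unfolding nat_bij_rel_def by (intro ballI inv2) (simp add: srels)
      show "nat_bij_rel M n ` srels (induced M 1) n \<subseteq> srels (induced M 2) n"
      proof
        fix S assume "S \<in> nat_bij_rel M n ` srels (induced M 1) n"
        then obtain Q where Q: "S = map ?\<Gamma> ` Q" "Q \<in> rels M n" "\<forall>as\<in>Q. set as \<subseteq> ?R \<and> length as = Suc n"
          unfolding nat_bij_rel_def srels image_iff Bex_def by blast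
        then have "S \<in> rels M n" using rels_image[OF ifun_\<Gamma> Q(2)] by blast
        then show "S \<in> srels (induced M 2) n" unfolding srels using Q im by auto
      qed
      show "(\<lambda>Q. map ?\<Delta> ` Q) ` srels (induced M 2) n \<subseteq> srels (induced M 1) n"
      proof
        fix S assume "S \<in> (\<lambda>Q. map ?\<Delta> ` Q) ` srels (induced M 2) n"
        then obtain Q where Q: "S = map ?\<Delta> ` Q" "Q \<in> rels M n" "\<forall>as\<in>Q. set as \<subseteq> rng M 2 \<and> length as = Suc n"
          unfolding srels image_iff Bex_def by blast
        then have "S \<in> rels M n" using rels_image[OF \<Delta> Q(2)] by blast
        then show "S \<in> srels (induced M 1) n" unfolding srels using Q \<Gamma>\<Delta>(2) by auto
      qed
    qed
  next
    fix n Q as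
    assume Q: "Q \<in> srels (induced M 1) n" and as: "set as \<subseteq> sdom (induced M 1)" "length as = Suc n"
    have "as \<in> Q" if img: "map ?\<Gamma> as \<in> map ?\<Gamma> ` Q"
    proof -
      obtain as' where as': "as' \<in> Q" "map ?\<Gamma> as = map ?\<Gamma> as'" using img by blast
      have "set as \<subseteq> ?R" "set as' \<subseteq> ?R"
        using as(1) Q as'(1) unfolding srels by (auto simp: induced_def)
      from map1[OF this(1)] map1[OF this(2)] have "as = as'" using as'(2) by simp
      then show ?thesis using as' by simp
    qed
    then show "as \<in> Q \<longleftrightarrow> map ?\<Gamma> as \<in> nat_bij_rel M n Q" unfolding nat_bij_rel_def by blast
  next
    fix X assume X: "X \<in> srels (induced M 1) 0"
    then obtain A where A: "iset A" "X = singles A" using rels_0_cases unfolding srels by blast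
    have AR: "A \<subseteq> ?R" using X A(2) unfolding srels by (auto simp: singles_def)
    \<comment> \<open>Forgets \<open>\<partial>\<^sub>2\<close> and makes
      \<open>\<partial>\<^sub>1\<close> the operator of a model of \<open>A[E]\<close>, so that sets
      of values of \<open>\<partial>\<^sub>1\<close> become sets of abstracts.\<close>
    define N where "N = relabel M (\<lambda>_. 1) (\<lambda>_ a. a)"
    have N: "is_model {0} N (A_theory E)"
      unfolding N_def
      by (rule is_model_relabel[OF fv_E syms_E M]) (use ifun_id[OF \<open>iset ?R\<close>] in auto)
    have rels_N: "rels N = rels M" by (simp add: N_def)
    note cong = base_model_cong[OF base_model_axioms modelD(1)[OF N] rels_N]
    have "rng N 0 = ?R" by (simp add: N_def)
    then have "holds N E (singles A) (singles (?\<Gamma> ` A))"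
      using invariantD[OF inv N] cong A(1) AR ifun_subset[OF ifun_\<Gamma> A(1) AR] inj_on_subset[OF inj AR] by metis
    moreover have "holds N E = holds M E" by (rule holds_reduct[OF syms_E]) (simp_all add: N_def)
    moreover have "singles (?\<Gamma> ` A) \<in> rels M 0" using iset_image[OF ifun_\<Gamma> A(1) AR] by (simp add: iset_def)
    moreover have "singles A \<in> rels M 0" using A(1) by (simp add: iset_def)
    ultimately have "ab M 2 (singles A) = ab M 2 (singles (?\<Gamma> ` A))" "?\<Gamma> (ab M 1 (singles A)) = ab M 2 (singles A)"
      using ab(2) \<Gamma> by simp_all
    then show "?\<Gamma> (sab (induced M 1) X) = sab (induced M 2) (nat_bij_rel M 0 X)"
      by (simp add: induced_def nat_bij_rel_def A(2) map_singles)
  qed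
qed

end


section \<open>The syntactic conditions evaluated in a model\<close>

context base_model
begin

lemma bex_rels_1: "(\<exists>X\<in>rels M (Suc 0). P X) \<longleftrightarrow> (\<exists>R. irel R \<and> P (pairs R))"
  using ball_rels_1[of "\<lambda>X. \<not> P X"] by blast

lemma sat_injection_V:
  assumes R: "irel R" and r: "r 1 F = pairs R"
  shows "sat M e r (injection_V F) \<longleftrightarrow> (\<exists>f. ifun (dom M) f \<and> inj_on f (dom M) \<and> R = (\<lambda>a b. a \<in> dom M \<and> b = f a))"
proof -
  have "sat M e r (injection_V F) \<longleftrightarrow> (\<forall>a\<in>dom M. \<exists>b\<in>dom M. R a b) \<and>
      (\<forall>a\<in>dom M. \<forall>b\<in>dom M. \<forall>c\<in>dom M. R a b \<and> R a c \<longrightarrow> b = c) \<and>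
      (\<forall>a\<in>dom M. \<forall>b\<in>dom M. \<forall>c\<in>dom M. R a c \<and> R b c \<longrightarrow> a = b)"
    using r by (simp add: injection_V_def) blast
  also have "\<dots> \<longleftrightarrow> (\<exists>f. ifun (dom M) f \<and> inj_on f (dom M) \<and> R = (\<lambda>a b. a \<in> dom M \<and> b = f a))" (is "?L \<longleftrightarrow> ?R")
  proof
    assume L: ?L
    have "\<exists>f. ifun (dom M) f \<and> R = (\<lambda>a b. a \<in> dom M \<and> b = f a)"
    proof (rule irel_functional[OF R])
      show "\<exists>b. R a b" if "a \<in> dom M" for a using L that by blast
      show "a \<in> dom M" if "R a b" for a b using irel_dom[OF R that] by blast
      show "b = b'" if "R a b" "R a b'" for a b b'
        using L that irel_dom[OF R that(1)] irel_dom[OF R that(2)] by blast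
    qed
    then obtain f where f: "ifun (dom M) f" "R = (\<lambda>a b. a \<in> dom M \<and> b = f a)" by blast
    have "inj_on f (dom M)"
    proof (rule inj_onI)
      fix a b assume "a \<in> dom M" "b \<in> dom M" "f a = f b"
      then show "a = b" using L ifun_range[OF f(1)] unfolding f(2) by blast
    qed
    then show ?R using f by blast
  next
    assume ?R
    then obtain f where f: "ifun (dom M) f" "inj_on f (dom M)" "R = (\<lambda>a b. a \<in> dom M \<and> b = f a)" by blast
    then show ?L using ifun_range[OF f(1)] inj_onD[OF f(2)] by auto
  qed
  finally show ?thesis .
qed

lemma sat_sub_rng:
  assumes A: "iset A" "r 0 X = singles A"
  shows "sat M e r (sub_rng X) \<longleftrightarrow> A \<subseteq> rng M 0"
proof -
  have "sat M e r (sub_rng X) \<longleftrightarrow> (\<forall>a\<in>dom M. a \<in> A \<longrightarrow> a \<in> rng M 0)"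
    using A(2) by (auto simp: sub_rng_def rng_def)
  then show ?thesis using iset_subset[OF A(1)] by blast
qed

lemma sat_image_of:
  assumes f: "ifun D f" "r 1 F = pairs (\<lambda>a b. a \<in> D \<and> b = f a)"
    and A: "iset A" "r 0 X = singles A" "A \<subseteq> D" and B: "iset B" "r 0 Y = singles B"
  shows "sat M e r (image_of F X Y) \<longleftrightarrow> B = f ` A"
proof -
  have "sat M e r (image_of F X Y) \<longleftrightarrow> (\<forall>b\<in>dom M. b \<in> B \<longleftrightarrow> (\<exists>a\<in>dom M. a \<in> A \<and> a \<in> D \<and> b = f a))"
    unfolding image_of_def sat.simps(7) sat_Iff sat_ExO sat_Conj using f(2) A(2) B(2) by simp blast
  also have "\<dots> \<longleftrightarrow> B = f ` A"
    using iset_subset[OF A(1)] iset_subset[OF B(1)] iset_subset[OF iset_image[OF f(1) A(1,3)]] A(3) by blast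
  finally show ?thesis .
qed

lemma sat_equinumerous:
  assumes A: "iset A" "r 0 X = singles A" and B: "iset B" "r 0 Y = singles B"
  shows "sat M e r (equinumerous X Y) \<longleftrightarrow> (\<exists>f. ifun A f \<and> inj_on f A \<and> f ` A = B)"
proof -
  \<comment> \<open>The clauses follow the unfolded formula with the quantifier over
    \<open>c\<close> moved inside; hence the disjunction that expresses injectivity.\<close>
  let ?bij = "\<lambda>R. (\<forall>a\<in>dom M. \<forall>b\<in>dom M. R a b \<longrightarrow> a \<in> A \<and> b \<in> B) \<and>
      (\<forall>a\<in>dom M. a \<in> A \<longrightarrow> (\<exists>b\<in>dom M. R a b)) \<and>
      (\<forall>a\<in>dom M. \<forall>b\<in>dom M. R a b \<longrightarrow> (\<forall>c\<in>dom M. R a c \<longrightarrow> b = c)) \<and>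
      (\<forall>a\<in>dom M. \<forall>b\<in>dom M. (\<forall>c\<in>dom M. R a c \<longrightarrow> \<not> R b c) \<or> a = b) \<and>
      (\<forall>b\<in>dom M. b \<in> B \<longrightarrow> (\<exists>a\<in>dom M. R a b))"
  have "sat M e r (equinumerous X Y) \<longleftrightarrow> (\<exists>R. irel R \<and> ?bij R)"
    unfolding equinumerous_def sat_ExR One_nat_def bex_rels_1
    using A(2) B(2) by (simp add: bijection_def)
  also have "\<dots> \<longleftrightarrow> (\<exists>f. ifun A f \<and> inj_on f A \<and> f ` A = B)"
  proof
    assume "\<exists>R. irel R \<and> ?bij R"
    then obtain R where R: "irel R" and bij: "?bij R" by blast
    have "\<exists>f. ifun A f \<and> R = (\<lambda>a b. a \<in> A \<and> b = f a)"
    proof (rule irel_functional[OF R])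
      show "\<exists>b. R a b" if "a \<in> A" for a using bij that iset_subset[OF A(1)] by blast
      show "a \<in> A" if "R a b" for a b using bij that irel_dom[OF R that] by blast
      show "b = b'" if "R a b" "R a b'" for a b b'
        using bij that irel_dom[OF R that(1)] irel_dom[OF R that(2)] by blast
    qed
    then obtain f where f: "ifun A f" "R = (\<lambda>a b. a \<in> A \<and> b = f a)" by blast
    have "inj_on f A"
    proof (rule inj_onI)
      fix a b assume "a \<in> A" "b \<in> A" "f a = f b"
      then have ab: "R a (f a)" "R b (f a)" unfolding f(2) by simp_all
      have "a \<in> dom M" "b \<in> dom M" "f a \<in> dom M" using irel_dom[OF R ab(1)] irel_dom[OF R ab(2)] by simp_all
      moreover from bij have "\<forall>a\<in>dom M. \<forall>b\<in>dom M. (\<forall>c\<in>dom M. R a c \<longrightarrow> \<not> R b c) \<or> a = b" by (elim conjE)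
      ultimately show "a = b" using ab by blast
    qed
    moreover have "f ` A = B"
    proof
      have "f a \<in> B" if "a \<in> A" for a
      proof -
        have "R a (f a)" using that unfolding f(2) by simp
        then show ?thesis using bij irel_dom[OF R] by blast
      qed
      then show "f ` A \<subseteq> B" by blast
      show "B \<subseteq> f ` A"
      proof
        fix b assume b: "b \<in> B"
        then have "b \<in> dom M" using iset_subset[OF B(1)] by blast
        then obtain a where "R a b" using bij b by blast
        then show "b \<in> f ` A" unfolding f(2) by blast
      qed
    qed
    ultimately show "\<exists>f. ifun A f \<and> inj_on f A \<and> f ` A = B" using f(1) by blast
  next
    assume "\<exists>f. ifun A f \<and> inj_on f A \<and> f ` A = B"
    then obtain f where f: "ifun A f" "inj_on f A" "f ` A = B" by blast
    then have "?bij (\<lambda>a b. a \<in> A \<and> b = f a)"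
      using ifun_range[OF f(1)] inj_onD[OF f(2)] by auto
    then show "\<exists>R. irel R \<and> ?bij R" using f(1) unfolding ifun_def by blast
  qed
  finally show ?thesis .
qed

lemma valid_in_closed:
  assumes "\<And>e r. sat M e r p \<longleftrightarrow> P"
  shows "valid_in M p \<longleftrightarrow> P"
  using assms proper_params[of "[]" "[]" "\<lambda>_. obj"] by (auto simp: valid_in_def)

end

context abstraction_formula
begin

lemma injection_invariant_iff:
  assumes "infinite (UNIV :: 'a set)"
  shows "injection_invariant_on_abstracts E \<longleftrightarrow> invariant E (\<lambda>(M :: 'a model) X. dom M)"
proof -
  let ?p = "AllR 1 0 (Imp (injection_V 0)
         (AllR 0 0 (Imp (sub_rng 0)
           (AllR 0 1 (Imp (image_of 0 0 1) (app2 E 0 1))))))"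
  have p: "?p \<in> lang {0}"
    using syms_E by (auto simp: lang_def injection_V_def sub_rng_def image_of_def app2_def syms_subst)
  have "valid_in M ?p \<longleftrightarrow> (\<forall>X f. base_model.iset M X \<longrightarrow> X \<subseteq> rng M 0 \<longrightarrow> base_model.ifun M (dom M) f \<longrightarrow>
      inj_on f (dom M) \<longrightarrow> holds M E (singles X) (singles (f ` X)))"
    if M: "is_model {0} M (A_theory E)" for M :: "'a model"
  proof -
    interpret base_model "{0}" M by (rule modelD(1)[OF M])
    show ?thesis
    proof (rule valid_in_closed)
      fix e :: "nat \<Rightarrow> 'a" and r :: "nat \<Rightarrow> nat \<Rightarrow> 'a list set"
      \<comment> \<open>The assignments \<open>?r\<close> and \<open>?r'\<close> are those that
        arise from the nested quantifiers over the function, \<open>X\<close> and its image.\<close>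
      let ?r = "\<lambda>R X. (r(1 := (r 1)(0 := pairs R)))(0 := ((r(1 := (r 1)(0 := pairs R))) 0)(0 := singles X))"
      let ?r' = "\<lambda>R X Y. (?r R X)(0 := (?r R X 0)(1 := singles Y))"
      have "sat M e r ?p \<longleftrightarrow> (\<forall>R. irel R \<longrightarrow> sat M e (r(1 := (r 1)(0 := pairs R))) (injection_V 0) \<longrightarrow>
          (\<forall>X. iset X \<longrightarrow> sat M e (?r R X) (sub_rng 0) \<longrightarrow>
            (\<forall>Y. iset Y \<longrightarrow> sat M e (?r' R X Y) (image_of 0 0 1) \<longrightarrow> sat M e (?r' R X Y) (app2 E 0 1))))"
        by (simp only: sat.simps(6,8) One_nat_def ball_rels_0 ball_rels_1)
      also have "\<dots> \<longleftrightarrow> (\<forall>R. irel R \<longrightarrow> (\<exists>f. ifun (dom M) f \<and> inj_on f (dom M) \<and> R = (\<lambda>a b. a \<in> dom M \<and> b = f a)) \<longrightarrow>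
          (\<forall>X. iset X \<longrightarrow> X \<subseteq> rng M 0 \<longrightarrow>
            (\<forall>Y. iset Y \<longrightarrow> sat M e (?r' R X Y) (image_of 0 0 1) \<longrightarrow> holds M E (singles X) (singles Y))))"
        by (intro arg_cong[of _ _ All] ext imp_cong refl)
          (simp_all add: sat_injection_V sat_sub_rng sat_app2[OF fv_E])
      also have "\<dots> \<longleftrightarrow> (\<forall>f. ifun (dom M) f \<longrightarrow> inj_on f (dom M) \<longrightarrow>
          (\<forall>X. iset X \<longrightarrow> X \<subseteq> rng M 0 \<longrightarrow>
            (\<forall>Y. iset Y \<longrightarrow> sat M e (?r' (\<lambda>a b. a \<in> dom M \<and> b = f a) X Y) (image_of 0 0 1) \<longrightarrow>
              holds M E (singles X) (singles Y))))"
        unfolding ifun_def by blast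
      also have "\<dots> \<longleftrightarrow> (\<forall>f. ifun (dom M) f \<longrightarrow> inj_on f (dom M) \<longrightarrow>
          (\<forall>X. iset X \<longrightarrow> X \<subseteq> rng M 0 \<longrightarrow>
            (\<forall>Y. iset Y \<longrightarrow> Y = f ` X \<longrightarrow> holds M E (singles X) (singles Y))))"
      proof (intro arg_cong[of _ _ All] ext imp_cong refl)
        fix f X Y assume "ifun (dom M) f" "iset X" "iset Y"
        then show "sat M e (?r' (\<lambda>a b. a \<in> dom M \<and> b = f a) X Y) (image_of 0 0 1) \<longleftrightarrow> Y = f ` X"
          by (intro sat_image_of[of "dom M"] iset_subset) simp_all
      qed
      also have "\<dots> \<longleftrightarrow> (\<forall>X f. iset X \<longrightarrow> X \<subseteq> rng M 0 \<longrightarrow> ifun (dom M) f \<longrightarrow>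
          inj_on f (dom M) \<longrightarrow> holds M E (singles X) (singles (f ` X)))"
        using iset_image iset_subset by blast
      finally show "sat M e r ?p \<longleftrightarrow> (\<forall>X f. iset X \<longrightarrow> X \<subseteq> rng M 0 \<longrightarrow> ifun (dom M) f \<longrightarrow>
          inj_on f (dom M) \<longrightarrow> holds M E (singles X) (singles (f ` X)))" .
    qed
  qed
  then show ?thesis
    unfolding injection_invariant_on_abstracts_def invariant_def
      proves_iff_valid[OF assms abs_theory_lang[OF syms_E] p]
    by blast
qed

text \<open>The formula speaks of bijections from \<open>Y\<close> onto \<open>X\<close>, while
  \<open>invariant\<close> starts from injections on \<open>X\<close>; inverses, which are again
  functions of the model, pass between the two.\<close>

lemma cardinality_coarsening_iff:
  assumes "infinite (UNIV :: 'a set)"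
  shows "cardinality_coarsening_on_abstracts E \<longleftrightarrow> invariant E (\<lambda>(M :: 'a model) X. X)"
proof -
  let ?p = "AllR 0 0 (AllR 0 1 (Imp (Conj (equinumerous 1 0) (sub_rng 0)) (app2 E 0 1)))"
  have p: "?p \<in> lang {0}"
    using syms_E by (auto simp: lang_def equinumerous_def bijection_def sub_rng_def app2_def syms_subst)
  have "valid_in M ?p \<longleftrightarrow> (\<forall>X f. base_model.iset M X \<longrightarrow> X \<subseteq> rng M 0 \<longrightarrow> base_model.ifun M X f \<longrightarrow>
      inj_on f X \<longrightarrow> holds M E (singles X) (singles (f ` X)))"
    if M: "is_model {0} M (A_theory E)" for M :: "'a model"
  proof -
    interpret base_model "{0}" M by (rule modelD(1)[OF M])
    show ?thesis
    proof (rule valid_in_closed)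
      fix e :: "nat \<Rightarrow> 'a" and r :: "nat \<Rightarrow> nat \<Rightarrow> 'a list set"
      let ?r = "\<lambda>X Y. (r(0 := (r 0)(0 := singles X)))(0 := ((r(0 := (r 0)(0 := singles X))) 0)(1 := singles Y))"
      have "sat M e r ?p \<longleftrightarrow> (\<forall>X. iset X \<longrightarrow> (\<forall>Y. iset Y \<longrightarrow>
          sat M e (?r X Y) (Conj (equinumerous 1 0) (sub_rng 0)) \<longrightarrow> sat M e (?r X Y) (app2 E 0 1)))"
        unfolding sat.simps(8) ball_rels_0 by (subst sat.simps(6)) (rule refl)
      also have "\<dots> \<longleftrightarrow> (\<forall>X. iset X \<longrightarrow> (\<forall>Y. iset Y \<longrightarrow>
          (\<exists>g. ifun Y g \<and> inj_on g Y \<and> g ` Y = X) \<and> X \<subseteq> rng M 0 \<longrightarrow> holds M E (singles X) (singles Y)))"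
        unfolding sat_Conj sat_app2[OF fv_E]
      proof (intro arg_cong[of _ _ All] ext imp_cong refl arg_cong2[of _ _ _ _ "(\<and>)"])
        fix X Y assume "iset X" "iset Y"
        then show "sat M e (?r X Y) (equinumerous 1 0) \<longleftrightarrow> (\<exists>g. ifun Y g \<and> inj_on g Y \<and> g ` Y = X)"
          by (intro sat_equinumerous) simp_all
        show "sat M e (?r X Y) (sub_rng 0) \<longleftrightarrow> X \<subseteq> rng M 0"
          by (rule sat_sub_rng) (simp_all add: \<open>iset X\<close>)
      qed simp
      also have "\<dots> \<longleftrightarrow> (\<forall>X f. iset X \<longrightarrow> X \<subseteq> rng M 0 \<longrightarrow> ifun X f \<longrightarrow>
          inj_on f X \<longrightarrow> holds M E (singles X) (singles (f ` X)))" (is "?L \<longleftrightarrow> ?R")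
      proof
        assume L: ?L
        show ?R
        proof (intro allI impI)
          fix X f assume X: "iset X" "X \<subseteq> rng M 0" and f: "ifun X f" "inj_on f X"
          have "ifun (f ` X) (the_inv_into X f)" "inj_on (the_inv_into X f) (f ` X)"
            "the_inv_into X f ` f ` X = X"
            using ifun_inv[OF f] inj_on_the_inv_into[OF f(2)] the_inv_into_onto[OF f(2)] by simp_all
          moreover have "iset (f ` X)" using iset_image[OF f(1) X(1)] by simp
          ultimately show "holds M E (singles X) (singles (f ` X))" using L X by blast
        qed
      next
        assume R: ?R
        show ?L
        proof (intro allI impI, elim conjE exE)
          fix X Y g assume X: "iset X" "X \<subseteq> rng M 0" and g: "ifun Y g" "inj_on g Y" "g ` Y = X"
          have "ifun X (the_inv_into Y g)" "inj_on (the_inv_into Y g) X" "the_inv_into Y g ` X = Y"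
            using ifun_inv[OF g(1,2)] inj_on_the_inv_into[OF g(2)] the_inv_into_onto[OF g(2)] g(3) by simp_all
          then show "holds M E (singles X) (singles Y)" using R X by metis
        qed
      qed
      finally show "sat M e r ?p \<longleftrightarrow> (\<forall>X f. iset X \<longrightarrow> X \<subseteq> rng M 0 \<longrightarrow> ifun X f \<longrightarrow>
          inj_on f X \<longrightarrow> holds M E (singles X) (singles (f ` X)))" .
    qed
  qed
  then show ?thesis
    unfolding cardinality_coarsening_on_abstracts_def invariant_def
      proves_iff_valid[OF assms abs_theory_lang[OF syms_E] p]
    by blast
qed

end

theorem theorem1:
  fixes E :: fm
  assumes "infinite (UNIV :: 'a set)"
    and "syms E = {}"
    and "fv E = {RV 0 0, RV 0 1}"
    and "provably_equivalence E"
  shows "(naturally_relatively_categorical TYPE('a) E \<longleftrightarrow> injection_invariant_on_abstracts E) \<and>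
         (injection_invariant_on_abstracts E \<longleftrightarrow> cardinality_coarsening_on_abstracts E)"
proof -
  interpret abstraction_formula E using assms(2,3) by unfold_locales
  have rng_dom: "X \<subseteq> dom M" if "is_model {0} M (A_theory E)" "X \<subseteq> rng M 0" for M :: "'a model" and X
  proof -
    interpret base_model "{0}" M by (rule modelD(1)[OF that(1)])
    show ?thesis using iset_subset[OF iset_rng[of 0]] that(2) by blast
  qed
  \<comment> \<open>The cycle runs from \<open>V\<close> to \<open>rng(\<partial>)\<close>, on to
    \<open>X\<close>, and back to \<open>V\<close> by restricting an injection of \<open>V\<close>
    to \<open>X\<close>.\<close>
  have "invariant E (\<lambda>(M :: 'a model) X. dom M) \<longleftrightarrow> invariant E (\<lambda>(M :: 'a model) X. X)"
    using invariant_restrict[of "\<lambda>M X. dom M"] rng_dom invariant_rng invariant_self by blast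
  moreover have "naturally_relatively_categorical TYPE('a) E \<longleftrightarrow> invariant E (\<lambda>(M :: 'a model) X. X)"
    using categorical_imp_invariant invariant_self invariant_imp_categorical by blast
  ultimately show ?thesis
    unfolding injection_invariant_iff[OF assms(1)] cardinality_coarsening_iff[OF assms(1)] by blast
qed

end
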